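(* Let $w$ be a Lévy white noise in $\mathcal{S}'(\mathbb{R}^d)$ (satisfying the sector condition) whose indices satisfy $0<\underline{\beta}_\infty\le\beta_\infty<p_{\max}$. Let $\psi\neq0$ be a bounded and compactly supported test function on $\mathbb{R}^d$, and let $0<p<\beta_\infty$. Then, for $\epsilon>0$ small enough, there exist constants $A,B>0$, independent of $j\in\mathbb{N}$ and $k\in\mathbb{Z}^d$, such that $$A\,2^{-j\epsilon}\,2^{jdp\left(\frac12-\frac1{\underline{\beta}_\infty}\right)}\ \le\ \mathbb{E}\big[|\langle w,\psi_{j,k}\rangle|^p\big]\ \le\ B\,2^{j\epsilon}\,2^{jdp\left(\frac12-\frac1{\beta_\infty}\right)}$$ for every $j\in\mathbb{N}$ and $k\in\mathbb{Z}^d$, where $\psi_{j,k}=2^{jd/2}\psi(2^j\cdot-k)$.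
   Context: Fix $d\ge1$ and a complete probability space; $\mathbb{N}=\{0,1,2,\dots\}$. $\mathcal{S}(\mathbb{R}^d)$ is the space of rapidly decaying smooth functions $\mathbb{R}^d\to\mathbb{R}$, and $\mathcal{S}'(\mathbb{R}^d)$ its dual with the strong topology and its Borel $\sigma$-field; a generalized random process is a measurable map from the probability space to $\mathcal{S}'(\mathbb{R}^d)$. A characteristic exponent is a function $\Psi(\xi)=\mathrm{i}\mu\xi-\frac{\sigma^2\xi^2}{2}+\int_{\mathbb{R}}(e^{\mathrm{i}\xi t}-1-\mathrm{i}\xi t\mathbf{1}_{|t|\le1})\,d\nu(t)$ with $\mu\in\mathbb{R}$, $\sigma^2\ge0$, and $\nu$ a Lévy measure (positive, $\nu(\{0\})=0$, $\int\min(1,t^2)d\nu(t)<\infty$). A Lévy white noise is a generalized random process $w$ with $\mathbb{E}[e^{\mathrm{i}\langle w,\varphi\rangle}]=\exp(\int_{\mathbb{R}^d}\Psi(\varphi(x))dx)$ for all $\varphi\in\mathcal{S}(\mathbb{R}^d)$, where $\Psi$ is a characteristic exponent satisfying the $\epsilon$-condition: $\int\min(|t|^\varepsilon,t^2)d\nu(t)<\infty$ for some $\varepsilon>0$. For compactly supported $\varphi\in L_2(\mathbb{R}^d)$, $\langle w,\varphi\rangle$ is defined as the limit in probability of $\langle w,\varphi_n\rangle$ for $\varphi_n\in\mathcal{S}(\mathbb{R}^d)$ approximating $\varphi$. Sector condition: there is $M>0$ with $|\Im\Psi(\xi)|\le M|\Re\Psi(\xi)|$ for all $\xi\in\mathbb{R}$.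 Indices: $\beta_\infty=\inf\{q>0:\lim_{|\xi|\to\infty}|\Psi(\xi)|/|\xi|^q=0\}$, $\underline{\beta}_\infty=\inf\{q>0:\liminf_{|\xi|\to\infty}|\Psi(\xi)|/|\xi|^q=0\}$, $p_{\max}=\sup\{q>0:\mathbb{E}[|\langle w,\mathbf{1}_{[0,1]^d}\rangle|^q]<\infty\}\in(0,\infty]$. *)

theory Defs
  imports "HOL-Probability.Probability"
begin

section \<open>Schwartz space and tempered distributions\<close>

primrec partials :: "'d::finite list \<Rightarrow> (real^'d \<Rightarrow> real) \<Rightarrow> real^'d \<Rightarrow> real" where
  "partials [] f = f"
| "partials (i # is) f = (\<lambda>x. frechet_derivative (partials is f) (at x) (axis i 1))"

definition smooth :: "(real^'d::finite \<Rightarrow> real) \<Rightarrow> bool" where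
  "smooth f \<longleftrightarrow> (\<forall>is. partials is f differentiable_on UNIV)"

definition schwartz :: "(real^'d::finite \<Rightarrow> real) set" where
  "schwartz = {f. smooth f \<and>
     (\<forall>n is. bdd_above (range (\<lambda>x. norm x ^ n * \<bar>partials is f x\<bar>)))}"

definition schwartz_seminorm :: "nat \<Rightarrow> 'd::finite list \<Rightarrow> (real^'d \<Rightarrow> real) \<Rightarrow> real" where
  "schwartz_seminorm n is f = (SUP x. norm x ^ n * \<bar>partials is f x\<bar>)"

definition schwartz_topology :: "(real^'d::finite \<Rightarrow> real) topology" where
  "schwartz_topology = topology_generated_by
     {{g \<in> schwartz. schwartz_seminorm n is (\<lambda>x. g x - f x) < e} | f n is e.
        f \<in> schwartz \<and> 0 < e}"

definition schwartz_bounded :: "(real^'d::finite \<Rightarrow> real) set \<Rightarrow> bool" where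
  "schwartz_bounded B \<longleftrightarrow>
     B \<subseteq> schwartz \<and> (\<forall>n is. bdd_above (schwartz_seminorm n is ` B))"

text \<open>Functionals are represented as functions on \<^term>\<open>schwartz\<close> that take a fixed dummy value
  elsewhere, so that two functionals are equal iff they agree on \<^term>\<open>schwartz\<close>.\<close>

definition tempered_distributions :: "((real^'d::finite \<Rightarrow> real) \<Rightarrow> real) set" where
  "tempered_distributions = {u \<in> extensional schwartz.
     (\<forall>f\<in>schwartz. \<forall>g\<in>schwartz. u (\<lambda>x. f x + g x) = u f + u g) \<and>
     (\<forall>f\<in>schwartz. \<forall>c. u (\<lambda>x. c * f x) = c * u f) \<and>
     continuous_map schwartz_topology euclideanreal u}"

text \<open>Strong topology: uniform convergence on bounded subsets.\<close>

definition strong_dual_topology :: "((real^'d::finite \<Rightarrow> real) \<Rightarrow> real) topology" where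
  "strong_dual_topology = topology_generated_by
     {{v \<in> tempered_distributions. (SUP f\<in>B. \<bar>v f - u f\<bar>) < e} | u B e.
        u \<in> tempered_distributions \<and> schwartz_bounded B \<and> B \<noteq> {} \<and> 0 < e}"

definition strong_dual_borel :: "((real^'d::finite \<Rightarrow> real) \<Rightarrow> real) measure" where
  "strong_dual_borel = sigma tempered_distributions {U. openin strong_dual_topology U}"


section \<open>L\'evy white noise\<close>

definition levy_measure :: "real measure \<Rightarrow> bool" where
  "levy_measure \<nu> \<longleftrightarrow> sets \<nu> = sets borel \<and> emeasure \<nu> {0} = 0 \<and>
     (\<integral>\<^sup>+t. ennreal (min 1 (t\<^sup>2)) \<partial>\<nu>) < \<infinity>"

definition levy_exponent :: "real \<Rightarrow> real \<Rightarrow> real measure \<Rightarrow> real \<Rightarrow> complex" where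
  "levy_exponent \<mu> \<sigma>2 \<nu> \<xi> =
     \<i> * of_real (\<mu> * \<xi>) - of_real (\<sigma>2 * \<xi>\<^sup>2 / 2) +
     (\<integral>t. iexp (\<xi> * t) - 1 - \<i> * of_real (\<xi> * t * indicator {-1..1} t) \<partial>\<nu>)"

definition eps_condition :: "real measure \<Rightarrow> bool" where
  "eps_condition \<nu> \<longleftrightarrow> (\<exists>\<epsilon>>0. (\<integral>\<^sup>+t. ennreal (min (\<bar>t\<bar> powr \<epsilon>) (t\<^sup>2)) \<partial>\<nu>) < \<infinity>)"

definition levy_white_noise ::
    "'w measure \<Rightarrow> (real \<Rightarrow> complex) \<Rightarrow> ('w \<Rightarrow> (real^'d::finite \<Rightarrow> real) \<Rightarrow> real) \<Rightarrow> bool" where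
  "levy_white_noise M \<Psi> w \<longleftrightarrow>
     w \<in> measurable M strong_dual_borel \<and>
     (\<exists>\<mu> \<sigma>2 \<nu>. 0 \<le> \<sigma>2 \<and> levy_measure \<nu> \<and> eps_condition \<nu> \<and> \<Psi> = levy_exponent \<mu> \<sigma>2 \<nu>) \<and>
     (\<forall>\<phi>\<in>schwartz. (\<integral>\<omega>. iexp (w \<omega> \<phi>) \<partial>M) = exp (\<integral>x. \<Psi> (\<phi> x) \<partial>lborel))"

definition sector_condition :: "(real \<Rightarrow> complex) \<Rightarrow> bool" where
  "sector_condition \<Psi> \<longleftrightarrow> (\<exists>C>0. \<forall>\<xi>. \<bar>Im (\<Psi> \<xi>)\<bar> \<le> C * \<bar>Re (\<Psi> \<xi>)\<bar>)"


section \<open>Pairing with compactly supported square-integrable functions\<close>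

definition tendsto_in_prob :: "'w measure \<Rightarrow> (nat \<Rightarrow> 'w \<Rightarrow> real) \<Rightarrow> ('w \<Rightarrow> real) \<Rightarrow> bool" where
  "tendsto_in_prob M X Y \<longleftrightarrow>
     (\<forall>e>0. (\<lambda>n. measure M {\<omega> \<in> space M. e < \<bar>X n \<omega> - Y \<omega>\<bar>}) \<longlonglongrightarrow> 0)"

text \<open>The supports have to stay in one compact set: on a domain of infinite measure,
  convergence in \<open>L\<^sub>2\<close> does not control, for instance, the drift term
  \<open>\<mu> * (\<integral>x. \<phi> x \<partial>lborel)\<close>.\<close>

definition approximates :: "(nat \<Rightarrow> real^'d::finite \<Rightarrow> real) \<Rightarrow> (real^'d \<Rightarrow> real) \<Rightarrow> bool" where
  "approximates \<phi>s \<phi> \<longleftrightarrow>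
     (\<forall>n. \<phi>s n \<in> schwartz) \<and>
     (\<exists>K. compact K \<and> (\<forall>n. {x. \<phi>s n x \<noteq> 0} \<subseteq> K)) \<and>
     ((\<lambda>n. \<integral>\<^sup>+x. ennreal ((\<phi>s n x - \<phi> x)\<^sup>2) \<partial>lebesgue) \<longlonglongrightarrow> 0)"

text \<open>Meaningful for compactly supported \<open>\<phi> \<in> L\<^sub>2\<close>; the random variable is then unique
  up to almost sure equality.\<close>

definition pairing ::
    "'w measure \<Rightarrow> ('w \<Rightarrow> (real^'d::finite \<Rightarrow> real) \<Rightarrow> real) \<Rightarrow> (real^'d \<Rightarrow> real) \<Rightarrow> 'w \<Rightarrow> real" where
  "pairing M w \<phi> = (SOME X. X \<in> borel_measurable M \<and>
     (\<forall>\<phi>s. approximates \<phi>s \<phi> \<longrightarrow> tendsto_in_prob M (\<lambda>n \<omega>. w \<omega> (\<phi>s n)) X))"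

definition abs_moment :: "'w measure \<Rightarrow> real \<Rightarrow> ('w \<Rightarrow> real) \<Rightarrow> ennreal" where
  "abs_moment M q X = (\<integral>\<^sup>+\<omega>. ennreal (\<bar>X \<omega>\<bar> powr q) \<partial>M)"


section \<open>Indices\<close>

text \<open>For a characteristic exponent, \<open>\<Psi> \<xi> = O(\<xi>\<^sup>2)\<close> at infinity, so both sets below contain
  every \<open>q > 2\<close> and the real infima are infima of nonempty sets.\<close>

definition beta_upper :: "(real \<Rightarrow> complex) \<Rightarrow> real" where
  "beta_upper \<Psi> = Inf {q. 0 < q \<and> ((\<lambda>\<xi>. cmod (\<Psi> \<xi>) / \<bar>\<xi>\<bar> powr q) \<longlongrightarrow> 0) at_infinity}"

definition beta_lower :: "(real \<Rightarrow> complex) \<Rightarrow> real" where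
  "beta_lower \<Psi> =
     Inf {q. 0 < q \<and> Liminf at_infinity (\<lambda>\<xi>. ereal (cmod (\<Psi> \<xi>) / \<bar>\<xi>\<bar> powr q)) = 0}"

definition p_max :: "'w measure \<Rightarrow> ('w \<Rightarrow> (real^'d::finite \<Rightarrow> real) \<Rightarrow> real) \<Rightarrow> ereal" where
  "p_max M w = Sup {ereal q | q. 0 < q \<and>
     abs_moment M q (pairing M w (indicator {x. \<forall>i. 0 \<le> x $ i \<and> x $ i \<le> 1})) < \<infinity>}"


definition rescaled :: "(real^'d::finite \<Rightarrow> real) \<Rightarrow> nat \<Rightarrow> int^'d \<Rightarrow> real^'d \<Rightarrow> real" where
  "rescaled \<psi> j k x =
     2 powr (real j * real CARD('d) / 2) * \<psi> (2 ^ j *\<^sub>R x - (\<chi> i. real_of_int (k $ i)))"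

end

theory Submission
  imports Defs "HOL-Computational_Algebra.Polynomial"
begin

text \<open>
  For \<open>0 < p < 2\<close> the \<open>p\<close>-th absolute moment of a random variable is, up to a constant, the integral of
  \<open>(1 - Re \<Phi> \<xi>) \<xi>\<^sup>-\<^sup>p\<^sup>-\<^sup>1\<close> over \<open>\<xi> > 0\<close>, where \<open>\<Phi>\<close> is its characteristic function. For the pairing with
  \<open>\<psi>\<^sub>j\<^sub>,\<^sub>k\<close> one has \<open>\<Phi> \<xi> = exp (2\<^sup>-\<^sup>j\<^sup>d \<integral> \<Psi> (2\<^sup>j\<^sup>d\<^sup>/\<^sup>2 \<xi> \<psi> y) dy)\<close>, independently of \<open>k\<close>.
  If \<open>\<bar>\<Psi> \<xi>\<bar> \<le> C \<bar>\<xi>\<bar>\<^sup>q\<close> everywhere, the moment is at most a constant times \<open>2\<close> to the power \<open>j d p (1/2 - 1/q)\<close>;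
  if \<open>- Re \<Psi> \<xi> \<ge> c \<bar>\<xi>\<bar>\<^sup>q\<close> for large \<open>\<bar>\<xi>\<bar>\<close>, it is at least such a multiple. The first bound holds for \<open>q\<close>
  slightly above the upper index (finiteness of moments handles small \<open>\<xi>\<close>), the second, by the sector
  condition, for \<open>q\<close> slightly below the lower index.

  The pairing exists since for every \<open>\<eta> > 0\<close> there is \<open>C\<close> with \<open>\<bar>\<Psi> \<xi>\<bar> \<le> \<eta> + C \<xi>\<^sup>2\<close>: functions with supports in one
  compact set that tend to \<open>0\<close> in \<open>L\<^sub>2\<close> are mapped by the noise to variables tending to \<open>0\<close> in probability.
\<close>

section \<open>Characteristic exponents\<close>

text \<open>Three obstacles shape the proof. \<open>pairing\<close> is a choice by
  \<open>SOME\<close>, so nothing is known about it until a limit in probability has been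
  constructed that serves all approximating sequences at once; its characteristic function then
  needs bounded Schwartz approximants with one common support, obtained as a bump function times a
  polynomial. Next, the indices describe \<Psi> only at infinity, while the moment integral runs
  over all frequencies. The gap near 0 is closed by testing the noise on the unit cube, where its
  characteristic exponent is \<Psi> itself, and by passing from the real part to the modulus with
  the sector condition. Since \<open>p_max\<close> exceeds the upper index, one exponent can serve
  both near 0 and at infinity. Finally, the inequality
  \<open>1 - cos u \<le> 2 * \<bar>u\<bar> powr q\<close> used there holds only for
  \<open>q \<le> 2\<close>, so an upper index equal to 2 leaves no room above it; the exponent 2
  itself is then used, which the quadratic growth of \<Psi> permits. The factors 2^(j eps) pay for
  replacing the indices by nearby exponents.\<close>

definition levy_integrand :: "real \<Rightarrow> real \<Rightarrow> complex" where
  "levy_integrand \<xi> t = iexp (\<xi> * t) - 1 - \<i> * of_real (\<xi> * t * indicator {-1..1} t)"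

text \<open>Second-order Taylor bound where the compensator is active, trivial bound 2 where it is
  cut off. The factor \<open>min 1 (t\<^sup>2)\<close> is exactly what a Levy measure
  integrates.\<close>

lemma norm_levy_integrand_le:
  "cmod (levy_integrand \<xi> t) \<le> (2 + \<xi>\<^sup>2) * min 1 (t\<^sup>2)"
proof (cases "t \<in> {-1..1}")
  case True
  then have t: "min 1 (t\<^sup>2) = t\<^sup>2" using abs_square_le_1[of t] by (simp add: abs_le_iff)
  have "cmod (iexp (\<xi> * t) - 1 - \<i> * of_real (\<xi> * t)) \<le> \<bar>\<xi> * t\<bar>\<^sup>2 / 2"
    using iexp_approx1[of "\<xi> * t" 1] by (simp add: diff_diff_eq eval_nat_numeral)
  also have "\<dots> \<le> (2 + \<xi>\<^sup>2) * t\<^sup>2"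
  proof -
    have "0 \<le> \<xi>\<^sup>2 * t\<^sup>2" "0 \<le> t\<^sup>2" by auto
    then show ?thesis by (simp add: distrib_right power_mult_distrib)
  qed
  finally show ?thesis using True t by (simp add: levy_integrand_def)
next
  case False
  then have "1 \<le> \<bar>t\<bar>" by auto
  then have t: "min 1 (t\<^sup>2) = 1" using abs_le_square_iff[of 1 t] by simp
  have "cmod (iexp (\<xi> * t) - 1) \<le> 2"
    using norm_triangle_ineq4[of "iexp (\<xi> * t)" 1] by simp
  moreover have "0 \<le> \<xi>\<^sup>2" by simp
  ultimately have "cmod (iexp (\<xi> * t) - 1) \<le> 2 + \<xi>\<^sup>2" by linarith
  then show ?thesis using False t by (simp add: levy_integrand_def)
qed

lemma measurable_levy_integrand [measurable]: "levy_integrand \<xi> \<in> borel_measurable borel"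
  unfolding levy_integrand_def by measurable

lemma levy_exponent_alt:
  "levy_exponent \<mu> \<sigma>2 \<nu> \<xi> = \<i> * of_real (\<mu> * \<xi>) - of_real (\<sigma>2 * \<xi>\<^sup>2 / 2) +
     (\<integral>t. levy_integrand \<xi> t \<partial>\<nu>)"
  by (simp add: levy_exponent_def levy_integrand_def)

context
  fixes \<nu> :: "real measure"
  assumes \<nu>: "levy_measure \<nu>"
begin

lemma levy_measure_sets [measurable_cong]: "sets \<nu> = sets borel"
  using \<nu> by (simp add: levy_measure_def)

lemma integrable_min_levy: "integrable \<nu> (\<lambda>t. min 1 (t\<^sup>2))"
  using \<nu> by (intro integrableI_nonneg) (auto simp: levy_measure_def)

lemma integrable_levy_integrand: "integrable \<nu> (levy_integrand \<xi>)"
  by (rule Bochner_Integration.integrable_bound[where f="\<lambda>t. (2 + \<xi>\<^sup>2) * min 1 (t\<^sup>2)"])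
     (auto intro!: integrable_mult_right integrable_min_levy order_trans[OF norm_levy_integrand_le])

lemma isCont_integral_levy_integrand: "isCont (\<lambda>\<xi>. \<integral>t. levy_integrand \<xi> t \<partial>\<nu>) \<xi>"
  unfolding continuous_at_sequentially o_def
proof safe
  fix u assume u: "u \<longlonglongrightarrow> \<xi>"
  \<comment> \<open>A convergent sequence is bounded; the bound makes the dominating function
    independent of n.\<close>
  then obtain K where K: "\<And>n. \<bar>u n\<bar> \<le> K"
    using convergent_imp_Bseq[of u] by (auto simp: convergent_def Bseq_def)
  show "(\<lambda>n. \<integral>t. levy_integrand (u n) t \<partial>\<nu>) \<longlonglongrightarrow> (\<integral>t. levy_integrand \<xi> t \<partial>\<nu>)"
  proof (rule integral_dominated_convergence[where w="\<lambda>t. (2 + K\<^sup>2) * min 1 (t\<^sup>2)"])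
    show "AE t in \<nu>. (\<lambda>n. levy_integrand (u n) t) \<longlonglongrightarrow> levy_integrand \<xi> t"
      unfolding levy_integrand_def by (intro AE_I2 tendsto_intros u)
    fix n
    have "(u n)\<^sup>2 \<le> K\<^sup>2" using power_mono[OF K[of n], of 2] by simp
    then have "(2 + (u n)\<^sup>2) * min 1 (t\<^sup>2) \<le> (2 + K\<^sup>2) * min 1 (t\<^sup>2)" for t :: real
      by (intro mult_right_mono) auto
    then show "AE t in \<nu>. norm (levy_integrand (u n) t) \<le> (2 + K\<^sup>2) * min 1 (t\<^sup>2)"
      using norm_levy_integrand_le order_trans by (intro AE_I2) blast
  qed (auto intro!: integrable_min_levy)
qed

lemma continuous_on_levy_exponent: "continuous_on UNIV (levy_exponent \<mu> \<sigma>2 \<nu>)"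
proof -
  have "isCont (\<lambda>\<xi>. levy_exponent \<mu> \<sigma>2 \<nu> \<xi>) \<xi>" for \<xi>
    unfolding levy_exponent_alt
    by (intro continuous_intros isCont_integral_levy_integrand) auto
  then show ?thesis by (simp add: continuous_on_eq_continuous_at)
qed

lemma Re_levy_exponent_nonpos:
  assumes "0 \<le> \<sigma>2"
  shows "Re (levy_exponent \<mu> \<sigma>2 \<nu> \<xi>) \<le> 0"
proof -
  have "Re (\<integral>t. levy_integrand \<xi> t \<partial>\<nu>) = (\<integral>t. Re (levy_integrand \<xi> t) \<partial>\<nu>)"
    by (simp add: integrable_levy_integrand)
  also have "\<dots> \<le> (\<integral>t. 0 \<partial>\<nu>)"
    by (intro integral_mono integrable_Re integrable_levy_integrand)
       (auto simp: levy_integrand_def Re_exp)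
  finally have "Re (\<integral>t. levy_integrand \<xi> t \<partial>\<nu>) \<le> 0" by simp
  moreover have "0 \<le> \<sigma>2 * \<xi>\<^sup>2" using assms by simp
  ultimately show ?thesis by (simp add: levy_exponent_alt)
qed

text \<open>Integrating the bound on the integrand adds a multiple of
  \<open>2 + \<xi>\<^sup>2\<close> to the drift and the Gaussian part. Later this growth bound
  stands in for the Levy triplet whenever a dominating function is needed.\<close>

lemma norm_levy_exponent_le: "\<exists>C\<ge>0. \<forall>\<xi>. cmod (levy_exponent \<mu> \<sigma>2 \<nu> \<xi>) \<le> C * (1 + \<xi>\<^sup>2)"
proof (intro exI conjI allI)
  let ?m = "\<integral>t. min 1 (t\<^sup>2) \<partial>\<nu>"
  let ?C = "\<bar>\<mu>\<bar> + \<bar>\<sigma>2\<bar> + 2 * ?m"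
  have m: "0 \<le> ?m" by (intro integral_nonneg_AE AE_I2) auto
  then show "0 \<le> ?C" by simp
  fix \<xi> :: real
  have "cmod (\<integral>t. levy_integrand \<xi> t \<partial>\<nu>) \<le> (\<integral>t. cmod (levy_integrand \<xi> t) \<partial>\<nu>)"
    by (rule integral_norm_bound)
  also have "\<dots> \<le> (\<integral>t. (2 + \<xi>\<^sup>2) * min 1 (t\<^sup>2) \<partial>\<nu>)"
    by (intro integral_mono norm_levy_integrand_le integrable_norm integrable_levy_integrand
        integrable_mult_right integrable_min_levy)
  also have "\<dots> = (2 + \<xi>\<^sup>2) * ?m" by simp
  finally have 1: "cmod (\<integral>t. levy_integrand \<xi> t \<partial>\<nu>) \<le> (2 + \<xi>\<^sup>2) * ?m" .
  have "cmod (levy_exponent \<mu> \<sigma>2 \<nu> \<xi>) \<le> cmod (\<i> * of_real (\<mu> * \<xi>)) +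
     cmod (of_real (\<sigma>2 * \<xi>\<^sup>2 / 2)) + cmod (\<integral>t. levy_integrand \<xi> t \<partial>\<nu>)"
    unfolding levy_exponent_alt using norm_triangle_ineq norm_triangle_ineq4 order_trans add_right_mono by meson
  also have "\<dots> \<le> \<bar>\<mu>\<bar> * (1 + \<xi>\<^sup>2) + \<bar>\<sigma>2\<bar> * (1 + \<xi>\<^sup>2) + (2 + \<xi>\<^sup>2) * ?m"
  proof (intro add_mono 1)
    have "0 \<le> (\<bar>\<xi>\<bar> - 1)\<^sup>2" by simp
    then have "2 * \<bar>\<xi>\<bar> \<le> 1 + \<xi>\<^sup>2" unfolding power2_diff by simp
    then have "\<bar>\<xi>\<bar> \<le> 1 + \<xi>\<^sup>2" by (smt (verit) abs_ge_zero)
    then show "cmod (\<i> * of_real (\<mu> * \<xi>)) \<le> \<bar>\<mu>\<bar> * (1 + \<xi>\<^sup>2)"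
      by (auto simp: norm_mult abs_mult intro!: mult_left_mono)
    have "\<bar>\<sigma>2\<bar> * (\<xi>\<^sup>2 / 2) \<le> \<bar>\<sigma>2\<bar> * (1 + \<xi>\<^sup>2)"
      by (intro mult_left_mono) (auto simp: add_increasing)
    then show "cmod (of_real (\<sigma>2 * \<xi>\<^sup>2 / 2)) \<le> \<bar>\<sigma>2\<bar> * (1 + \<xi>\<^sup>2)"
      by (simp only: norm_of_real) (simp add: abs_mult)
  qed
  also have "\<dots> \<le> ?C * (1 + \<xi>\<^sup>2)"
    using m mult_nonneg_nonneg[OF m, of "\<xi>\<^sup>2"] by (simp add: algebra_simps)
  finally show "cmod (levy_exponent \<mu> \<sigma>2 \<nu> \<xi>) \<le> ?C * (1 + \<xi>\<^sup>2)" .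
qed

end

lemma levy_exponent_0: "levy_exponent \<mu> \<sigma>2 \<nu> 0 = 0"
  by (simp add: levy_exponent_def)

section \<open>Schwartz functions\<close>

text \<open>Since \<open>d/dt (q(1/t) e\<^sup>-\<^sup>1\<^sup>/\<^sup>t) = t\<^sup>-\<^sup>2 (q - q')(1/t) e\<^sup>-\<^sup>1\<^sup>/\<^sup>t\<close>, all
  derivatives of the standard bump \<open>q = 1\<close> have this form.\<close>

definition bump :: "real poly \<Rightarrow> real \<Rightarrow> real" where
  "bump q t = (if 0 < t then poly q (1 / t) * exp (- (1 / t)) else 0)"

lemma poly_exp_tendsto_0: "((\<lambda>x::real. poly q x * exp (- x)) \<longlongrightarrow> 0) at_top"
proof (induction q)
  case (pCons a q)
  have 1: "((\<lambda>x::real. a * exp (- x)) \<longlongrightarrow> 0) at_top"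
    using tendsto_mult_right_zero[OF filterlim_compose[OF exp_at_bot filterlim_uminus_at_bot_at_top], of a] .
  have "((\<lambda>x::real. x * poly q x * exp (- x)) \<longlongrightarrow> 0) at_top"
  proof -
    have "((\<lambda>x::real. \<Sum>i\<le>degree q. coeff q i * (x ^ Suc i / exp x)) \<longlongrightarrow> (\<Sum>i\<le>degree q. coeff q i * 0)) at_top"
      by (intro tendsto_intros tendsto_power_div_exp_0)
    then show ?thesis
      by (simp add: poly_altdef sum_distrib_left sum_distrib_right exp_minus field_simps)
  qed
  from tendsto_add[OF 1 this] show ?case by (simp add: algebra_simps)
qed simp

text \<open>This is the difference quotient at 0, the only point where differentiability is in
  doubt. The extra factor 1/t is absorbed by multiplying the polynomial by its variable.\<close>

lemma bump_over_tendsto_0: "((\<lambda>t. bump q t / t) \<longlongrightarrow> 0) (at 0)"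
proof -
  have "((\<lambda>t. poly (pCons 0 q) (1 / t) * exp (- (1 / t))) \<longlongrightarrow> 0) (at_right (0::real))"
    using filterlim_compose[OF poly_exp_tendsto_0 filterlim_inverse_at_top_right, of "pCons 0 q"]
    by (simp add: inverse_eq_divide)
  then have "((\<lambda>t. bump q t / t) \<longlongrightarrow> 0) (at_right 0)"
    by (rule Lim_transform_eventually)
       (auto simp: bump_def eventually_at_right_field intro!: exI[of _ 1])
  moreover have "((\<lambda>t. bump q t / t) \<longlongrightarrow> 0) (at_left 0)"
    by (rule Lim_transform_eventually[OF tendsto_const])
       (auto simp: bump_def eventually_at_left_field intro!: exI[of _ "-1"])
  ultimately show ?thesis by (simp add: filterlim_at_split)
qed

lemma bump_has_derivative:
  "(bump q has_field_derivative bump ([:0, 0, 1:] * (q - pderiv q)) t) (at t)"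
proof -
  consider "t > 0" | "t < 0" | "t = 0" by linarith
  then show ?thesis
  proof cases
    case 1
    have "((\<lambda>t. poly q (1 / t) * exp (- (1 / t))) has_field_derivative
        bump ([:0, 0, 1:] * (q - pderiv q)) t) (at t)"
      using 1 by (auto intro!: derivative_eq_intros poly_DERIV[THEN DERIV_chain2] simp: bump_def power2_eq_square field_simps)
    then show ?thesis
      by (rule has_field_derivative_transform_within_open[of _ _ _ "{0<..}"])
         (use 1 in \<open>auto simp: bump_def\<close>)
  next
    case 2
    have "((\<lambda>t. 0) has_field_derivative bump ([:0, 0, 1:] * (q - pderiv q)) t) (at t)"
      using 2 by (simp add: bump_def)
    then show ?thesis
      by (rule has_field_derivative_transform_within_open[of _ _ _ "{..<0}"])
         (use 2 in \<open>auto simp: bump_def\<close>)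
  next
    case 3
    then show ?thesis using bump_over_tendsto_0[of q]
      by (simp add: has_field_derivative_iff bump_def)
  qed
qed

inductive smooth_expr :: "(real^'d::finite \<Rightarrow> real) \<Rightarrow> bool" where
  lin: "bounded_linear f \<Longrightarrow> smooth_expr f"
| const: "smooth_expr (\<lambda>x. c)"
| add: "smooth_expr f \<Longrightarrow> smooth_expr g \<Longrightarrow> smooth_expr (\<lambda>x. f x + g x)"
| mult: "smooth_expr f \<Longrightarrow> smooth_expr g \<Longrightarrow> smooth_expr (\<lambda>x. f x * g x)"
| bump: "smooth_expr f \<Longrightarrow> smooth_expr (\<lambda>x. bump q (f x))"

lemma smooth_expr_derivative:
  assumes "smooth_expr f"
  shows "\<exists>f'. (\<forall>x. (f has_derivative f' x) (at x)) \<and> (\<forall>v. smooth_expr (\<lambda>x. f' x v))"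
  using assms
proof induction
  case (lin f)
  then show ?case
    by (intro exI[of _ "\<lambda>x. f"]) (auto intro: smooth_expr.const bounded_linear_imp_has_derivative)
next
  case (const c)
  then show ?case
    by (intro exI[of _ "\<lambda>x v. 0"]) (auto intro: smooth_expr.const)
next
  case (add f g)
  then obtain f' g' where fg: "\<And>x. (f has_derivative f' x) (at x)" "\<And>v. smooth_expr (\<lambda>x. f' x v)"
     "\<And>x. (g has_derivative g' x) (at x)" "\<And>v. smooth_expr (\<lambda>x. g' x v)" by metis
  then show ?case
    by (intro exI[of _ "\<lambda>x v. f' x v + g' x v"]) (auto intro!: smooth_expr.add has_derivative_add)
next
  case (mult f g)
  then obtain f' g' where fg: "\<And>x. (f has_derivative f' x) (at x)" "\<And>v. smooth_expr (\<lambda>x. f' x v)"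
     "\<And>x. (g has_derivative g' x) (at x)" "\<And>v. smooth_expr (\<lambda>x. g' x v)" by metis
  then show ?case
    by (intro exI[of _ "\<lambda>x v. f x * g' x v + f' x v * g x"])
       (auto intro!: smooth_expr.add smooth_expr.mult mult.hyps has_derivative_mult)
next
  case (bump f q)
  then obtain f' where f: "\<And>x. (f has_derivative f' x) (at x)" "\<And>v. smooth_expr (\<lambda>x. f' x v)" by metis
  have "((\<lambda>x. bump q (f x)) has_derivative (\<lambda>v. bump ([:0, 0, 1:] * (q - pderiv q)) (f x) * f' x v)) (at x)" for x
    using has_derivative_compose[OF f(1) bump_has_derivative[unfolded has_field_derivative_def]] .
  then show ?case
    by (intro exI[of _ "\<lambda>x v. bump ([:0, 0, 1:] * (q - pderiv q)) (f x) * f' x v"])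
       (intro conjI allI smooth_expr.mult smooth_expr.bump bump.hyps f)
qed

lemma smooth_expr_partials: "smooth_expr f \<Longrightarrow> smooth_expr (partials is f)"
proof (induction "is")
  case (Cons i "is")
  then obtain f' where f: "\<And>x. (partials is f has_derivative f' x) (at x)"
    "\<And>v. smooth_expr (\<lambda>x. f' x v)" using smooth_expr_derivative by metis
  have "partials (i # is) f = (\<lambda>x. f' x (axis i 1))"
    by (simp add: frechet_derivative_at[OF f(1), symmetric])
  then show ?case using f(2) by simp
qed simp

lemma smooth_expr_smooth: "smooth_expr f \<Longrightarrow> smooth f"
  unfolding smooth_def
  using smooth_expr_partials smooth_expr_derivative
  by (metis differentiable_def differentiable_at_withinI differentiable_on_def)

section \<open>Compactly supported smooth functions and the linear structure of the Schwartz
  space\<close>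

lemma partials_zero_on_open:
  assumes "open U" "\<And>x. x \<in> U \<Longrightarrow> f x = 0"
  shows "x \<in> U \<Longrightarrow> partials is f x = 0"
proof (induction "is" arbitrary: x)
  case (Cons i "is")
  have "(partials is f has_derivative (\<lambda>v. 0)) (at x)"
    by (rule has_derivative_transform_within_open[OF has_derivative_const assms(1) Cons.prems])
       (simp add: Cons.IH)
  then show ?case by (simp add: frechet_derivative_at[symmetric])
qed (use assms in auto)

lemma smooth_partials_differentiable: "smooth f \<Longrightarrow> partials is f differentiable at x"
  unfolding smooth_def differentiable_on_def by simp

text \<open>On K all weighted derivatives are continuous, hence bounded; the complement of K is
  open, so every iterated derivative vanishes there.\<close>

lemma smooth_compact_support_schwartz:
  assumes f: "smooth f" and K: "compact K" "\<And>x. x \<notin> K \<Longrightarrow> f x = 0"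
  shows "f \<in> schwartz"
proof -
  have "bdd_above (range (\<lambda>x. norm x ^ n * \<bar>partials is f x\<bar>))" for n "is"
  proof -
    have "continuous_on K (\<lambda>x. norm x ^ n * \<bar>partials is f x\<bar>)"
      using f unfolding smooth_def
      by (intro continuous_intros) (meson continuous_on_subset differentiable_imp_continuous_on subset_UNIV)
    then have "bounded ((\<lambda>x. norm x ^ n * \<bar>partials is f x\<bar>) ` K)"
      by (intro compact_imp_bounded compact_continuous_image K)
    then obtain b where b: "\<And>x. x \<in> K \<Longrightarrow> norm x ^ n * \<bar>partials is f x\<bar> \<le> b"
      by (auto simp: bounded_real)
    have 0: "partials is f x = 0" if "x \<notin> K" for x
      by (rule partials_zero_on_open[of "- K"]) (use K that in \<open>auto simp: open_Compl compact_imp_closed\<close>)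
    have "norm x ^ n * \<bar>partials is f x\<bar> \<le> max b 0" for x
      using b[of x] 0[of x] by (cases "x \<in> K") auto
    then show ?thesis by (intro bdd_aboveI2)
  qed
  then show ?thesis using f by (simp add: schwartz_def)
qed

lemma partials_add:
  assumes "smooth f" "smooth g"
  shows "partials is (\<lambda>x. f x + g x) = (\<lambda>x. partials is f x + partials is g x)"
proof (induction "is")
  case (Cons i "is")
  have "frechet_derivative (\<lambda>x. partials is f x + partials is g x) (at x) =
      (\<lambda>v. frechet_derivative (partials is f) (at x) v + frechet_derivative (partials is g) (at x) v)" for x
    using assms[THEN smooth_partials_differentiable]
    by (intro frechet_derivative_at[symmetric] has_derivative_add frechet_derivative_works[THEN iffD1])
  then show ?case by (simp add: Cons)
qed simp

lemma partials_cmult: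
  assumes "smooth f"
  shows "partials is (\<lambda>x. c * f x) = (\<lambda>x. c * partials is f x)"
proof (induction "is")
  case (Cons i "is")
  have "frechet_derivative (\<lambda>x. c * partials is f x) (at x) =
      (\<lambda>v. c * frechet_derivative (partials is f) (at x) v)" for x
    using assms[THEN smooth_partials_differentiable]
    by (intro frechet_derivative_at[symmetric] has_derivative_mult_right frechet_derivative_works[THEN iffD1])
  then show ?case by (simp add: Cons)
qed simp

lemma schwartz_add:
  assumes "f \<in> schwartz" "g \<in> schwartz"
  shows "(\<lambda>x. f x + g x) \<in> schwartz"
proof -
  have fg: "smooth f" "smooth g" using assms by (auto simp: schwartz_def)
  have "bdd_above (range (\<lambda>x. norm x ^ n * \<bar>partials is f x + partials is g x\<bar>))" for n "is"
  proof -
    obtain a b where ab: "\<And>x. norm x ^ n * \<bar>partials is f x\<bar> \<le> a" "\<And>x. norm x ^ n * \<bar>partials is g x\<bar> \<le> b"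
      using assms unfolding schwartz_def bdd_above_def by fastforce
    have "norm x ^ n * \<bar>partials is f x + partials is g x\<bar> \<le> a + b" for x
    proof -
      have "norm x ^ n * \<bar>partials is f x + partials is g x\<bar> \<le>
          norm x ^ n * (\<bar>partials is f x\<bar> + \<bar>partials is g x\<bar>)"
        by (intro mult_left_mono) auto
      then show ?thesis using ab[of x] by (simp add: algebra_simps)
    qed
    then show ?thesis by (intro bdd_aboveI2)
  qed
  moreover have "smooth (\<lambda>x. f x + g x)"
    using fg unfolding smooth_def partials_add[OF fg] by (auto intro: differentiable_on_add)
  ultimately show ?thesis by (simp add: schwartz_def partials_add fg)
qed

lemma schwartz_cmult:
  assumes "f \<in> schwartz"
  shows "(\<lambda>x. c * f x) \<in> schwartz"
proof -
  have f: "smooth f" using assms by (auto simp: schwartz_def)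
  have "bdd_above (range (\<lambda>x. norm x ^ n * \<bar>c * partials is f x\<bar>))" for n "is"
  proof -
    obtain a where a: "\<And>x. norm x ^ n * \<bar>partials is f x\<bar> \<le> a"
      using assms unfolding schwartz_def bdd_above_def by fastforce
    have "norm x ^ n * \<bar>c * partials is f x\<bar> \<le> \<bar>c\<bar> * a" for x
      using mult_left_mono[OF a[of x], of "\<bar>c\<bar>"] by (simp add: abs_mult algebra_simps)
    then show ?thesis by (intro bdd_aboveI2)
  qed
  moreover have "smooth (\<lambda>x. c * f x)"
    using f unfolding smooth_def partials_cmult[OF f] by (auto intro!: differentiable_on_mult)
  ultimately show ?thesis by (simp add: schwartz_def partials_cmult f)
qed

lemma schwartz_diff:
  assumes "f \<in> schwartz" "g \<in> schwartz"
  shows "(\<lambda>x. f x - g x) \<in> schwartz"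
  using schwartz_add[OF assms(1) schwartz_cmult[OF assms(2), of "-1"]] by simp

section \<open>Approximation of bounded measurable functions by Schwartz functions\<close>

lemma smooth_expr_real_polynomial: "real_polynomial_function f \<Longrightarrow> smooth_expr f"
  by (induction rule: real_polynomial_function.induct) (auto intro: smooth_expr.intros)

text \<open>Uniform bound, common support and almost everywhere convergence are what dominated
  convergence asks for, once for the L2 distance and once for the exponent of the characteristic
  function. Measurability supplies merely continuous approximants; clipping, cutting off and
  polynomial approximation give them the missing properties.\<close>

lemma bounded_measurable_schwartz_approx:
  fixes \<phi> :: "real^'d::finite \<Rightarrow> real"
  assumes meas: "\<phi> \<in> borel_measurable lebesgue" and b: "\<And>x. \<bar>\<phi> x\<bar> \<le> b"
    and r: "0 < r" "\<And>x. r < norm x \<Longrightarrow> \<phi> x = 0"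
  obtains \<phi>s where "\<And>n. \<phi>s n \<in> schwartz" "\<And>n x. \<bar>\<phi>s n x\<bar> \<le> b + 1"
    "\<And>n x. 3 * r < norm x \<Longrightarrow> \<phi>s n x = 0" "AE x in lebesgue. (\<lambda>n. \<phi>s n x) \<longlonglongrightarrow> \<phi> x"
proof -
  have b0: "0 \<le> b" using b[of 0] by linarith
  have "\<phi> measurable_on UNIV"
    using measurable_on_iff_borel_measurable[of UNIV \<phi>] meas by (simp add: lebesgue_on_UNIV_eq)
  then obtain N g where N: "negligible N" and g: "\<And>n. continuous_on UNIV (g n)"
      "\<And>x. x \<notin> N \<Longrightarrow> (\<lambda>n. g n x) \<longlonglongrightarrow> \<phi> x"
    unfolding measurable_on_def by auto
  \<comment> \<open>On the ball of radius \<open>2 * r\<close> the smooth weight \<open>cut\<close> is bounded below, so a polynomial close to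
    \<open>h n / cut\<close> gives a smooth compactly supported function \<open>cut * P\<close> close to \<open>h n\<close>.\<close>
  define \<theta> where "\<theta> x = max 0 (min 1 (2 - norm x / r))" for x :: "real^'d"
  \<comment> \<open>Clipping to [-b, b] preserves the limit because \<phi> takes values there, and
    \<theta> is 1 wherever \<phi> can be nonzero.\<close>
  define h where "h n x = \<theta> x * max (- b) (min b (g n x))" for n x
  define cut where "cut x = bump 1 (9 * r\<^sup>2 + (-1) * (x \<bullet> x))" for x :: "real^'d"
  have \<theta>: "0 \<le> \<theta> x" "\<theta> x \<le> 1" "norm x \<le> r \<Longrightarrow> \<theta> x = 1" "2 * r \<le> norm x \<Longrightarrow> \<theta> x = 0" for x
    using r(1) by (auto simp: \<theta>_def field_simps max_def min_def)
  have hb: "\<bar>h n x\<bar> \<le> b" for n x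
  proof -
    have "\<bar>h n x\<bar> \<le> 1 * b"
      unfolding h_def abs_mult using \<theta>[of x] b0 by (intro mult_mono) auto
    then show ?thesis by simp
  qed
  have hcont: "continuous_on UNIV (h n)" for n
    unfolding h_def \<theta>_def using g(1)[of n] r(1) by (intro continuous_intros) auto
  have hlim: "(\<lambda>n. h n x) \<longlonglongrightarrow> \<phi> x" if "x \<notin> N" for x
  proof -
    have "(\<lambda>n. h n x) \<longlonglongrightarrow> \<theta> x * max (- b) (min b (\<phi> x))"
      unfolding h_def by (intro tendsto_intros g that)
    also have "\<theta> x * max (- b) (min b (\<phi> x)) = \<phi> x"
      using \<theta>(3)[of x] r(2)[of x] b[of x] by (cases "norm x \<le> r") (auto simp: abs_le_iff max_def min_def)
    finally show ?thesis .
  qed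
  have "smooth_expr (\<lambda>x :: real^'d. \<Sum>i\<in>Basis. (x \<bullet> i) * (x \<bullet> i))"
    by (intro smooth_expr_real_polynomial real_polynomial_function_sum real_polynomial_function.intros(4)
        real_polynomial_function.intros(1) bounded_linear_inner_left) auto
  then have "smooth_expr (\<lambda>x :: real^'d. x \<bullet> x)"
    by (subst euclidean_inner)
  then have cut_smooth: "smooth_expr cut"
    unfolding cut_def
    by (intro smooth_expr.bump smooth_expr.add[OF smooth_expr.const] smooth_expr.mult[OF smooth_expr.const])
  have sq: "x \<bullet> x < 9 * r\<^sup>2 \<longleftrightarrow> norm x < 3 * r" for x :: "real^'d"
    using r(1) power_mono_iff[of "3 * r" "norm x" 2] by (simp add: power2_norm_eq_inner power_mult_distrib not_le[symmetric])
  have cut: "0 \<le> cut x" "cut x \<le> 1" "norm x < 3 * r \<Longrightarrow> 0 < cut x" "3 * r \<le> norm x \<Longrightarrow> cut x = 0" for x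
    using sq[of x] by (auto simp: cut_def bump_def)
  have cut_cont: "continuous_on S cut" for S
  proof -
    have "continuous_on UNIV cut"
      using smooth_expr_smooth[OF cut_smooth] differentiable_imp_continuous_on
      unfolding smooth_def by (metis partials.simps(1))
    then show ?thesis using continuous_on_subset by blast
  qed
  have "\<exists>P. real_polynomial_function P \<and> (\<forall>x\<in>cball 0 (2 * r). \<bar>h n x / cut x - P x\<bar> < 1 / real (Suc n)) 
     \<and> (\<forall>x\<in>cball 0 (3 * r). \<bar>h n x - cut x * P x\<bar> \<le> 1 / real (Suc n))" for n
  proof -
    \<comment> \<open>Extending the quotient by 0 keeps it continuous up to radius
      \<open>3 * r\<close>, since \<open>h n\<close> vanishes from radius \<open>2 * r\<close> on;
      the quotient itself would break down at radius \<open>3 * r\<close>, where \<open>cut\<close>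
      is 0.\<close>
    define q where "q x = (if norm x \<le> 2 * r then h n x / cut x else 0)" for x
    have "continuous_on (cball 0 (2 * r) \<union> (cball 0 (3 * r) - ball 0 (2 * r))) q"
      unfolding q_def
    proof (rule continuous_on_If)
      show "continuous_on (cball 0 (2 * r)) (\<lambda>x. h n x / cut x)"
      proof (intro continuous_on_divide cut_cont ballI)
        fix x assume "x \<in> cball (0::real^'d) (2 * r)"
        then have "norm x < 3 * r" using r(1) by auto
        then show "cut x \<noteq> 0" using cut(3)[of x] by simp
      qed (use hcont[of n] continuous_on_subset in blast)
    qed (use \<theta>(4) in \<open>auto simp: h_def closed_Diff\<close>)
    also have "cball 0 (2 * r) \<union> (cball 0 (3 * r) - ball 0 (2 * r)) = cball (0::real^'d) (3 * r)"
      using r(1) by auto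
    finally have "continuous_on (cball 0 (3 * r)) q" .
    then obtain P where P: "real_polynomial_function P"
       "\<And>x. x \<in> cball 0 (3 * r) \<Longrightarrow> \<bar>q x - P x\<bar> < 1 / real (Suc n)"
      using Stone_Weierstrass_real_polynomial_function[OF compact_cball, of 0 "3 * r" q "1 / real (Suc n)"]
      by auto
    have "\<bar>h n x - cut x * P x\<bar> \<le> 1 / real (Suc n)" if x: "x \<in> cball 0 (3 * r)" for x
    proof -
      have "h n x = cut x * q x"
        using cut(3)[of x] \<theta>(4)[of x] r(1) by (auto simp: q_def h_def)
      then have "\<bar>h n x - cut x * P x\<bar> = cut x * \<bar>q x - P x\<bar>"
        using cut(1)[of x] by (simp add: abs_mult right_diff_distrib[symmetric])
      also have "\<dots> \<le> 1 * \<bar>q x - P x\<bar>" using cut(2)[of x] by (intro mult_right_mono) auto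
      finally show ?thesis using P(2)[OF x] by simp
    qed
    moreover have "\<bar>h n x / cut x - P x\<bar> < 1 / real (Suc n)" if x: "x \<in> cball 0 (2 * r)" for x
      using P(2)[of x] x r(1) by (auto simp: q_def)
    ultimately show ?thesis using P(1) by blast
  qed
  then obtain P where P: "\<And>n. real_polynomial_function (P n)"
     "\<And>n x. norm x \<le> 3 * r \<Longrightarrow> \<bar>h n x - cut x * P n x\<bar> \<le> 1 / real (Suc n)"
    by (metis mem_cball_0)
  define \<phi>s where "\<phi>s n x = cut x * P n x" for n x
  have close: "\<bar>h n x - \<phi>s n x\<bar> \<le> 1 / real (Suc n)" for n x
    using P(2)[of x n] cut(4)[of x] \<theta>(4)[of x] r(1)
    by (cases "norm x \<le> 3 * r") (auto simp: \<phi>s_def h_def)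
  show thesis
  proof
    show zero: "\<phi>s n x = 0" if "3 * r < norm x" for n x
      using cut(4)[of x] that by (simp add: \<phi>s_def)
    have "smooth_expr (\<phi>s n)" for n
      unfolding \<phi>s_def by (intro smooth_expr.mult cut_smooth smooth_expr_real_polynomial P)
    then show "\<phi>s n \<in> schwartz" for n
      using zero by (intro smooth_compact_support_schwartz[OF smooth_expr_smooth compact_cball[of 0 "3 * r"]]) auto
    show "\<bar>\<phi>s n x\<bar> \<le> b + 1" for n x
    proof -
      have "1 / real (Suc n) \<le> 1" by simp
      then show ?thesis using close[of n x] hb[of n x] by linarith
    qed
    have "(\<lambda>n. \<phi>s n x) \<longlonglongrightarrow> \<phi> x" if "x \<notin> N" for x
    proof -
      have "(\<lambda>n. h n x - \<phi>s n x) \<longlonglongrightarrow> 0"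
        by (rule Lim_null_comparison[OF _ lim_1_over_n[THEN LIMSEQ_Suc]]) (use close in auto)
      then show ?thesis using tendsto_diff[OF hlim[OF that]] by fastforce
    qed
    then show "AE x in lebesgue. (\<lambda>n. \<phi>s n x) \<longlonglongrightarrow> \<phi> x"
      using N by (intro AE_I'[of N]) (auto simp: negligible_iff_null_sets)
  qed
qed

section \<open>Convergence in probability\<close>

lemma (in prob_space) integrable_one_minus_cos:
  "X \<in> borel_measurable M \<Longrightarrow> integrable M (\<lambda>\<omega>. 1 - cos (X \<omega>) :: real)"
  by (intro integrable_const_bound[where B=2] AE_I2)
     (auto simp: abs_le_iff intro: order_trans[OF cos_le_one] cos_ge_minus_one)

text \<open>Averaging \<open>1 - cos (\<xi> x)\<close> over \<open>\<xi> \<in> [0, 2 / e]\<close> gives at least \<open>1/2\<close> when \<open>\<bar>x\<bar> > e\<close>.\<close>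

lemma (in prob_space) prob_gt_le_integral_one_minus_cos:
  assumes X [measurable]: "X \<in> borel_measurable M" and e: "0 < e"
    and \<delta>: "\<And>\<xi>. 0 \<le> \<xi> \<Longrightarrow> \<xi> \<le> 2 / e \<Longrightarrow> expectation (\<lambda>\<omega>. 1 - cos (\<xi> * X \<omega>)) \<le> \<delta>"
  shows "prob {\<omega> \<in> space M. e < \<bar>X \<omega>\<bar>} \<le> 2 * \<delta>"
proof -
  define c where "c = 2 / e"
  have c: "0 < c" "c / 2 = 1 / e" using e by (auto simp: c_def)
  have \<delta>0: "0 \<le> \<delta>" using \<delta>[of 0] e by simp
  interpret pair_sigma_finite M lborel by (simp add: pair_sigma_finite_def sigma_finite_measure_axioms lborel.sigma_finite_measure_axioms)
  let ?A = "{\<omega> \<in> space M. e < \<bar>X \<omega>\<bar>}"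
  have inner: "ennreal (c / 2) * indicator ?A \<omega> \<le>
      (\<integral>\<^sup>+\<xi>. ennreal (1 - cos (\<xi> * X \<omega>)) * indicator {0..c} \<xi> \<partial>lborel)" for \<omega>
  proof (cases "\<omega> \<in> ?A")
    case True
    define x where "x = X \<omega>"
    have x: "e < \<bar>x\<bar>" "x \<noteq> 0" using True e by (auto simp: x_def)
    have "(\<integral>\<^sup>+\<xi>. ennreal (1 - cos (\<xi> * x)) * indicator {0..c} \<xi> \<partial>lborel) =
        ennreal ((c - sin (c * x) / x) - (0 - sin (0 * x) / x))"
      using x c by (intro nn_integral_FTC_Icc) (auto intro!: derivative_eq_intros)
    moreover have "c / 2 \<le> c - sin (c * x) / x"
    proof -
      have "\<bar>sin (c * x) / x\<bar> \<le> 1 / \<bar>x\<bar>"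
        using x by (simp add: abs_divide divide_right_mono)
      also have "\<dots> \<le> c / 2" unfolding c(2) using x e by (intro divide_left_mono) auto
      finally show ?thesis by linarith
    qed
    ultimately show ?thesis using True by (simp add: x_def ennreal_leI)
  qed simp
  have "ennreal (c / 2) * emeasure M ?A = (\<integral>\<^sup>+\<omega>. ennreal (c / 2) * indicator ?A \<omega> \<partial>M)"
    by (simp add: nn_integral_cmult_indicator)
  also have "\<dots> \<le> (\<integral>\<^sup>+\<omega>. \<integral>\<^sup>+\<xi>. ennreal (1 - cos (\<xi> * X \<omega>)) * indicator {0..c} \<xi> \<partial>lborel \<partial>M)"
    by (intro nn_integral_mono inner)
  also have "\<dots> = (\<integral>\<^sup>+\<xi>. \<integral>\<^sup>+\<omega>. ennreal (1 - cos (\<xi> * X \<omega>)) * indicator {0..c} \<xi> \<partial>M \<partial>lborel)"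
  proof (rule Fubini'[symmetric])
    have "(\<lambda>z. X (fst z)) \<in> borel_measurable (M \<Otimes>\<^sub>M lborel)"
      by (rule measurable_compose[OF measurable_fst X])
    moreover have "snd \<in> borel_measurable (M \<Otimes>\<^sub>M lborel)"
      using measurable_snd[of M lborel] by simp
    ultimately show "(\<lambda>(\<omega>, \<xi>). ennreal (1 - cos (\<xi> * X \<omega>)) * indicator {0..c} \<xi>) \<in> borel_measurable (M \<Otimes>\<^sub>M lborel)"
      unfolding case_prod_beta' by measurable
  qed
  also have "\<dots> \<le> (\<integral>\<^sup>+\<xi>. ennreal \<delta> * indicator {0..c} \<xi> \<partial>lborel)"
  proof (intro nn_integral_mono)
    fix \<xi> :: real
    have "integrable M (\<lambda>\<omega>. 1 - cos (\<xi> * X \<omega>))"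
      by (intro integrable_one_minus_cos) measurable
    then have "(\<integral>\<^sup>+\<omega>. ennreal (1 - cos (\<xi> * X \<omega>)) \<partial>M) = ennreal (expectation (\<lambda>\<omega>. 1 - cos (\<xi> * X \<omega>)))"
      by (intro nn_integral_eq_integral) auto
    then show "(\<integral>\<^sup>+\<omega>. ennreal (1 - cos (\<xi> * X \<omega>)) * indicator {0..c} \<xi> \<partial>M) \<le> ennreal \<delta> * indicator {0..c} \<xi>"
      using \<delta>[of \<xi>] by (auto simp: c_def indicator_def intro!: ennreal_leI)
  qed
  also have "\<dots> = ennreal (\<delta> * c)"
    using c(1) \<delta>0 by (simp add: nn_integral_cmult_indicator ennreal_mult)
  finally have "ennreal (c / 2 * prob ?A) \<le> ennreal (\<delta> * c)"
    using c(1) by (simp add: emeasure_eq_measure ennreal_mult del: times_divide_eq_left)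
  then have "c / 2 * prob ?A \<le> \<delta> * c"
    using c \<delta>0 by (subst (asm) ennreal_le_iff) auto
  then have "c * prob ?A \<le> c * (2 * \<delta>)" by (simp add: algebra_simps)
  then show ?thesis using c by simp
qed

lemma (in prob_space) AE_imp_tendsto_in_prob:
  assumes X [measurable]: "\<And>n. X n \<in> borel_measurable M" and Y [measurable]: "Y \<in> borel_measurable M"
    and lim: "AE \<omega> in M. (\<lambda>n. X n \<omega>) \<longlonglongrightarrow> Y \<omega>"
  shows "tendsto_in_prob M X Y"
  unfolding tendsto_in_prob_def
proof safe
  fix e :: real assume e: "0 < e"
  have "(\<lambda>n. expectation (indicator {\<omega> \<in> space M. e < \<bar>X n \<omega> - Y \<omega>\<bar>} :: _ \<Rightarrow> real)) \<longlonglongrightarrow> expectation (\<lambda>\<omega>. 0)"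
  proof (rule integral_dominated_convergence[where w="\<lambda>_. 1"])
    show "AE \<omega> in M. (\<lambda>n. indicator {\<omega> \<in> space M. e < \<bar>X n \<omega> - Y \<omega>\<bar>} \<omega> :: real) \<longlonglongrightarrow> 0"
      using lim
    proof eventually_elim
      fix \<omega> assume "(\<lambda>n. X n \<omega>) \<longlonglongrightarrow> Y \<omega>"
      then have "eventually (\<lambda>n. dist (X n \<omega>) (Y \<omega>) < e) sequentially"
        using e tendstoD by blast
      then show "(\<lambda>n. indicator {\<omega> \<in> space M. e < \<bar>X n \<omega> - Y \<omega>\<bar>} \<omega> :: real) \<longlonglongrightarrow> 0"
        by (intro tendsto_eventually) (auto elim!: eventually_mono simp: dist_real_def)
    qed
  qed (auto split: split_indicator)
  then show "(\<lambda>n. prob {\<omega> \<in> space M. e < \<bar>X n \<omega> - Y \<omega>\<bar>}) \<longlonglongrightarrow> 0" by simp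
qed

lemma (in prob_space) prob_gt_triangle:
  fixes e :: real
  assumes [measurable]: "X \<in> borel_measurable M" "Y \<in> borel_measurable M" "Z \<in> borel_measurable M"
  shows "prob {\<omega> \<in> space M. e < \<bar>X \<omega> - Z \<omega>\<bar>} \<le>
    prob {\<omega> \<in> space M. e / 2 < \<bar>X \<omega> - Y \<omega>\<bar>} + prob {\<omega> \<in> space M. e / 2 < \<bar>Y \<omega> - Z \<omega>\<bar>}"
proof -
  have "{\<omega> \<in> space M. e < \<bar>X \<omega> - Z \<omega>\<bar>} \<subseteq>
     {\<omega> \<in> space M. e / 2 < \<bar>X \<omega> - Y \<omega>\<bar>} \<union> {\<omega> \<in> space M. e / 2 < \<bar>Y \<omega> - Z \<omega>\<bar>}"
  proof
    fix \<omega> assume "\<omega> \<in> {\<omega> \<in> space M. e < \<bar>X \<omega> - Z \<omega>\<bar>}"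
    then show "\<omega> \<in> {\<omega> \<in> space M. e / 2 < \<bar>X \<omega> - Y \<omega>\<bar>} \<union> {\<omega> \<in> space M. e / 2 < \<bar>Y \<omega> - Z \<omega>\<bar>}"
      using abs_triangle_ineq[of "X \<omega> - Y \<omega>" "Y \<omega> - Z \<omega>"] by auto
  qed
  then have "prob {\<omega> \<in> space M. e < \<bar>X \<omega> - Z \<omega>\<bar>} \<le> prob ({\<omega> \<in> space M. e / 2 < \<bar>X \<omega> - Y \<omega>\<bar>} \<union> {\<omega> \<in> space M. e / 2 < \<bar>Y \<omega> - Z \<omega>\<bar>})"
    by (intro finite_measure_mono) auto
  also have "\<dots> \<le> prob {\<omega> \<in> space M. e / 2 < \<bar>X \<omega> - Y \<omega>\<bar>} + prob {\<omega> \<in> space M. e / 2 < \<bar>Y \<omega> - Z \<omega>\<bar>}"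
    by (intro measure_Un_le) auto
  finally show ?thesis .
qed

lemma (in prob_space) tendsto_in_prob_trans:
  assumes [measurable]: "\<And>n. X n \<in> borel_measurable M" "\<And>n. Z n \<in> borel_measurable M" "Y \<in> borel_measurable M"
    and "tendsto_in_prob M Z Y" and "tendsto_in_prob M (\<lambda>n \<omega>. X n \<omega> - Z n \<omega>) (\<lambda>\<omega>. 0)"
  shows "tendsto_in_prob M X Y"
  unfolding tendsto_in_prob_def
proof safe
  fix e :: real assume "0 < e"
  then have "(\<lambda>n. prob {\<omega> \<in> space M. e / 2 < \<bar>X n \<omega> - Z n \<omega>\<bar>} + prob {\<omega> \<in> space M. e / 2 < \<bar>Z n \<omega> - Y \<omega>\<bar>}) \<longlonglongrightarrow> 0"
    using assms(4,5)[unfolded tendsto_in_prob_def, rule_format, of "e / 2"] by (intro tendsto_add_zero) auto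
  then show "(\<lambda>n. prob {\<omega> \<in> space M. e < \<bar>X n \<omega> - Y \<omega>\<bar>}) \<longlonglongrightarrow> 0"
    by (rule Lim_null_comparison[rotated]) (use prob_gt_triangle[OF assms(1,2,3)] in auto)
qed

text \<open>Along a subsequence whose k-th increment exceeds 2^-k with probability below 2^-k,
  Borel-Cantelli makes the increments almost surely summable, so the subsequence converges almost
  surely by telescoping. The Cauchy condition carries the limit over to the whole sequence.\<close>

lemma (in prob_space) Cauchy_in_prob_convergent:
  assumes X [measurable]: "\<And>n. X n \<in> borel_measurable M"
    and Cau: "\<And>e \<delta>. 0 < e \<Longrightarrow> 0 < \<delta> \<Longrightarrow>
      \<exists>N. \<forall>m\<ge>N. \<forall>n\<ge>N. prob {\<omega> \<in> space M. e < \<bar>X m \<omega> - X n \<omega>\<bar>} < \<delta>"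
  shows "\<exists>Y\<in>borel_measurable M. tendsto_in_prob M X Y"
proof -
  have "\<exists>N. \<forall>k. (\<forall>m\<ge>N k. \<forall>n\<ge>N k. prob {\<omega> \<in> space M. (1/2)^k < \<bar>X m \<omega> - X n \<omega>\<bar>} < (1/2)^k) \<and> N k < N (Suc k)"
  proof (rule dependent_nat_choice)
    show "\<exists>N. \<forall>m\<ge>N. \<forall>n\<ge>N. prob {\<omega> \<in> space M. (1/2)^0 < \<bar>X m \<omega> - X n \<omega>\<bar>} < (1/2)^0"
      by (rule Cau) auto
    fix N :: nat and k
    obtain N' where "\<forall>m\<ge>N'. \<forall>n\<ge>N'. prob {\<omega> \<in> space M. (1/2)^Suc k < \<bar>X m \<omega> - X n \<omega>\<bar>} < (1/2)^Suc k"
      using Cau[of "(1/2)^Suc k" "(1/2)^Suc k"] by auto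
    then show "\<exists>N'. (\<forall>m\<ge>N'. \<forall>n\<ge>N'. prob {\<omega> \<in> space M. (1/2)^Suc k < \<bar>X m \<omega> - X n \<omega>\<bar>} < (1/2)^Suc k) \<and> N < N'"
      by (intro exI[of _ "max N' (Suc N)"]) auto
  qed
  then obtain r where r: "\<And>k m n. r k \<le> m \<Longrightarrow> r k \<le> n \<Longrightarrow> prob {\<omega> \<in> space M. (1/2)^k < \<bar>X m \<omega> - X n \<omega>\<bar>} < (1/2)^k"
      "\<And>k. r k < r (Suc k)" by blast
  have mono: "strict_mono r" using r(2) by (rule strict_monoI_Suc)
  let ?B = "\<lambda>k. {\<omega> \<in> space M. (1/2)^k < \<bar>X (r (Suc k)) \<omega> - X (r k) \<omega>\<bar>}"
  have "AE \<omega> in M. eventually (\<lambda>k. \<omega> \<in> space M - ?B k) sequentially"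
  proof (rule borel_cantelli_AE1)
    show "summable (\<lambda>k. prob (?B k))"
      by (rule summable_comparison_test'[where g="\<lambda>k. (1/2)^k" and N=0])
         (use r(1) r(2)[THEN less_imp_le] in \<open>auto intro!: less_imp_le summable_geometric\<close>)
  qed (auto simp: emeasure_eq_measure)
  then have conv: "AE \<omega> in M. (\<lambda>k. X (r k) \<omega>) \<longlonglongrightarrow> lim (\<lambda>k. X (r k) \<omega>)"
  proof eventually_elim
    fix \<omega> assume "eventually (\<lambda>k. \<omega> \<in> space M - ?B k) sequentially"
    then have "eventually (\<lambda>k. norm (X (r (Suc k)) \<omega> - X (r k) \<omega>) \<le> (1/2)^k) sequentially"
      by (auto elim!: eventually_mono)
    then have "summable (\<lambda>k. X (r (Suc k)) \<omega> - X (r k) \<omega>)"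
      by (rule summable_comparison_test_ev) (simp add: summable_geometric)
    then have "convergent (\<lambda>n. \<Sum>k<n. X (r (Suc k)) \<omega> - X (r k) \<omega>)"
      by (simp add: summable_iff_convergent)
    then have "convergent (\<lambda>n. X (r n) \<omega> - X (r 0) \<omega>)"
      by (simp add: sum_lessThan_telescope[of "\<lambda>k. X (r k) \<omega>"])
    from convergent_add[OF this convergent_const[of "X (r 0) \<omega>"]]
    have "convergent (\<lambda>n. X (r n) \<omega>)" by simp
    then show "(\<lambda>k. X (r k) \<omega>) \<longlonglongrightarrow> lim (\<lambda>k. X (r k) \<omega>)"
      by (simp add: convergent_LIMSEQ_iff)
  qed
  define Y where "Y \<omega> = lim (\<lambda>k. X (r k) \<omega>)" for \<omega>
  have Y [measurable]: "Y \<in> borel_measurable M"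
    unfolding Y_def by (rule borel_measurable_lim_metric) simp
  have sub: "tendsto_in_prob M (\<lambda>k. X (r k)) Y"
    by (rule AE_imp_tendsto_in_prob) (use conv in \<open>auto simp: Y_def\<close>)
  have "tendsto_in_prob M X Y"
  proof (rule tendsto_in_prob_trans[OF _ _ _ sub])
    show "tendsto_in_prob M (\<lambda>n \<omega>. X n \<omega> - X (r n) \<omega>) (\<lambda>\<omega>. 0)"
      unfolding tendsto_in_prob_def LIMSEQ_iff
    proof (intro allI impI)
      fix e \<delta> :: real assume "0 < e" "0 < \<delta>"
      from Cau[OF this] obtain N where N:
        "\<And>m n. N \<le> m \<Longrightarrow> N \<le> n \<Longrightarrow> prob {\<omega> \<in> space M. e < \<bar>X m \<omega> - X n \<omega>\<bar>} < \<delta>" by blast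
      have "prob {\<omega> \<in> space M. e < \<bar>X n \<omega> - X (r n) \<omega>\<bar>} < \<delta>" if "N \<le> n" for n
        \<comment> \<open>A strictly increasing \<open>r\<close> satisfies
          \<open>n \<le> r n\<close>, so both indices lie beyond N.\<close>
        using N[of n "r n"] that seq_suble[OF mono, of n] by simp
      then show "\<exists>no. \<forall>n\<ge>no. norm (prob {\<omega> \<in> space M. e < \<bar>X n \<omega> - X (r n) \<omega> - 0\<bar>} - 0) < \<delta>"
        by auto
    qed
  qed auto
  then show ?thesis using Y by blast
qed

lemma cmod_iexp_diff_le: "cmod (iexp a - iexp b) \<le> \<bar>a - b\<bar>"
proof -
  have "iexp a - iexp b = iexp b * (iexp (a - b) - 1)"
    by (simp add: algebra_simps flip: exp_add)
  then have "cmod (iexp a - iexp b) = cmod (iexp (a - b) - 1)"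
    by (simp only: norm_mult norm_exp_i_times mult_1)
  also have "\<dots> \<le> \<bar>a - b\<bar>" using iexp_approx1[of "a - b" 0] by simp
  finally show ?thesis .
qed

text \<open>The map \<open>iexp\<close> is 1-Lipschitz and bounded by 1: where the variables differ
  by at most e/2 the first property suffices, and the exceptional event contributes at most twice
  its probability.\<close>

lemma (in prob_space) tendsto_in_prob_char:
  assumes X [measurable]: "\<And>n. X n \<in> borel_measurable M" and Y [measurable]: "Y \<in> borel_measurable M"
    and lim: "tendsto_in_prob M X Y"
  shows "(\<lambda>n. \<integral>\<omega>. iexp (X n \<omega>) \<partial>M) \<longlonglongrightarrow> (\<integral>\<omega>. iexp (Y \<omega>) \<partial>M)"
proof (rule LIMSEQ_I)
  fix e :: real assume e: "0 < e"
  define A where "A n = {\<omega> \<in> space M. e / 2 < \<bar>X n \<omega> - Y \<omega>\<bar>}" for n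
  have A [measurable]: "A n \<in> sets M" for n unfolding A_def by measurable
  have "(\<lambda>n. prob (A n)) \<longlonglongrightarrow> 0" unfolding A_def by (rule lim[unfolded tendsto_in_prob_def, rule_format]) (use e in simp)
  from LIMSEQ_D[OF this, of "e / 4"] e obtain N where N: "\<And>n. N \<le> n \<Longrightarrow> prob (A n) < e / 4"
    by auto
  have "cmod ((\<integral>\<omega>. iexp (X n \<omega>) \<partial>M) - (\<integral>\<omega>. iexp (Y \<omega>) \<partial>M)) < e" if n: "N \<le> n" for n
  proof -
    have "(\<integral>\<omega>. iexp (X n \<omega>) \<partial>M) - (\<integral>\<omega>. iexp (Y \<omega>) \<partial>M) = (\<integral>\<omega>. iexp (X n \<omega>) - iexp (Y \<omega>) \<partial>M)"
      by (intro Bochner_Integration.integral_diff[symmetric] integrable_iexp) auto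
    also have "cmod \<dots> \<le> (\<integral>\<omega>. cmod (iexp (X n \<omega>) - iexp (Y \<omega>)) \<partial>M)"
      by (rule integral_norm_bound)
    also have "\<dots> \<le> (\<integral>\<omega>. e / 2 + 2 * indicator (A n) \<omega> \<partial>M)"
    proof (rule integral_mono)
      show "integrable M (\<lambda>\<omega>. cmod (iexp (X n \<omega>) - iexp (Y \<omega>)))"
        by (intro integrable_norm Bochner_Integration.integrable_diff integrable_iexp) auto
      fix \<omega> assume \<omega>: "\<omega> \<in> space M"
      show "cmod (iexp (X n \<omega>) - iexp (Y \<omega>)) \<le> e / 2 + 2 * indicator (A n) \<omega>"
      proof (cases "\<omega> \<in> A n")
        case True
        then show ?thesis using e norm_triangle_ineq4[of "iexp (X n \<omega>)" "iexp (Y \<omega>)"] by simp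
      next
        case False
        then show ?thesis using \<omega> cmod_iexp_diff_le[of "X n \<omega>" "Y \<omega>"] by (simp add: A_def)
      qed
    qed (auto simp: emeasure_eq_measure intro!: integrable_real_indicator)
    also have "\<dots> = e / 2 + 2 * prob (A n)"
      by (subst Bochner_Integration.integral_add) (auto simp: prob_space emeasure_eq_measure)
    also have "\<dots> < e" using N[OF n] by simp
    finally show ?thesis .
  qed
  then show "\<exists>N. \<forall>n\<ge>N. norm ((\<integral>\<omega>. iexp (X n \<omega>) \<partial>M) - (\<integral>\<omega>. iexp (Y \<omega>) \<partial>M)) < e" by blast
qed

section \<open>Measurability of evaluations on the strong dual\<close>

lemma schwartz_bounded_singleton: "\<phi> \<in> schwartz \<Longrightarrow> schwartz_bounded {\<phi>}"
  by (simp add: schwartz_bounded_def)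

lemma openin_strong_dual_subset:
  "openin strong_dual_topology U \<Longrightarrow> U \<subseteq> tempered_distributions"
  using openin_subset[of strong_dual_topology U]
  unfolding strong_dual_topology_def topology_generated_by_topspace by auto

lemma space_strong_dual_borel: "space strong_dual_borel = tempered_distributions"
  unfolding strong_dual_borel_def
  using openin_strong_dual_subset by (intro space_measure_of) auto

text \<open>A singleton is a bounded subset of the Schwartz space, so the condition on one value is
  strongly open: around each u with value above c, the basic neighbourhood of radius
  \<open>u \<phi> - c\<close> for the set {\<phi>} stays inside the half-space.\<close>

lemma measurable_evaluation:
  assumes \<phi>: "\<phi> \<in> schwartz"
  shows "(\<lambda>u. u \<phi>) \<in> borel_measurable strong_dual_borel"
proof (rule borel_measurableI_greater)
  fix c :: real
  let ?S = "\<lambda>u. {v \<in> tempered_distributions. (SUP f\<in>{\<phi>}. \<bar>v f - u f\<bar>) < u \<phi> - c}"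
  have "{v \<in> space strong_dual_borel. c < v \<phi>} = (\<Union>u\<in>{u \<in> tempered_distributions. c < u \<phi>}. ?S u)"
    unfolding space_strong_dual_borel by fastforce
  moreover have "openin strong_dual_topology (\<Union>u\<in>{u \<in> tempered_distributions. c < u \<phi>}. ?S u)"
  proof (intro openin_Union)
    fix S assume "S \<in> ?S ` {u \<in> tempered_distributions. c < u \<phi>}"
    then obtain u where u: "S = ?S u" "u \<in> tempered_distributions" "c < u \<phi>" by blast
    then have "0 < u \<phi> - c" by simp
    then show "openin strong_dual_topology S"
      unfolding strong_dual_topology_def u(1)
      using schwartz_bounded_singleton[OF \<phi>] u(2)
      by (intro topology_generated_by_Basis CollectI exI conjI refl) auto
  qed
  ultimately show "{v \<in> space strong_dual_borel. c < v \<phi>} \<in> sets strong_dual_borel"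
    unfolding strong_dual_borel_def using openin_strong_dual_subset by (subst sets_measure_of) auto
qed

section \<open>The pairing with bounded compactly supported functions\<close>

text \<open>Splitting off the modulus, 1 - Re (exp z) = (1 - exp (Re z)) + exp (Re z) (1 - cos (Im
  z)); for a nonpositive real part the summands are at most -Re z and |Im z|.\<close>

lemma one_minus_Re_exp_le:
  assumes "Re z \<le> 0"
  shows "1 - Re (exp z) \<le> 2 * cmod z"
proof -
  have "1 - exp (Re z) \<le> - Re z" using exp_ge_add_one_self[of "Re z"] by linarith
  moreover have "exp (Re z) * (1 - cos (Im z)) \<le> 1 * \<bar>Im z\<bar>"
  proof (rule mult_mono)
    have "1 - cos (Im z) = 2 * (sin (Im z / 2))\<^sup>2" using cos_double_sin[of "Im z / 2"] by simp
    also have "\<dots> \<le> 2 * (\<bar>sin (Im z / 2)\<bar> * 1)"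
      unfolding power2_eq_square abs_mult_self[of "sin (Im z / 2)", symmetric]
      by (intro mult_left_mono) auto
    also have "\<dots> \<le> 2 * \<bar>Im z / 2\<bar>" using abs_sin_x_le_abs_x[of "Im z / 2"] by simp
    finally show "1 - cos (Im z) \<le> \<bar>Im z\<bar>" by simp
  qed (use assms in auto)
  moreover have "- Re z \<le> cmod z" "\<bar>Im z\<bar> \<le> cmod z"
    using abs_Re_le_cmod[of z] abs_Im_le_cmod[of z] by auto
  moreover have "1 - Re (exp z) = (1 - exp (Re z)) + exp (Re z) * (1 - cos (Im z))"
    by (simp add: Re_exp algebra_simps)
  ultimately show ?thesis by linarith
qed

text \<open>A function that is not integrable has Bochner integral 0 by convention, so the sign
  survives in that case as well. The same convention is used in the next lemma.\<close>

lemma Re_integral_nonpos: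
  fixes f :: "'a \<Rightarrow> complex"
  assumes "\<And>x. Re (f x) \<le> 0"
  shows "Re (\<integral>x. f x \<partial>M) \<le> 0"
proof (cases "integrable M f")
  case True
  then have "Re (\<integral>x. f x \<partial>M) = (\<integral>x. Re (f x) \<partial>M)" by simp
  also have "\<dots> \<le> (\<integral>x. 0 \<partial>M)" using True assms by (intro integral_mono) auto
  finally show ?thesis by simp
qed (simp add: not_integrable_integral_eq)

lemma norm_integral_le_nn_integral:
  fixes f :: "'a \<Rightarrow> complex"
  shows "ennreal (cmod (\<integral>x. f x \<partial>M)) \<le> (\<integral>\<^sup>+x. ennreal (cmod (f x)) \<partial>M)"
  by (cases "integrable M f") (auto intro: integral_norm_bound_ennreal simp: not_integrable_integral_eq)

lemma (in prob_space) Re_char: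
  assumes [measurable]: "X \<in> borel_measurable M"
  shows "expectation (\<lambda>\<omega>. 1 - cos (X \<omega>)) = 1 - Re (\<integral>\<omega>. iexp (X \<omega>) \<partial>M)"
proof -
  have "Re (\<integral>\<omega>. iexp (X \<omega>) \<partial>M) = expectation (\<lambda>\<omega>. Re (iexp (X \<omega>)))"
    by (intro integral_Re[symmetric] integrable_iexp) auto
  also have "\<dots> = expectation (\<lambda>\<omega>. cos (X \<omega>))" by (simp add: Re_exp)
  finally have 1: "Re (\<integral>\<omega>. iexp (X \<omega>) \<partial>M) = expectation (\<lambda>\<omega>. cos (X \<omega>))" .
  have "integrable M (\<lambda>\<omega>. cos (X \<omega>))"
    by (intro integrable_const_bound[where B=1] AE_I2) auto
  then show ?thesis unfolding 1 by (simp add: prob_space)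
qed

lemma schwartz_measurable:
  assumes "\<phi> \<in> schwartz"
  shows "\<phi> \<in> borel_measurable borel"
proof -
  have "partials [] \<phi> differentiable_on UNIV" using assms unfolding schwartz_def smooth_def by blast
  then have "continuous_on UNIV \<phi>" using differentiable_imp_continuous_on by simp
  then show ?thesis by (rule borel_measurable_continuous_onI)
qed

lemma nn_integral_diff_square_le:
  fixes f g h :: "'a::euclidean_space \<Rightarrow> real"
  assumes [measurable]: "f \<in> borel_measurable lebesgue" "g \<in> borel_measurable lebesgue" "h \<in> borel_measurable lebesgue"
  shows "(\<integral>\<^sup>+x. ennreal ((f x - g x)\<^sup>2) \<partial>lebesgue) \<le>
     2 * (\<integral>\<^sup>+x. ennreal ((f x - h x)\<^sup>2) \<partial>lebesgue) + 2 * (\<integral>\<^sup>+x. ennreal ((g x - h x)\<^sup>2) \<partial>lebesgue)"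
proof -
  have "(\<integral>\<^sup>+x. ennreal ((f x - g x)\<^sup>2) \<partial>lebesgue) \<le>
      (\<integral>\<^sup>+x. 2 * ennreal ((f x - h x)\<^sup>2) + 2 * ennreal ((g x - h x)\<^sup>2) \<partial>lebesgue)"
  proof (intro nn_integral_mono)
    fix x
    have "0 \<le> ((f x - h x) + (g x - h x))\<^sup>2" by simp
    then have "(f x - g x)\<^sup>2 \<le> 2 * (f x - h x)\<^sup>2 + 2 * (g x - h x)\<^sup>2"
      by (simp add: power2_eq_square algebra_simps)
    then have "ennreal ((f x - g x)\<^sup>2) \<le> ennreal (2 * (f x - h x)\<^sup>2 + 2 * (g x - h x)\<^sup>2)"
      by (rule ennreal_leI)
    then show "ennreal ((f x - g x)\<^sup>2) \<le> 2 * ennreal ((f x - h x)\<^sup>2) + 2 * ennreal ((g x - h x)\<^sup>2)"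
      by (simp add: ennreal_mult)
  qed
  then show ?thesis by (simp add: nn_integral_add nn_integral_cmult)
qed

text \<open>The analytic content of the Levy-Khintchine form on which the remaining proof rests:
  continuity, value at 0, sign of the real part and quadratic growth. The triplet itself does not
  occur again after \<open>levy_noiseI\<close>.\<close>

locale levy_noise = prob_space M for M :: "'w measure" +
  fixes w :: "'w \<Rightarrow> (real^'d::finite \<Rightarrow> real) \<Rightarrow> real" and \<Psi> :: "real \<Rightarrow> complex"
  assumes w: "w \<in> measurable M strong_dual_borel"
    and \<Psi>_cont: "continuous_on UNIV \<Psi>" and \<Psi>_0: "\<Psi> 0 = 0" and \<Psi>_Re: "Re (\<Psi> \<xi>) \<le> 0"
    and \<Psi>_growth: "\<exists>C\<ge>0. \<forall>\<xi>. cmod (\<Psi> \<xi>) \<le> C * (1 + \<xi>\<^sup>2)"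
    and char_w: "\<phi> \<in> schwartz \<Longrightarrow> (\<integral>\<omega>. iexp (w \<omega> \<phi>) \<partial>M) = exp (\<integral>x. \<Psi> (\<phi> x) \<partial>lborel)"

lemma levy_noiseI:
  assumes "prob_space M" "levy_white_noise M \<Psi> w"
  shows "levy_noise M w \<Psi>"
proof -
  from assms(2) obtain \<mu> \<sigma>2 \<nu> where "0 \<le> \<sigma>2" "levy_measure \<nu>" "\<Psi> = levy_exponent \<mu> \<sigma>2 \<nu>"
    by (auto simp: levy_white_noise_def)
  with assms show ?thesis
    unfolding levy_noise_def levy_noise_axioms_def
    using continuous_on_levy_exponent Re_levy_exponent_nonpos norm_levy_exponent_le levy_exponent_0
    by (simp add: levy_white_noise_def)
qed

context levy_noise
begin

lemma \<Psi>_measurable [measurable]: "\<Psi> \<in> borel_measurable borel"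
  using \<Psi>_cont by (rule borel_measurable_continuous_onI)

lemma w_measurable [measurable]: "\<phi> \<in> schwartz \<Longrightarrow> (\<lambda>\<omega>. w \<omega> \<phi>) \<in> borel_measurable M"
  using measurable_compose[OF w measurable_evaluation] .

lemma w_tempered: "\<omega> \<in> space M \<Longrightarrow> w \<omega> \<in> tempered_distributions"
  using measurable_space[OF w] by (simp add: space_strong_dual_borel)

lemma w_cmult: "\<omega> \<in> space M \<Longrightarrow> \<phi> \<in> schwartz \<Longrightarrow> w \<omega> (\<lambda>x. c * \<phi> x) = c * w \<omega> \<phi>"
  using w_tempered unfolding tempered_distributions_def by blast

lemma w_add: "\<omega> \<in> space M \<Longrightarrow> \<phi> \<in> schwartz \<Longrightarrow> \<eta> \<in> schwartz \<Longrightarrow> w \<omega> (\<lambda>x. \<phi> x + \<eta> x) = w \<omega> \<phi> + w \<omega> \<eta>"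
  using w_tempered unfolding tempered_distributions_def by blast

lemma w_diff: "\<omega> \<in> space M \<Longrightarrow> \<phi> \<in> schwartz \<Longrightarrow> \<eta> \<in> schwartz \<Longrightarrow> w \<omega> (\<lambda>x. \<phi> x - \<eta> x) = w \<omega> \<phi> - w \<omega> \<eta>"
  using w_add[of \<omega> \<phi> "\<lambda>x. - 1 * \<eta> x"] w_cmult[of \<omega> \<eta> "- 1"] schwartz_cmult[of \<eta> "- 1"] by simp

lemma char_w_scaled:
  assumes "\<phi> \<in> schwartz"
  shows "(\<integral>\<omega>. iexp (\<xi> * w \<omega> \<phi>) \<partial>M) = exp (\<integral>x. \<Psi> (\<xi> * \<phi> x) \<partial>lborel)"
proof -
  have "(\<integral>\<omega>. iexp (\<xi> * w \<omega> \<phi>) \<partial>M) = (\<integral>\<omega>. iexp (w \<omega> (\<lambda>x. \<xi> * \<phi> x)) \<partial>M)"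
    by (intro Bochner_Integration.integral_cong refl) (simp add: w_cmult assms)
  then show ?thesis using char_w[OF schwartz_cmult[OF assms]] by simp
qed

text \<open>Continuity and \<Psi> 0 = 0 control a ball of radius r around 0; outside it the constant
  1 in the growth bound is at most \<open>\<xi>\<^sup>2 / r\<^sup>2\<close>.\<close>

lemma \<Psi>_le_small_plus_quadratic:
  assumes "0 < \<eta>"
  shows "\<exists>C\<ge>0. \<forall>\<xi>. cmod (\<Psi> \<xi>) \<le> \<eta> + C * \<xi>\<^sup>2"
proof -
  obtain C where C: "0 \<le> C" "\<And>\<xi>. cmod (\<Psi> \<xi>) \<le> C * (1 + \<xi>\<^sup>2)" using \<Psi>_growth by blast
  have "isCont \<Psi> 0" using \<Psi>_cont by (simp add: continuous_on_eq_continuous_at)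
  then obtain r where r: "0 < r" "\<And>\<xi>. \<bar>\<xi>\<bar> < r \<Longrightarrow> cmod (\<Psi> \<xi>) < \<eta>"
    unfolding continuous_at_eps_delta using assms \<Psi>_0 by (auto simp: dist_norm)
  let ?C = "C * (1 / r\<^sup>2 + 1)"
  have "cmod (\<Psi> \<xi>) \<le> \<eta> + ?C * \<xi>\<^sup>2" for \<xi>
  proof (cases "\<bar>\<xi>\<bar> < r")
    case True
    then show ?thesis using r(2)[of \<xi>] C(1) by (intro add_increasing2) auto
  next
    case False
    then have "r\<^sup>2 \<le> \<xi>\<^sup>2" using r(1) abs_le_square_iff[of r \<xi>] by simp
    then have "1 + \<xi>\<^sup>2 \<le> (1 / r\<^sup>2 + 1) * \<xi>\<^sup>2" using r(1) by (simp add: field_simps)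
    then have "C * (1 + \<xi>\<^sup>2) \<le> ?C * \<xi>\<^sup>2" using C(1) by (simp add: mult.assoc mult_left_mono)
    then show ?thesis using C(2)[of \<xi>] assms by linarith
  qed
  then show ?thesis using C(1) by (intro exI[of _ ?C]) auto
qed

text \<open>The tail bound involves only frequencies up to 2/e, where the exponent is at most h
  times the volume of K plus a constant times the squared L2 norm. The fixed compact K is what makes
  the first term small uniformly in n.\<close>

lemma w_tendsto_0_in_prob:
  assumes \<eta>: "\<And>n. \<eta> n \<in> schwartz" and K: "compact K" "\<And>n x. x \<notin> K \<Longrightarrow> \<eta> n x = 0"
    and lim: "(\<lambda>n. \<integral>\<^sup>+x. ennreal ((\<eta> n x)\<^sup>2) \<partial>lborel) \<longlonglongrightarrow> 0"
  shows "tendsto_in_prob M (\<lambda>n \<omega>. w \<omega> (\<eta> n)) (\<lambda>\<omega>. 0)"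
  unfolding tendsto_in_prob_def LIMSEQ_iff
proof (intro allI impI)
  fix e \<delta> :: real assume e: "0 < e" and \<delta>: "0 < \<delta>"
  have Km: "K \<in> sets lborel" using K(1) by (simp add: compact_imp_closed)
  obtain k where k: "0 \<le> k" "emeasure lborel K = ennreal k"
    using emeasure_compact_finite[OF K(1)] by (metis ennreal_cases less_irrefl infinity_ennreal_def)
  \<comment> \<open>The budget: \<delta>/8 from the volume term and \<delta>/16 from the L2 term
    bound the exponent by 3\<delta>/16; the factor 2 of \<open>one_minus_Re_exp_le\<close> and the
    factor 2 of the tail bound give 3\<delta>/4. Using k + 1 avoids division by zero when K is a
    null set.\<close>
  define h where "h = \<delta> / (8 * (k + 1))"
  have h: "0 < h" "h * k \<le> \<delta> / 8" using \<delta> k(1) by (auto simp: h_def field_simps)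
  obtain C where C: "0 \<le> C" "\<And>\<xi>. cmod (\<Psi> \<xi>) \<le> h + C * \<xi>\<^sup>2"
    using \<Psi>_le_small_plus_quadratic[OF h(1)] by blast
  define D where "D = C * (2 / e)\<^sup>2"
  have D: "0 \<le> D" using C(1) by (simp add: D_def)
  have "(\<lambda>n. ennreal D * (\<integral>\<^sup>+x. ennreal ((\<eta> n x)\<^sup>2) \<partial>lborel)) \<longlonglongrightarrow> 0"
    using ennreal_tendsto_cmult[OF _ lim, of "ennreal D"] by simp
  then have "eventually (\<lambda>n. ennreal D * (\<integral>\<^sup>+x. ennreal ((\<eta> n x)\<^sup>2) \<partial>lborel) < ennreal (\<delta> / 16)) sequentially"
    by (rule order_tendstoD) (use \<delta> in simp)
  then obtain N where N: "\<And>n. N \<le> n \<Longrightarrow> ennreal D * (\<integral>\<^sup>+x. ennreal ((\<eta> n x)\<^sup>2) \<partial>lborel) < ennreal (\<delta> / 16)"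
    by (auto simp: eventually_sequentially)
  have "prob {\<omega> \<in> space M. e < \<bar>w \<omega> (\<eta> n)\<bar>} < \<delta>" if n: "N \<le> n" for n
  proof -
    have [measurable]: "\<eta> n \<in> borel_measurable borel" by (rule schwartz_measurable[OF \<eta>])
    have "expectation (\<lambda>\<omega>. 1 - cos (\<xi> * w \<omega> (\<eta> n))) \<le> 2 * (3 * \<delta> / 16)" if \<xi>: "0 \<le> \<xi>" "\<xi> \<le> 2 / e" for \<xi>
    proof -
      let ?z = "\<integral>x. \<Psi> (\<xi> * \<eta> n x) \<partial>lborel"
      have "ennreal (cmod ?z) \<le> (\<integral>\<^sup>+x. ennreal (cmod (\<Psi> (\<xi> * \<eta> n x))) \<partial>lborel)"
        by (rule norm_integral_le_nn_integral)
      also have "\<dots> \<le> (\<integral>\<^sup>+x. ennreal h * indicator K x + ennreal D * ennreal ((\<eta> n x)\<^sup>2) \<partial>lborel)"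
      proof (intro nn_integral_mono)
        fix x
        show "ennreal (cmod (\<Psi> (\<xi> * \<eta> n x))) \<le> ennreal h * indicator K x + ennreal D * ennreal ((\<eta> n x)\<^sup>2)"
        proof (cases "x \<in> K")
          case True
          have "C * (\<xi> * \<eta> n x)\<^sup>2 \<le> D * (\<eta> n x)\<^sup>2"
            unfolding D_def power_mult_distrib mult.assoc[symmetric]
            using \<xi> C(1) by (intro mult_right_mono mult_left_mono power_mono) auto
          then have "cmod (\<Psi> (\<xi> * \<eta> n x)) \<le> h + D * (\<eta> n x)\<^sup>2"
            using C(2)[of "\<xi> * \<eta> n x"] by linarith
          then show ?thesis using True h(1) D
            by (simp flip: ennreal_mult ennreal_plus) 
        qed (simp add: K(2) \<Psi>_0)
      qed
      also have "\<dots> = ennreal h * emeasure lborel K + ennreal D * (\<integral>\<^sup>+x. ennreal ((\<eta> n x)\<^sup>2) \<partial>lborel)"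
        using Km by (subst nn_integral_add) (auto simp: nn_integral_cmult_indicator nn_integral_cmult)
      also have "\<dots> \<le> ennreal (\<delta> / 8) + ennreal (\<delta> / 16)"
        using h k N[OF n] by (intro add_mono) (auto simp flip: ennreal_mult intro: ennreal_leI)
      also have "\<dots> = ennreal (3 * \<delta> / 16)" using \<delta> by (simp flip: ennreal_plus)
      finally have z: "cmod ?z \<le> 3 * \<delta> / 16" using \<delta> by (simp add: ennreal_le_iff)
      have "expectation (\<lambda>\<omega>. 1 - cos (\<xi> * w \<omega> (\<eta> n))) = 1 - Re (exp ?z)"
        unfolding char_w_scaled[OF \<eta>, symmetric]
        by (intro Re_char borel_measurable_times borel_measurable_const w_measurable \<eta>)
      also have "\<dots> \<le> 2 * cmod ?z" by (intro one_minus_Re_exp_le Re_integral_nonpos \<Psi>_Re)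
      finally show ?thesis using z by simp
    qed
    then have "prob {\<omega> \<in> space M. e < \<bar>w \<omega> (\<eta> n)\<bar>} \<le> 2 * (2 * (3 * \<delta> / 16))"
      by (intro prob_gt_le_integral_one_minus_cos[OF w_measurable[OF \<eta>] e]) auto
    then show ?thesis using \<delta> by simp
  qed
  then show "\<exists>no. \<forall>n\<ge>no. norm (prob {\<omega> \<in> space M. e < \<bar>w \<omega> (\<eta> n) - 0\<bar>} - 0) < \<delta>" by auto
qed

text \<open>Independent index sequences r and s allow two uses: one approximating sequence with
  different indices yields the Cauchy property, two sequences with equal indices yield independence
  of the approximation.\<close>

lemma approximates_diff_tendsto_0:
  fixes \<phi> :: "real^'d \<Rightarrow> real"
  assumes \<phi>: "\<phi> \<in> borel_measurable lebesgue" and a: "approximates \<phi>s \<phi>" and b: "approximates \<eta>s \<phi>"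
    and r: "filterlim r at_top sequentially" "filterlim s at_top sequentially"
  shows "tendsto_in_prob M (\<lambda>n \<omega>. w \<omega> (\<phi>s (r n)) - w \<omega> (\<eta>s (s n))) (\<lambda>\<omega>. 0)"
proof -
  from a obtain K where \<phi>s: "\<And>n. \<phi>s n \<in> schwartz" and K: "compact K" "\<And>n x. x \<notin> K \<Longrightarrow> \<phi>s n x = 0"
    and l1: "(\<lambda>n. \<integral>\<^sup>+x. ennreal ((\<phi>s n x - \<phi> x)\<^sup>2) \<partial>lebesgue) \<longlonglongrightarrow> 0"
    unfolding approximates_def by blast
  from b obtain L where \<eta>s: "\<And>n. \<eta>s n \<in> schwartz" and L: "compact L" "\<And>n x. x \<notin> L \<Longrightarrow> \<eta>s n x = 0"
    and l2: "(\<lambda>n. \<integral>\<^sup>+x. ennreal ((\<eta>s n x - \<phi> x)\<^sup>2) \<partial>lebesgue) \<longlonglongrightarrow> 0"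
    unfolding approximates_def by blast
  have m: "\<phi>s n \<in> borel_measurable lebesgue" "\<eta>s n \<in> borel_measurable lebesgue" for n
    using schwartz_measurable[OF \<phi>s] schwartz_measurable[OF \<eta>s] by (auto intro: measurable_completion)
  have "tendsto_in_prob M (\<lambda>n \<omega>. w \<omega> (\<lambda>x. \<phi>s (r n) x - \<eta>s (s n) x)) (\<lambda>\<omega>. 0)"
  proof (rule w_tendsto_0_in_prob)
    have "(\<lambda>n. 2 * (\<integral>\<^sup>+x. ennreal ((\<phi>s (r n) x - \<phi> x)\<^sup>2) \<partial>lebesgue) + 2 * (\<integral>\<^sup>+x. ennreal ((\<eta>s (s n) x - \<phi> x)\<^sup>2) \<partial>lebesgue)) \<longlonglongrightarrow> 2 * 0 + 2 * 0"
      by (intro tendsto_add ennreal_tendsto_cmult filterlim_compose[OF l1 r(1)] filterlim_compose[OF l2 r(2)]) auto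
    then have lim0: "(\<lambda>n. 2 * (\<integral>\<^sup>+x. ennreal ((\<phi>s (r n) x - \<phi> x)\<^sup>2) \<partial>lebesgue) + 2 * (\<integral>\<^sup>+x. ennreal ((\<eta>s (s n) x - \<phi> x)\<^sup>2) \<partial>lebesgue)) \<longlonglongrightarrow> 0"
      by simp
    have "(\<lambda>n. \<integral>\<^sup>+x. ennreal ((\<phi>s (r n) x - \<eta>s (s n) x)\<^sup>2) \<partial>lebesgue) \<longlonglongrightarrow> 0"
      by (rule tendsto_sandwich[OF always_eventually always_eventually tendsto_const lim0])
         (intro allI zero_le nn_integral_diff_square_le m \<phi>)+
    then show "(\<lambda>n. \<integral>\<^sup>+x. ennreal ((\<phi>s (r n) x - \<eta>s (s n) x)\<^sup>2) \<partial>lborel) \<longlonglongrightarrow> 0"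
      by (simp add: nn_integral_completion)
    show "compact (K \<union> L)" using K L by auto
  qed (use K L \<phi>s \<eta>s in \<open>auto intro!: schwartz_diff\<close>)
  then show ?thesis
    unfolding tendsto_in_prob_def by (simp add: w_diff \<phi>s \<eta>s cong: conj_cong)
qed

lemma bounded_schwartz_approximates:
  fixes \<phi> :: "real^'d \<Rightarrow> real"
  assumes meas: "\<phi> \<in> borel_measurable lebesgue" and b: "\<And>x. \<bar>\<phi> x\<bar> \<le> b"
    and r: "0 < r" "\<And>x. r < norm x \<Longrightarrow> \<phi> x = 0"
  obtains \<phi>s where "approximates \<phi>s \<phi>" "\<And>n x. \<bar>\<phi>s n x\<bar> \<le> b + 1"
    "\<And>n x. 3 * r < norm x \<Longrightarrow> \<phi>s n x = 0" "AE x in lebesgue. (\<lambda>n. \<phi>s n x) \<longlonglongrightarrow> \<phi> x"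
proof -
  obtain \<phi>s where \<phi>s: "\<And>n. \<phi>s n \<in> schwartz" "\<And>n x. \<bar>\<phi>s n x\<bar> \<le> b + 1"
    "\<And>n x. 3 * r < norm x \<Longrightarrow> \<phi>s n x = 0" "AE x in lebesgue. (\<lambda>n. \<phi>s n x) \<longlonglongrightarrow> \<phi> x"
    using bounded_measurable_schwartz_approx[OF assms] by blast
  have m: "\<phi>s n \<in> borel_measurable lebesgue" for n
    using schwartz_measurable[OF \<phi>s(1)] by (auto intro: measurable_completion)
  have [measurable]: "cball (0::real^'d) (3 * r) \<in> sets lebesgue" by auto
  have "(\<lambda>n. \<integral>\<^sup>+x. ennreal ((\<phi>s n x - \<phi> x)\<^sup>2) \<partial>lebesgue) \<longlonglongrightarrow> (\<integral>\<^sup>+(x::real^'d). 0 \<partial>lebesgue)"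
  proof (rule nn_integral_dominated_convergence[where w="\<lambda>x. ennreal ((2 * b + 1)\<^sup>2) * indicator (cball 0 (3 * r)) x"])
    show "AE x in lebesgue. ennreal ((\<phi>s n x - \<phi> x)\<^sup>2) \<le> ennreal ((2 * b + 1)\<^sup>2) * indicator (cball 0 (3 * r)) x" for n
    proof (rule AE_I2)
      fix x
      show "ennreal ((\<phi>s n x - \<phi> x)\<^sup>2) \<le> ennreal ((2 * b + 1)\<^sup>2) * indicator (cball 0 (3 * r)) x"
      proof (cases "norm x \<le> 3 * r")
        case True
        have "\<bar>\<phi>s n x - \<phi> x\<bar> \<le> \<bar>2 * b + 1\<bar>" using \<phi>s(2)[of n x] b[of x] by linarith
        then have "(\<phi>s n x - \<phi> x)\<^sup>2 \<le> (2 * b + 1)\<^sup>2" by (simp add: abs_le_square_iff)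
        then show ?thesis using True by (simp add: ennreal_leI)
      next
        case False
        then show ?thesis using \<phi>s(3)[of x n] r by simp
      qed
    qed
    show "(\<integral>\<^sup>+x. ennreal ((2 * b + 1)\<^sup>2) * indicator (cball (0::real^'d) (3 * r)) x \<partial>lebesgue) < \<infinity>"
      using emeasure_lborel_cball_finite[of "0::real^'d" "3 * r"]
      by (simp add: nn_integral_cmult_indicator ennreal_mult_less_top)
    show "AE x in lebesgue. (\<lambda>n. ennreal ((\<phi>s n x - \<phi> x)\<^sup>2)) \<longlonglongrightarrow> 0"
      using \<phi>s(4)
    proof eventually_elim
      fix x assume "(\<lambda>n. \<phi>s n x) \<longlonglongrightarrow> \<phi> x"
      then have "(\<lambda>n. ennreal ((\<phi>s n x - \<phi> x)\<^sup>2)) \<longlonglongrightarrow> ennreal ((\<phi> x - \<phi> x)\<^sup>2)"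
        by (intro tendsto_intros)
      then show "(\<lambda>n. ennreal ((\<phi>s n x - \<phi> x)\<^sup>2)) \<longlonglongrightarrow> 0" by simp
    qed
  qed (use m meas in measurable)
  then have "(\<lambda>n. \<integral>\<^sup>+x. ennreal ((\<phi>s n x - \<phi> x)\<^sup>2) \<partial>lebesgue) \<longlonglongrightarrow> 0" by simp
  moreover have "{x. \<phi>s n x \<noteq> 0} \<subseteq> cball 0 (3 * r)" for n
    using \<phi>s(3)[of _ n] by (force simp: not_le[symmetric])
  ultimately have "approximates \<phi>s \<phi>"
    unfolding approximates_def
    by (intro conjI allI exI[of _ "cball 0 (3 * r)"] compact_cball \<phi>s(1))
  then show thesis using that \<phi>s by blast
qed

lemma pairing_exists:
  fixes \<phi> :: "real^'d \<Rightarrow> real"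
  assumes \<phi>: "\<phi> \<in> borel_measurable lebesgue" and \<phi>s: "approximates \<phi>s \<phi>"
  shows "\<exists>X\<in>borel_measurable M. \<forall>\<phi>s. approximates \<phi>s \<phi> \<longrightarrow> tendsto_in_prob M (\<lambda>n \<omega>. w \<omega> (\<phi>s n)) X"
proof -
  have sch: "\<phi>s n \<in> schwartz" if "approximates \<phi>s \<phi>" for \<phi>s n using that by (simp add: approximates_def)
  have "\<exists>N. \<forall>m\<ge>N. \<forall>n\<ge>N. prob {\<omega> \<in> space M. e < \<bar>w \<omega> (\<phi>s m) - w \<omega> (\<phi>s n)\<bar>} < \<delta>"
    if "0 < e" "0 < \<delta>" for e \<delta>
  \<comment> \<open>If the Cauchy condition fails, indices m N and n N beyond each N violate it;
    both tend to infinity, which contradicts \<open>approximates_diff_tendsto_0\<close>.\<close>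
  proof (rule ccontr)
    define P where "P m n \<longleftrightarrow> \<delta> \<le> prob {\<omega> \<in> space M. e < \<bar>w \<omega> (\<phi>s m) - w \<omega> (\<phi>s n)\<bar>}" for m n
    assume "\<not> ?thesis"
    then have "\<forall>N. \<exists>m n. N \<le> m \<and> N \<le> n \<and> P m n"
      unfolding P_def not_less[symmetric] by blast
    then obtain m n where mn: "\<And>N. N \<le> m N" "\<And>N. N \<le> n N" and "\<And>N. P (m N) (n N)"
      by metis
    then have mn3: "\<And>N. \<delta> \<le> prob {\<omega> \<in> space M. e < \<bar>w \<omega> (\<phi>s (m N)) - w \<omega> (\<phi>s (n N))\<bar>}"
      by (simp add: P_def)
    have "filterlim m at_top sequentially" "filterlim n at_top sequentially"
      using mn by (auto intro: filterlim_at_top_mono[OF filterlim_ident])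
    from approximates_diff_tendsto_0[OF \<phi> \<phi>s \<phi>s this] that(1)
    have "(\<lambda>N. prob {\<omega> \<in> space M. e < \<bar>w \<omega> (\<phi>s (m N)) - w \<omega> (\<phi>s (n N))\<bar>}) \<longlonglongrightarrow> 0"
      by (simp add: tendsto_in_prob_def)
    from order_tendstoD(2)[OF this that(2)] mn3 show False
      by (auto simp: eventually_sequentially not_less[symmetric])
  qed
  then obtain X where X: "X \<in> borel_measurable M" "tendsto_in_prob M (\<lambda>n \<omega>. w \<omega> (\<phi>s n)) X"
    using Cauchy_in_prob_convergent[of "\<lambda>n \<omega>. w \<omega> (\<phi>s n)"] sch[OF \<phi>s] by auto
  have "tendsto_in_prob M (\<lambda>n \<omega>. w \<omega> (\<eta>s n)) X" if "approximates \<eta>s \<phi>" for \<eta>s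
    using approximates_diff_tendsto_0[OF \<phi> that \<phi>s filterlim_ident filterlim_ident]
    by (intro tendsto_in_prob_trans[OF _ _ X(1) X(2)] w_measurable sch[OF that] sch[OF \<phi>s])
  then show ?thesis using X(1) by blast
qed

text \<open>Existence turns the choice in \<open>pairing\<close> into its defining property. The
  characteristic function is then the common limit of two computations along one approximating
  sequence: convergence in probability on the left, dominated convergence of the exponents on the
  right.\<close>

lemma
  fixes \<phi> :: "real^'d \<Rightarrow> real"
  assumes \<phi>: "\<phi> \<in> borel_measurable lebesgue" and b: "\<And>x. \<bar>\<phi> x\<bar> \<le> b"
    and r: "0 < r" "\<And>x. r < norm x \<Longrightarrow> \<phi> x = 0"
  shows pairing_measurable: "pairing M w \<phi> \<in> borel_measurable M"
    and char_pairing: "(\<integral>\<omega>. iexp (\<xi> * pairing M w \<phi> \<omega>) \<partial>M) = exp (\<integral>x. \<Psi> (\<xi> * \<phi> x) \<partial>lebesgue)"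
proof -
  obtain \<phi>s where \<phi>s: "approximates \<phi>s \<phi>" "\<And>n x. \<bar>\<phi>s n x\<bar> \<le> b + 1"
    "\<And>n x. 3 * r < norm x \<Longrightarrow> \<phi>s n x = 0" "AE x in lebesgue. (\<lambda>n. \<phi>s n x) \<longlonglongrightarrow> \<phi> x"
    using bounded_schwartz_approximates[OF assms] by blast
  have sch: "\<phi>s n \<in> schwartz" for n using \<phi>s(1) by (simp add: approximates_def)
  let ?P = "\<lambda>X. X \<in> borel_measurable M \<and>
     (\<forall>\<phi>s. approximates \<phi>s \<phi> \<longrightarrow> tendsto_in_prob M (\<lambda>n \<omega>. w \<omega> (\<phi>s n)) X)"
  have "\<exists>X. ?P X" using pairing_exists[OF \<phi> \<phi>s(1)] by blast
  then have P: "?P (pairing M w \<phi>)" unfolding pairing_def by (rule someI_ex)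
  then show X [measurable]: "pairing M w \<phi> \<in> borel_measurable M" ..
  have lim: "tendsto_in_prob M (\<lambda>n \<omega>. w \<omega> (\<phi>s n)) (pairing M w \<phi>)" using P \<phi>s(1) by blast
  have "tendsto_in_prob M (\<lambda>n \<omega>. \<xi> * w \<omega> (\<phi>s n)) (\<lambda>\<omega>. \<xi> * pairing M w \<phi> \<omega>)"
  proof (cases "\<xi> = 0")
    case True
    then show ?thesis by (auto simp: tendsto_in_prob_def)
  next
    case False
    have "(e < \<bar>\<xi> * a - \<xi> * b\<bar>) = (e / \<bar>\<xi>\<bar> < \<bar>a - b\<bar>)" for e a b :: real
      using False by (simp add: field_simps flip: abs_mult)
    then show ?thesis using lim False by (simp add: tendsto_in_prob_def)
  qed
  then have "(\<lambda>n. \<integral>\<omega>. iexp (\<xi> * w \<omega> (\<phi>s n)) \<partial>M) \<longlonglongrightarrow> (\<integral>\<omega>. iexp (\<xi> * pairing M w \<phi> \<omega>) \<partial>M)"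
    using sch by (intro tendsto_in_prob_char) auto
  then have 1: "(\<lambda>n. exp (\<integral>x. \<Psi> (\<xi> * \<phi>s n x) \<partial>lborel)) \<longlonglongrightarrow> (\<integral>\<omega>. iexp (\<xi> * pairing M w \<phi> \<omega>) \<partial>M)"
    unfolding char_w_scaled[OF sch] .
  have m: "\<phi>s n \<in> borel_measurable borel" for n
    using schwartz_measurable[OF sch] .
  have m': "\<phi>s n \<in> borel_measurable lebesgue" for n
    using m by (auto intro: measurable_completion)
  obtain C where C: "0 \<le> C" "\<And>\<xi>. cmod (\<Psi> \<xi>) \<le> C * (1 + \<xi>\<^sup>2)" using \<Psi>_growth by blast
  have "(\<lambda>n. \<integral>x. \<Psi> (\<xi> * \<phi>s n x) \<partial>lebesgue) \<longlonglongrightarrow> (\<integral>x. \<Psi> (\<xi> * \<phi> x) \<partial>lebesgue)"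
  proof (rule integral_dominated_convergence[where w="\<lambda>x. C * (1 + (\<xi> * (b + 1))\<^sup>2) * indicator (cball 0 (3 * r)) x"])
    show "(\<lambda>x. \<Psi> (\<xi> * \<phi> x)) \<in> borel_measurable lebesgue" using \<phi> by measurable
    show "(\<lambda>x. \<Psi> (\<xi> * \<phi>s n x)) \<in> borel_measurable lebesgue" for n using m'[of n] by measurable
    show "integrable lebesgue (\<lambda>x :: real^'d. C * (1 + (\<xi> * (b + 1))\<^sup>2) * indicator (cball 0 (3 * r)) x :: real)"
      using emeasure_lborel_cball_finite[of "0::real^'d" "3 * r"]
      by (intro integrable_mult_right integrable_real_indicator) auto
    show "AE x in lebesgue. (\<lambda>n. \<Psi> (\<xi> * \<phi>s n x)) \<longlonglongrightarrow> \<Psi> (\<xi> * \<phi> x)"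
      using \<phi>s(4)
    proof eventually_elim
      fix x assume "(\<lambda>n. \<phi>s n x) \<longlonglongrightarrow> \<phi> x"
      then show "(\<lambda>n. \<Psi> (\<xi> * \<phi>s n x)) \<longlonglongrightarrow> \<Psi> (\<xi> * \<phi> x)"
        using \<Psi>_cont by (intro continuous_on_tendsto_compose[OF \<Psi>_cont] tendsto_intros) auto
    qed
    show "AE x in lebesgue. cmod (\<Psi> (\<xi> * \<phi>s n x)) \<le> C * (1 + (\<xi> * (b + 1))\<^sup>2) * indicator (cball 0 (3 * r)) x" for n
    proof (rule AE_I2)
      fix x
      show "cmod (\<Psi> (\<xi> * \<phi>s n x)) \<le> C * (1 + (\<xi> * (b + 1))\<^sup>2) * indicator (cball 0 (3 * r)) x"
      proof (cases "norm x \<le> 3 * r")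
        case True
        have "\<bar>\<phi>s n x\<bar> \<le> \<bar>b + 1\<bar>" using \<phi>s(2)[of n x] by linarith
        then have "\<bar>\<xi> * \<phi>s n x\<bar> \<le> \<bar>\<xi> * (b + 1)\<bar>" by (simp add: abs_mult mult_left_mono)
        then have "(\<xi> * \<phi>s n x)\<^sup>2 \<le> (\<xi> * (b + 1))\<^sup>2" by (simp add: abs_le_square_iff)
        then have "C * (1 + (\<xi> * \<phi>s n x)\<^sup>2) \<le> C * (1 + (\<xi> * (b + 1))\<^sup>2)" using C(1) by (intro mult_left_mono) auto
        then show ?thesis using True order_trans[OF C(2)[of "\<xi> * \<phi>s n x"]] by simp
      next
        case False
        then show ?thesis using \<phi>s(3)[of x n] by (simp add: \<Psi>_0)
      qed
    qed
  qed
  \<comment> \<open>The limit \<phi> is only Lebesgue measurable, whereas the noise is specified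
    with \<open>lborel\<close>; for the Borel measurable approximants both integrals agree.\<close>
  moreover have "(\<integral>x. \<Psi> (\<xi> * \<phi>s n x) \<partial>lebesgue) = (\<integral>x. \<Psi> (\<xi> * \<phi>s n x) \<partial>lborel)" for n
  proof (rule integral_completion)
    have "\<phi>s n \<in> borel_measurable lborel" using m[of n] by simp
    then show "(\<lambda>x. \<Psi> (\<xi> * \<phi>s n x)) \<in> borel_measurable lborel" by measurable
  qed
  ultimately have "(\<lambda>n. exp (\<integral>x. \<Psi> (\<xi> * \<phi>s n x) \<partial>lborel)) \<longlonglongrightarrow> exp (\<integral>x. \<Psi> (\<xi> * \<phi> x) \<partial>lebesgue)"
    by (intro tendsto_exp) simp
  from LIMSEQ_unique[OF 1 this]
  show "(\<integral>\<omega>. iexp (\<xi> * pairing M w \<phi> \<omega>) \<partial>M) = exp (\<integral>x. \<Psi> (\<xi> * \<phi> x) \<partial>lebesgue)" .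
qed

end

section \<open>Moments from characteristic functions\<close>

lemma nn_integral_powr_from_0:
  fixes a c :: real
  assumes "-1 < a" "0 \<le> c"
  shows "(\<integral>\<^sup>+x. ennreal (x powr a) * indicator {0..c} x \<partial>lborel) = ennreal (c powr (a + 1) / (a + 1))"
  using assms by (intro nn_integral_has_integral_lebesgue' has_integral_powr_from_0) auto

lemma nn_integral_powr_to_inf:
  fixes a c :: real
  assumes "a < -1" "0 < c"
  shows "(\<integral>\<^sup>+x. ennreal (x powr a) * indicator {c..} x \<partial>lborel) = ennreal (- (c powr (a + 1)) / (a + 1))"
  using assms by (intro nn_integral_has_integral_lebesgue' has_integral_powr_to_inf) auto

text \<open>The power bound is used below T, where q > p makes the weight integrable at 0, and the
  constant 2 above T, where p > 0 makes it integrable at infinity. T stays free in order to be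
  balanced later.\<close>

lemma nn_integral_weighted_powr_le:
  fixes f :: "real \<Rightarrow> real"
  assumes p: "0 < p" "p < q" and T: "0 < T" and K: "0 \<le> K"
    and f: "\<And>u. 0 < u \<Longrightarrow> f u \<le> K * u powr q" "\<And>u. 0 < u \<Longrightarrow> f u \<le> 2"
  shows "(\<integral>\<^sup>+u. ennreal (f u * u powr (- p - 1)) * indicator {0<..} u \<partial>lborel)
    \<le> ennreal (K * (T powr (q - p) / (q - p)) + 2 * (T powr (- p) / p))"
proof -
  have "(\<integral>\<^sup>+u. ennreal (f u * u powr (- p - 1)) * indicator {0<..} u \<partial>lborel) \<le>
     (\<integral>\<^sup>+u. ennreal K * (ennreal (u powr (q - p - 1)) * indicator {0..T} u) +
        ennreal 2 * (ennreal (u powr (- p - 1)) * indicator {T..} u) \<partial>lborel)"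
  proof (intro nn_integral_mono)
    fix u :: real
    consider "u \<le> 0" | "0 < u" "u \<le> T" | "0 < u" "T < u" by linarith
    then show "ennreal (f u * u powr (- p - 1)) * indicator {0<..} u \<le>
      ennreal K * (ennreal (u powr (q - p - 1)) * indicator {0..T} u) +
        ennreal 2 * (ennreal (u powr (- p - 1)) * indicator {T..} u)"
    proof cases
      case 2
      have "f u * u powr (- p - 1) \<le> K * u powr q * u powr (- p - 1)"
        using f(1) 2 by (intro mult_right_mono) auto
      also have "\<dots> = K * u powr (q - p - 1)"
        by (simp add: mult.assoc flip: powr_add) (simp add: algebra_simps)
      finally have "ennreal (f u * u powr (- p - 1)) \<le> ennreal K * ennreal (u powr (q - p - 1))"
        using K by (simp add: ennreal_leI flip: ennreal_mult)
      then show ?thesis using 2 by (auto intro: order_trans add_increasing2)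
    next
      case 3
      have "f u * u powr (- p - 1) \<le> 2 * u powr (- p - 1)"
        using f(2) 3 by (intro mult_right_mono) auto
      then have "ennreal (f u * u powr (- p - 1)) \<le> ennreal 2 * ennreal (u powr (- p - 1))"
        by (subst ennreal_mult[symmetric]) (auto intro: ennreal_leI)
      then show ?thesis using 3 by simp
    qed simp
  qed
  also have "\<dots> = ennreal K * ennreal (T powr (q - p) / (q - p)) + ennreal 2 * ennreal (T powr (- p) / p)"
    using p T nn_integral_powr_from_0[of "q - p - 1" T] nn_integral_powr_to_inf[of "- p - 1" T]
    by (subst nn_integral_add) (simp_all add: nn_integral_cmult)
  also have "\<dots> = ennreal (K * (T powr (q - p) / (q - p)) + 2 * (T powr (- p) / p))"
    using p K by (simp add: ennreal_mult del: times_divide_eq_right)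
  finally show ?thesis .
qed

text \<open>The constant in \<open>\<bar>x\<bar>\<^sup>p c\<^sub>p = \<integral>\<^sub>0\<^sup>\<infinity> (1 - cos (u x)) u\<^sup>-\<^sup>p\<^sup>-\<^sup>1 du\<close>; it is finite only for \<open>0 < p < 2\<close>.\<close>

definition moment_const :: "real \<Rightarrow> ennreal" where
  "moment_const p = (\<integral>\<^sup>+u. ennreal ((1 - cos u) * u powr (- p - 1)) * indicator {0<..} u \<partial>lborel)"

lemma one_minus_cos_le_square: "1 - cos u \<le> (1/2) * u\<^sup>2" for u :: real
proof -
  have "1 - cos u = 2 * (sin (u / 2))\<^sup>2" using cos_double_sin[of "u / 2"] by simp
  also have "\<dots> \<le> 2 * (u / 2)\<^sup>2"
    using abs_sin_x_le_abs_x[of "u / 2"] by (simp only: abs_le_square_iff mult_le_cancel_left) simp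
  finally show ?thesis by (simp add: power_divide)
qed

lemma one_minus_cos_le_2: "1 - cos u \<le> 2" for u :: real
  using cos_ge_minus_one[of u] by linarith

text \<open>For |u| at most 1 the quadratic bound is the stronger one because q is at most 2; for
  larger |u| the power already exceeds 1.\<close>

lemma one_minus_cos_le_powr:
  fixes u q :: real
  assumes "0 < q" "q \<le> 2"
  shows "1 - cos u \<le> 2 * \<bar>u\<bar> powr q"
proof (cases "\<bar>u\<bar> \<le> 1")
  case True
  have "1 - cos u \<le> (1/2) * \<bar>u\<bar>\<^sup>2" using one_minus_cos_le_square[of u] by simp
  also have "\<dots> \<le> 2 * \<bar>u\<bar> powr q"
  proof (cases "u = 0")
    case False
    then have "\<bar>u\<bar> powr 2 \<le> \<bar>u\<bar> powr q" using True assms by (intro powr_mono') auto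
    then have "\<bar>u\<bar>\<^sup>2 \<le> \<bar>u\<bar> powr q" using False by (simp add: powr_numeral)
    then show ?thesis using powr_ge_zero[of "\<bar>u\<bar>" q] by linarith
  qed simp
  finally show ?thesis .
next
  case False
  then have "1 \<le> \<bar>u\<bar> powr q" using assms by (intro ge_one_powr_ge_zero) auto
  then show ?thesis using one_minus_cos_le_2[of u] by linarith
qed

lemma moment_const_less_top:
  assumes "0 < p" "p < 2"
  shows "moment_const p < \<top>"
proof -
  have "moment_const p \<le> ennreal ((1/2) * (1 powr (2 - p) / (2 - p)) + 2 * (1 powr (- p) / p))"
    unfolding moment_const_def
    by (rule nn_integral_weighted_powr_le)
       (use assms one_minus_cos_le_square one_minus_cos_le_2 in \<open>auto simp: powr_numeral\<close>)
  then show ?thesis using ennreal_less_top le_less_trans by blast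
qed

lemma moment_const_pos:
  assumes "0 < p"
  shows "0 < moment_const p"
proof -
  \<comment> \<open>On [1, 2], an interval inside [0, pi], the cosine is at most cos 1 and the
    weight is at least its value at 2.\<close>
  define c where "c = (1 - cos 1) * (2::real) powr (- p - 1)"
  have "cos 1 < cos (0::real)" by (intro cos_monotone_0_pi) (use pi_ge_two in auto)
  then have c: "0 < c" by (simp add: c_def)
  have "ennreal c = (\<integral>\<^sup>+u. ennreal c * indicator {1..2::real} u \<partial>lborel)"
    using c by (simp add: nn_integral_cmult_indicator)
  also have "\<dots> \<le> moment_const p"
    unfolding moment_const_def
  proof (intro nn_integral_mono)
    fix u :: real
    show "ennreal c * indicator {1..2} u \<le> ennreal ((1 - cos u) * u powr (- p - 1)) * indicator {0<..} u"
    proof (cases "u \<in> {1..2}")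
      case True
      have "cos u \<le> cos 1" using True pi_ge_two by (intro cos_monotone_0_pi_le) auto
      moreover have "2 powr (- p - 1) \<le> u powr (- p - 1)"
        using True assms by (intro powr_mono2') auto
      ultimately have "c \<le> (1 - cos u) * u powr (- p - 1)"
        unfolding c_def by (intro mult_mono) auto
      then show ?thesis using True by (simp add: ennreal_leI)
    qed simp
  qed
  finally show ?thesis using c by (metis ennreal_less_zero_iff less_le_trans)
qed

text \<open>Substitute |x| u for u: the Jacobian |x| and the weight |x|^(-p-1) combine to |x|^(-p),
  and evenness of the cosine replaces |x| by x.\<close>

lemma moment_const_scale:
  assumes "0 < p"
  shows "ennreal (\<bar>x\<bar> powr p) * moment_const p =
    (\<integral>\<^sup>+u. ennreal ((1 - cos (u * x)) * u powr (- p - 1)) * indicator {0<..} u \<partial>lborel)"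
proof (cases "x = 0")
  case False
  let ?c = "\<bar>x\<bar>"
  have c: "0 < ?c" using False by simp
  let ?I = "\<integral>\<^sup>+u. ennreal ((1 - cos (u * x)) * u powr (- p - 1)) * indicator {0<..} u \<partial>lborel"
  have "moment_const p = ennreal ?c *
      (\<integral>\<^sup>+u. ennreal ((1 - cos (0 + ?c * u)) * (0 + ?c * u) powr (- p - 1)) * indicator {0<..} (0 + ?c * u) \<partial>lborel)"
    unfolding moment_const_def
    using c by (subst nn_integral_real_affine[where c="?c" and t=0]) auto
  also have "(\<integral>\<^sup>+u. ennreal ((1 - cos (0 + ?c * u)) * (0 + ?c * u) powr (- p - 1)) * indicator {0<..} (0 + ?c * u) \<partial>lborel) =
      (\<integral>\<^sup>+u. ennreal (?c powr (- p - 1)) * (ennreal ((1 - cos (u * x)) * u powr (- p - 1)) * indicator {0<..} u) \<partial>lborel)"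
  proof (intro nn_integral_cong)
    fix u
    have "cos (?c * u) = cos (u * x)"
      by (cases "0 \<le> x") (simp_all add: mult.commute flip: cos_minus[of "- (u * x)"])
    then show "ennreal ((1 - cos (0 + ?c * u)) * (0 + ?c * u) powr (- p - 1)) * indicator {0<..} (0 + ?c * u) =
      ennreal (?c powr (- p - 1)) * (ennreal ((1 - cos (u * x)) * u powr (- p - 1)) * indicator {0<..} u)"
      using c by (auto simp: indicator_def powr_mult zero_less_mult_iff algebra_simps simp flip: ennreal_mult)
  qed
  also have "\<dots> = ennreal (?c powr (- p - 1)) * ?I"
    by (intro nn_integral_cmult) simp
  finally have "ennreal (?c powr p) * moment_const p = ennreal (?c powr p * (?c * ?c powr (- p - 1))) * ?I"
    by (simp add: ennreal_mult mult.assoc)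
  also have "?c powr p * (?c * ?c powr (- p - 1)) = 1"
    using c by (simp add: powr_mult_base flip: powr_add)
  finally show ?thesis by simp
qed simp

section \<open>Two-sided moment bounds from the characteristic exponent\<close>

context prob_space
begin

text \<open>Put x = X in \<open>moment_const_scale\<close> and exchange the integrals by Tonelli.
  Working in \<open>ennreal\<close> means that finiteness of the moment is a conclusion drawn from
  the right-hand side.\<close>

lemma abs_moment_eq_char:
  assumes X [measurable]: "X \<in> borel_measurable M" and p: "0 < p"
  shows "abs_moment M p X * moment_const p =
    (\<integral>\<^sup>+u. ennreal ((1 - Re (\<integral>\<omega>. iexp (u * X \<omega>) \<partial>M)) * u powr (- p - 1)) * indicator {0<..} u \<partial>lborel)"
proof -
  interpret pair_sigma_finite M lborel by (simp add: pair_sigma_finite_def sigma_finite_measure_axioms lborel.sigma_finite_measure_axioms)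
  have "abs_moment M p X * moment_const p = (\<integral>\<^sup>+\<omega>. ennreal (\<bar>X \<omega>\<bar> powr p) * moment_const p \<partial>M)"
    unfolding abs_moment_def by (intro nn_integral_multc[symmetric]) measurable
  also have "\<dots> = (\<integral>\<^sup>+\<omega>. \<integral>\<^sup>+u. ennreal ((1 - cos (u * X \<omega>)) * u powr (- p - 1)) * indicator {0<..} u \<partial>lborel \<partial>M)"
    by (simp only: moment_const_scale[OF p])
  also have "\<dots> = (\<integral>\<^sup>+u. \<integral>\<^sup>+\<omega>. ennreal ((1 - cos (u * X \<omega>)) * u powr (- p - 1)) * indicator {0<..} u \<partial>M \<partial>lborel)"
  proof (rule Fubini'[symmetric])
    have "(\<lambda>z. X (fst z)) \<in> borel_measurable (M \<Otimes>\<^sub>M lborel)"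
      by (rule measurable_compose[OF measurable_fst X])
    moreover have "snd \<in> borel_measurable (M \<Otimes>\<^sub>M lborel)"
      using measurable_snd[of M lborel] by simp
    ultimately show "(\<lambda>(\<omega>, u). ennreal ((1 - cos (u * X \<omega>)) * u powr (- p - 1)) * indicator {0<..} u) \<in> borel_measurable (M \<Otimes>\<^sub>M lborel)"
      unfolding case_prod_beta' by measurable
  qed
  also have "\<dots> = (\<integral>\<^sup>+u. ennreal ((1 - Re (\<integral>\<omega>. iexp (u * X \<omega>) \<partial>M)) * u powr (- p - 1)) * indicator {0<..} u \<partial>lborel)"
  proof (intro nn_integral_cong)
    fix u :: real
    have int: "integrable M (\<lambda>\<omega>. 1 - cos (u * X \<omega>))"
      by (intro integrable_one_minus_cos) measurable
    have "(\<integral>\<^sup>+\<omega>. ennreal ((1 - cos (u * X \<omega>)) * u powr (- p - 1)) \<partial>M) = ennreal (expectation (\<lambda>\<omega>. (1 - cos (u * X \<omega>)) * u powr (- p - 1)))"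
      using int by (intro nn_integral_eq_integral) auto
    also have "expectation (\<lambda>\<omega>. (1 - cos (u * X \<omega>)) * u powr (- p - 1)) = (1 - Re (\<integral>\<omega>. iexp (u * X \<omega>) \<partial>M)) * u powr (- p - 1)"
      using Re_char[of "\<lambda>\<omega>. u * X \<omega>"] by simp
    finally show "(\<integral>\<^sup>+\<omega>. ennreal ((1 - cos (u * X \<omega>)) * u powr (- p - 1)) * indicator {0<..} u \<partial>M) =
        ennreal ((1 - Re (\<integral>\<omega>. iexp (u * X \<omega>) \<partial>M)) * u powr (- p - 1)) * indicator {0<..} u"
      by (auto simp: indicator_def)
  qed
  finally show ?thesis .
qed

lemma abs_moment_upper_bound:
  assumes X: "X \<in> borel_measurable M" and p: "0 < p" "p < q" "p < 2" and K: "0 < K"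
    and char: "\<And>\<xi>. 0 < \<xi> \<Longrightarrow> (\<integral>\<omega>. iexp (\<xi> * X \<omega>) \<partial>M) = exp (z \<xi>)"
    and z: "\<And>\<xi>. Re (z \<xi>) \<le> 0" "\<And>\<xi>. 0 < \<xi> \<Longrightarrow> cmod (z \<xi>) \<le> K * \<xi> powr q"
  shows "abs_moment M p X \<le> ennreal ((2 / (q - p) + 2 / p) / enn2real (moment_const p) * K powr (p / q))"
proof -
  define \<kappa> where "\<kappa> = enn2real (moment_const p)"
  have \<kappa>: "moment_const p = ennreal \<kappa>" "0 < \<kappa>"
    using moment_const_pos[OF p(1)] moment_const_less_top[OF p(1,3)]
    by (auto simp: \<kappa>_def enn2real_positive_iff)
  \<comment> \<open>At this T the bound K T^q equals 1, so the two pieces of the integral balance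
    and both scale like K^(p/q).\<close>
  define T where "T = K powr (- 1 / q)"
  have T: "0 < T" using K by (simp add: T_def)
  have "abs_moment M p X * moment_const p \<le> ennreal (2 * K * (T powr (q - p) / (q - p)) + 2 * (T powr (- p) / p))"
    unfolding abs_moment_eq_char[OF X p(1)]
  proof (rule nn_integral_weighted_powr_le[OF p(1,2) T])
    fix u :: real assume u: "0 < u"
    show "1 - Re (\<integral>\<omega>. iexp (u * X \<omega>) \<partial>M) \<le> 2 * K * u powr q"
      using one_minus_Re_exp_le[OF z(1)[of u]] z(2)[OF u] char[OF u] by simp
    have "\<bar>Re (exp (z u))\<bar> \<le> 1"
      using z(1)[of u] order_trans[OF abs_Re_le_cmod[of "exp (z u)"], of 1] by simp
    then show "1 - Re (\<integral>\<omega>. iexp (u * X \<omega>) \<partial>M) \<le> 2"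
      unfolding char[OF u] by linarith
  qed (use K in simp)
  also have "2 * K * (T powr (q - p) / (q - p)) + 2 * (T powr (- p) / p) = (2 / (q - p) + 2 / p) * K powr (p / q)"
  proof -
    have q: "0 < q" using p by simp
    have "K * T powr (q - p) = K powr 1 * K powr (- 1 / q * (q - p))"
      using K by (simp add: T_def powr_powr)
    also have "\<dots> = K powr (p / q)"
      unfolding powr_add[symmetric] using q by (simp add: field_simps)
    finally have 1: "K * T powr (q - p) = K powr (p / q)" .
    have 2: "T powr (- p) = K powr (p / q)" by (simp add: T_def powr_powr)
    have "2 * K * (T powr (q - p) / (q - p)) + 2 * (T powr (- p) / p) = 2 / (q - p) * (K * T powr (q - p)) + 2 / p * T powr (- p)"
      by simp
    then show ?thesis unfolding 1 2 by (simp add: distrib_right)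
  qed
  finally have "abs_moment M p X * ennreal \<kappa> \<le> ennreal ((2 / (q - p) + 2 / p) * K powr (p / q))"
    by (simp add: \<kappa>)
  then have "abs_moment M p X * ennreal \<kappa> * ennreal (1 / \<kappa>) \<le> ennreal ((2 / (q - p) + 2 / p) * K powr (p / q)) * ennreal (1 / \<kappa>)"
    by (rule mult_right_mono) simp
  moreover have "ennreal \<kappa> * ennreal (1 / \<kappa>) = 1" using \<kappa>(2) by (simp flip: ennreal_mult)
  ultimately have "abs_moment M p X \<le> ennreal ((2 / (q - p) + 2 / p) * K powr (p / q)) * ennreal (1 / \<kappa>)"
    by (simp add: mult.assoc)
  also have "\<dots> = ennreal ((2 / (q - p) + 2 / p) / \<kappa> * K powr (p / q))"
    using p \<kappa>(2) by (subst ennreal_mult[symmetric]) auto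
  finally show ?thesis unfolding \<kappa>_def .
qed

text \<open>Only the frequencies in [T, 2T] are kept. There the first factor is at least 1 - exp
  (-c) and the weight at least (2T)^(-p-1); the interval length T turns this into the power
  T^(-p).\<close>

lemma abs_moment_lower_bound:
  assumes X: "X \<in> borel_measurable M" and p: "0 < p" "p < 2" and T: "0 < T" and c: "0 \<le> c"
    and char: "\<And>\<xi>. 0 < \<xi> \<Longrightarrow> (\<integral>\<omega>. iexp (\<xi> * X \<omega>) \<partial>M) = exp (z \<xi>)"
    and z: "\<And>\<xi>. T \<le> \<xi> \<Longrightarrow> c \<le> - Re (z \<xi>)"
  shows "ennreal ((1 - exp (- c)) * 2 powr (- p - 1) / enn2real (moment_const p) * T powr (- p)) \<le> abs_moment M p X"
proof -
  define \<kappa> where "\<kappa> = enn2real (moment_const p)"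
  have \<kappa>: "moment_const p = ennreal \<kappa>" "0 < \<kappa>"
    using moment_const_pos[OF p(1)] moment_const_less_top[OF p]
    by (auto simp: \<kappa>_def enn2real_positive_iff)
  define b where "b = (1 - exp (- c)) * (2 * T) powr (- p - 1)"
  have b: "0 \<le> b" using c by (simp add: b_def)
  have "ennreal (b * T) = (\<integral>\<^sup>+u. ennreal b * indicator {T..2 * T} u \<partial>lborel)"
    using b T by (simp add: nn_integral_cmult_indicator ennreal_mult)
  also have "\<dots> \<le> abs_moment M p X * moment_const p"
    unfolding abs_moment_eq_char[OF X p(1)]
  proof (intro nn_integral_mono)
    fix u :: real
    show "ennreal b * indicator {T..2 * T} u \<le>
      ennreal ((1 - Re (\<integral>\<omega>. iexp (u * X \<omega>) \<partial>M)) * u powr (- p - 1)) * indicator {0<..} u"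
    proof (cases "u \<in> {T..2 * T}")
      case True
      then have u: "0 < u" using T by simp
      have "Re (exp (z u)) \<le> exp (Re (z u))" using complex_Re_le_cmod[of "exp (z u)"] by simp
      also have "\<dots> \<le> exp (- c)" using z[of u] True by simp
      finally have "1 - exp (- c) \<le> 1 - Re (\<integral>\<omega>. iexp (u * X \<omega>) \<partial>M)" using char[OF u] by simp
      moreover have "(2 * T) powr (- p - 1) \<le> u powr (- p - 1)"
        using True u p by (intro powr_mono2') auto
      moreover have "exp (- c) \<le> 1" using c by simp
      ultimately have "b \<le> (1 - Re (\<integral>\<omega>. iexp (u * X \<omega>) \<partial>M)) * u powr (- p - 1)"
        unfolding b_def by (intro mult_mono powr_ge_zero) linarith+
      then show ?thesis using True u by (simp add: ennreal_leI)
    qed simp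
  qed
  finally have "ennreal (b * T) * ennreal (1 / \<kappa>) \<le> abs_moment M p X * ennreal \<kappa> * ennreal (1 / \<kappa>)"
    unfolding \<kappa>(1) by (rule mult_right_mono) simp
  moreover have "ennreal \<kappa> * ennreal (1 / \<kappa>) = 1" using \<kappa>(2) by (simp flip: ennreal_mult)
  ultimately have "ennreal (b * T) * ennreal (1 / \<kappa>) \<le> abs_moment M p X"
    by (simp add: mult.assoc)
  also have "ennreal (b * T) * ennreal (1 / \<kappa>) = ennreal (b * T * (1 / \<kappa>))"
    using b T \<kappa>(2) by (intro ennreal_mult[symmetric]) auto
  also have "b * T = (1 - exp (- c)) * 2 powr (- p - 1) * T powr (- p)"
  proof -
    have "T powr (- p - 1) * T = T powr (- p)"
      using T powr_mult_base[of T "- p - 1"] by (simp add: mult.commute)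
    then show ?thesis using T by (simp add: b_def powr_mult mult.assoc)
  qed
  finally show ?thesis unfolding \<kappa>_def by (simp add: mult_ac)
qed

end

section \<open>Growth of the exponent and rescaling\<close>

text \<open>The function \<psi> is merely Lebesgue measurable, so the change of variables is carried
  out on the completed measure.\<close>

lemma
  fixes t :: "'a::euclidean_space"
  assumes "c \<noteq> 0"
  shows lebesgue_affine: "lebesgue = density (distr lebesgue lebesgue (\<lambda>x. t + c *\<^sub>R x)) (\<lambda>_. ennreal (\<bar>c\<bar> ^ DIM('a)))"
    and measurable_lebesgue_affine: "(\<lambda>x. t + c *\<^sub>R x) \<in> lebesgue \<rightarrow>\<^sub>M lebesgue"
  using assms lebesgue_affine_euclidean[of "\<lambda>_. c" t] lebesgue_affine_measurable[of "\<lambda>_. c" t]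
  unfolding scaleR_scaleR[symmetric] scaleR_sum_right[symmetric] euclidean_representation prod_constant
  by simp_all

lemma nn_integral_lebesgue_affine:
  fixes t :: "'a::euclidean_space"
  assumes f: "f \<in> borel_measurable lebesgue" and c: "c \<noteq> 0"
  shows "(\<integral>\<^sup>+x. f x \<partial>lebesgue) = ennreal (\<bar>c\<bar> ^ DIM('a)) * (\<integral>\<^sup>+x. f (t + c *\<^sub>R x) \<partial>lebesgue)"
proof -
  note [measurable] = f measurable_lebesgue_affine[OF c]
  have "(\<integral>\<^sup>+x. f x \<partial>lebesgue) =
      (\<integral>\<^sup>+x. f x \<partial>density (distr lebesgue lebesgue (\<lambda>x. t + c *\<^sub>R x)) (\<lambda>_. ennreal (\<bar>c\<bar> ^ DIM('a))))"
    using lebesgue_affine[OF c, of t] by simp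
  also have "\<dots> = ennreal (\<bar>c\<bar> ^ DIM('a)) * (\<integral>\<^sup>+x. f (t + c *\<^sub>R x) \<partial>lebesgue)"
    by (simp add: nn_integral_density nn_integral_distr nn_integral_cmult)
  finally show ?thesis .
qed

lemma nn_integral_dyadic_rescale:
  fixes f :: "real^'d::finite \<Rightarrow> ennreal"
  assumes "f \<in> borel_measurable lebesgue"
  shows "(\<integral>\<^sup>+x. f (2 ^ j *\<^sub>R x - t) \<partial>lebesgue) = ennreal (2 powr (- (real j * real CARD('d)))) * (\<integral>\<^sup>+x. f x \<partial>lebesgue)"
proof -
  have e: "ennreal (\<bar>2 ^ j\<bar> ^ DIM(real^'d)) = ennreal (2 powr (real j * real CARD('d)))"
    by (simp add: powr_realpow flip: power_mult of_nat_mult)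
  have "ennreal (2 powr (- (real j * real CARD('d)))) * (\<integral>\<^sup>+x. f x \<partial>lebesgue) =
     ennreal (2 powr (- (real j * real CARD('d)))) * ennreal (2 powr (real j * real CARD('d))) * (\<integral>\<^sup>+x. f (- t + 2 ^ j *\<^sub>R x) \<partial>lebesgue)"
    using nn_integral_lebesgue_affine[OF assms, of "2 ^ j" "- t"] e by (simp add: mult.assoc)
  also have "ennreal (2 powr (- (real j * real CARD('d)))) * ennreal (2 powr (real j * real CARD('d))) = 1"
    by (simp flip: ennreal_mult powr_add)
  finally show ?thesis by simp
qed

lemma measurable_rescaled:
  fixes \<psi> :: "real^'d::finite \<Rightarrow> real"
  assumes "\<psi> \<in> borel_measurable lebesgue"
  shows "rescaled \<psi> j k \<in> borel_measurable lebesgue"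
proof -
  have "(\<lambda>x. \<psi> (- (\<chi> i. real_of_int (k $ i)) + 2 ^ j *\<^sub>R x)) \<in> borel_measurable lebesgue"
    by (rule measurable_compose[OF measurable_lebesgue_affine assms]) simp
  then show ?thesis unfolding rescaled_def by simp
qed

lemma rescaled_bounded_support:
  fixes \<psi> :: "real^'d::finite \<Rightarrow> real"
  assumes b: "\<And>x. \<bar>\<psi> x\<bar> \<le> b" and r: "0 < r" "\<And>x. r < norm x \<Longrightarrow> \<psi> x = 0"
  shows "\<exists>b' r'. (\<forall>x. \<bar>rescaled \<psi> j k x\<bar> \<le> b') \<and> 0 < r' \<and> (\<forall>x. r' < norm x \<longrightarrow> rescaled \<psi> j k x = 0)"
proof (intro exI conjI allI impI)
  let ?k = "\<chi> i. real_of_int (k $ i)"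
  show "0 < r + norm ?k" using r(1) by (simp add: add_pos_nonneg)
  fix x :: "real^'d"
  show "\<bar>rescaled \<psi> j k x\<bar> \<le> 2 powr (real j * real CARD('d) / 2) * b"
    by (simp add: rescaled_def abs_mult b)
  assume x: "r + norm ?k < norm x"
  have "norm x \<le> 2 ^ j * norm x" using mult_right_mono[of 1 "2 ^ j" "norm x"] by simp
  then have "norm x - norm ?k \<le> norm (2 ^ j *\<^sub>R x - ?k)"
    using norm_triangle_ineq2[of "2 ^ j *\<^sub>R x" ?k] by simp
  then show "rescaled \<psi> j k x = 0" using x r(2) by (simp add: rescaled_def)
qed

text \<open>From |x|^q at most 1 + |x|^q'. It transfers finiteness from the exponent provided by
  \<open>p_max\<close> to a smaller one close to the upper index.\<close>

lemma abs_moment_mono_finite: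
  assumes "prob_space M" "X \<in> borel_measurable M" "0 < q" "q \<le> q'" "abs_moment M q' X < \<infinity>"
  shows "abs_moment M q X < \<infinity>"
proof -
  interpret prob_space M by fact
  note [measurable] = assms(2)
  have "abs_moment M q X \<le> (\<integral>\<^sup>+\<omega>. 1 + ennreal (\<bar>X \<omega>\<bar> powr q') \<partial>M)"
    unfolding abs_moment_def
  proof (intro nn_integral_mono)
    fix \<omega>
    have "\<bar>X \<omega>\<bar> powr q \<le> 1 + \<bar>X \<omega>\<bar> powr q'"
    proof (cases "\<bar>X \<omega>\<bar> \<le> 1")
      case True
      then have "\<bar>X \<omega>\<bar> powr q \<le> 1" using assms(3) by (simp add: powr_le1)
      then show ?thesis using powr_ge_zero[of "\<bar>X \<omega>\<bar>" q'] by linarith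
    next
      case False
      then have "\<bar>X \<omega>\<bar> powr q \<le> \<bar>X \<omega>\<bar> powr q'" using assms(4) by (intro powr_mono) auto
      then show ?thesis by simp
    qed
    then show "ennreal (\<bar>X \<omega>\<bar> powr q) \<le> 1 + ennreal (\<bar>X \<omega>\<bar> powr q')"
      using ennreal_leI by (metis ennreal_1 ennreal_plus powr_ge_zero zero_le_one)
  qed
  also have "\<dots> = 1 + abs_moment M q' X"
    by (simp add: nn_integral_add abs_moment_def emeasure_space_1)
  also have "\<dots> < \<infinity>" using assms(5) by simp
  finally show ?thesis .
qed

section \<open>Power bounds for the exponent from its indices and moments\<close>

context levy_noise
begin

lemma integrable_\<Psi>:
  fixes \<phi> :: "real^'d \<Rightarrow> real"
  assumes meas: "\<phi> \<in> borel_measurable lebesgue" and b: "\<And>x. \<bar>\<phi> x\<bar> \<le> b"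
    and r: "\<And>x. r < norm x \<Longrightarrow> \<phi> x = 0"
  shows "integrable lebesgue (\<lambda>x. \<Psi> (\<phi> x))"
proof -
  obtain C where C: "0 \<le> C" "\<And>\<xi>. cmod (\<Psi> \<xi>) \<le> C * (1 + \<xi>\<^sup>2)" using \<Psi>_growth by blast
  show ?thesis
  proof (rule Bochner_Integration.integrable_bound)
    show "integrable lebesgue (\<lambda>x::real^'d. C * (1 + b\<^sup>2) * indicator (cball 0 r) x :: real)"
      using emeasure_lborel_cball_finite[of "0::real^'d" r]
      by (intro integrable_mult_right integrable_real_indicator) auto
    show "(\<lambda>x. \<Psi> (\<phi> x)) \<in> borel_measurable lebesgue" using meas by measurable
    show "AE x in lebesgue. norm (\<Psi> (\<phi> x)) \<le> norm (C * (1 + b\<^sup>2) * indicator (cball 0 r) x :: real)"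
    proof (rule AE_I2)
      fix x
      show "norm (\<Psi> (\<phi> x)) \<le> norm (C * (1 + b\<^sup>2) * indicator (cball 0 r) x :: real)"
      proof (cases "norm x \<le> r")
        case True
        have "\<bar>\<phi> x\<bar> \<le> \<bar>b\<bar>" using b[of x] by linarith
        then have "(\<phi> x)\<^sup>2 \<le> b\<^sup>2" by (simp add: abs_le_square_iff)
        then have "C * (1 + (\<phi> x)\<^sup>2) \<le> C * (1 + b\<^sup>2)" using C(1) by (intro mult_left_mono) auto
        then show ?thesis using True C(1) order_trans[OF C(2)[of "\<phi> x"]] by simp
      qed (simp add: r \<Psi>_0)
    qed
  qed
qed

definition unit_cube_pairing :: "'w \<Rightarrow> real" where
  "unit_cube_pairing = pairing M w (indicator {x. \<forall>i. 0 \<le> x $ i \<and> x $ i \<le> 1})"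

text \<open>The cube has volume 1 and \<Psi> vanishes at 0, so the exponent integral collapses to
  \<Psi> itself. This is how a moment assumption on the noise becomes information about
  \<Psi>.\<close>

lemma
  shows unit_cube_pairing_measurable: "unit_cube_pairing \<in> borel_measurable M"
    and char_unit_cube_pairing: "(\<integral>\<omega>. iexp (\<xi> * unit_cube_pairing \<omega>) \<partial>M) = exp (\<Psi> \<xi>)"
proof -
  let ?Q = "{x :: real^'d. \<forall>i. 0 \<le> x $ i \<and> x $ i \<le> 1}"
  have Q: "?Q = cbox 0 1" by (auto simp: mem_box_cart)
  obtain r where r: "0 < r" "cbox 0 1 \<subseteq> cball (0::real^'d) r"
    using bounded_subset_ballD[OF bounded_cbox, of 0 1 "0::real^'d"] ball_subset_cball by blast
  have *: "(indicator ?Q :: _ \<Rightarrow> real) \<in> borel_measurable lebesgue" "\<And>x. \<bar>indicator ?Q x :: real\<bar> \<le> 1"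
     "\<And>x. r < norm x \<Longrightarrow> indicator ?Q x = (0::real)"
    using r unfolding Q by (auto simp: indicator_def intro!: borel_measurable_indicator)
  show "unit_cube_pairing \<in> borel_measurable M"
    unfolding unit_cube_pairing_def by (rule pairing_measurable[OF *(1,2) r(1) *(3)])
  have "(\<integral>x. \<Psi> (\<xi> * indicator ?Q x) \<partial>lebesgue) = (\<integral>x. indicator ?Q x *\<^sub>R \<Psi> \<xi> \<partial>lebesgue)"
    by (intro Bochner_Integration.integral_cong) (auto simp: indicator_def \<Psi>_0)
  also have "\<dots> = measure lebesgue ?Q *\<^sub>R \<Psi> \<xi>"
    unfolding Q using emeasure_lborel_cbox_finite[of "0::real^'d" 1]
    by (intro has_bochner_integral_integral_eq has_bochner_integral_scaleR_left has_bochner_integral_real_indicator) auto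
  also have "measure lebesgue ?Q = 1"
  proof -
    have "0 \<in> cbox (0::real^'d) 1" by (simp add: mem_box_cart)
    then have "cbox (0::real^'d) 1 \<noteq> {}" by blast
    then show ?thesis unfolding Q by (simp add: content_cbox_if_cart)
  qed
  finally show "(\<integral>\<omega>. iexp (\<xi> * unit_cube_pairing \<omega>) \<partial>M) = exp (\<Psi> \<xi>)"
    unfolding unit_cube_pairing_def by (subst char_pairing[OF *(1,2) r(1) *(3)]) auto
qed

text \<open>Near \<open>0\<close> the exponent is controlled by the moment of the unit cube pairing \<open>X\<close>:
  \<open>1 - exp (Re (\<Psi> \<xi>)) \<le> 1 - Re (exp (\<Psi> \<xi>)) = E (1 - cos (\<xi> X)) \<le> 2 \<bar>\<xi>\<bar>\<^sup>q E \<bar>X\<bar>\<^sup>q\<close>.\<close>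

lemma \<Psi>_le_powr_near_0:
  assumes sector: "sector_condition \<Psi>" and q: "0 < q" "q \<le> 2"
    and fin: "abs_moment M q unit_cube_pairing < \<infinity>"
  shows "\<exists>C\<ge>0. \<forall>\<xi>. \<bar>\<xi>\<bar> \<le> R \<longrightarrow> cmod (\<Psi> \<xi>) \<le> C * \<bar>\<xi>\<bar> powr q"
proof -
  note X [measurable] = unit_cube_pairing_measurable
  let ?X = unit_cube_pairing
  obtain S where S: "0 < S" "\<And>\<xi>. \<bar>Im (\<Psi> \<xi>)\<bar> \<le> S * \<bar>Re (\<Psi> \<xi>)\<bar>"
    using sector unfolding sector_condition_def by blast
  obtain C where C: "0 \<le> C" "\<And>\<xi>. cmod (\<Psi> \<xi>) \<le> C * (1 + \<xi>\<^sup>2)" using \<Psi>_growth by blast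
  define L where "L = C * (1 + R\<^sup>2)"
  define E where "E = expectation (\<lambda>\<omega>. \<bar>?X \<omega>\<bar> powr q)"
  have int: "integrable M (\<lambda>\<omega>. \<bar>?X \<omega>\<bar> powr q)"
    using fin by (intro integrableI_nonneg) (auto simp: abs_moment_def)
  have E: "0 \<le> E" unfolding E_def by simp
  have "cmod (\<Psi> \<xi>) \<le> ((1 + S) * exp L * 2 * E) * \<bar>\<xi>\<bar> powr q" if \<xi>: "\<bar>\<xi>\<bar> \<le> R" for \<xi>
  proof -
    define y where "y = - Re (\<Psi> \<xi>)"
    have "\<xi>\<^sup>2 \<le> R\<^sup>2" using power_mono[OF \<xi>, of 2] by simp
    then have "cmod (\<Psi> \<xi>) \<le> L"
      unfolding L_def using C(1) by (intro order_trans[OF C(2)] mult_left_mono) auto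
    then have y: "0 \<le> y" "y \<le> L"
      using \<Psi>_Re[of \<xi>] abs_Re_le_cmod[of "\<Psi> \<xi>"] by (auto simp: y_def)
    \<comment> \<open>For y in [0, L] this recovers the exponent from the characteristic function: y
      is at most exp L (1 - exp (-y)). The bound L comes from the growth of \<Psi> on
      [-R, R].\<close>
    have "y \<le> exp y - 1" using exp_ge_add_one_self[of y] by linarith
    also have "\<dots> = exp y * (1 - exp (- y))" by (simp add: algebra_simps flip: exp_add)
    also have "\<dots> \<le> exp L * (1 - exp (- y))" using y by (intro mult_right_mono) auto
    also have "\<dots> \<le> exp L * (1 - Re (exp (\<Psi> \<xi>)))"
      using complex_Re_le_cmod[of "exp (\<Psi> \<xi>)"] by (intro mult_left_mono) (auto simp: y_def)
    also have "1 - Re (exp (\<Psi> \<xi>)) = expectation (\<lambda>\<omega>. 1 - cos (\<xi> * ?X \<omega>))"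
      unfolding char_unit_cube_pairing[symmetric] by (subst Re_char) auto
    also have "\<dots> \<le> expectation (\<lambda>\<omega>. 2 * \<bar>\<xi>\<bar> powr q * \<bar>?X \<omega>\<bar> powr q)"
    proof (rule integral_mono)
      show "integrable M (\<lambda>\<omega>. 1 - cos (\<xi> * ?X \<omega>))"
        by (intro integrable_one_minus_cos) measurable
      show "integrable M (\<lambda>\<omega>. 2 * \<bar>\<xi>\<bar> powr q * \<bar>?X \<omega>\<bar> powr q)" using int by simp
      show "1 - cos (\<xi> * ?X \<omega>) \<le> 2 * \<bar>\<xi>\<bar> powr q * \<bar>?X \<omega>\<bar> powr q" for \<omega>
        using one_minus_cos_le_powr[OF q, of "\<xi> * ?X \<omega>"] by (simp add: abs_mult powr_mult mult.assoc)
    qed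
    also have "\<dots> = 2 * \<bar>\<xi>\<bar> powr q * E" by (simp add: E_def)
    finally have 1: "y \<le> exp L * (2 * \<bar>\<xi>\<bar> powr q * E)" by simp
    \<comment> \<open>So far only the real part is controlled; the sector condition transfers the
      bound to the modulus.\<close>
    have "cmod (\<Psi> \<xi>) \<le> \<bar>Re (\<Psi> \<xi>)\<bar> + \<bar>Im (\<Psi> \<xi>)\<bar>" by (rule cmod_le)
    also have "\<dots> \<le> (1 + S) * y" using S(2)[of \<xi>] \<Psi>_Re[of \<xi>] by (simp add: y_def algebra_simps)
    also have "\<dots> \<le> (1 + S) * (exp L * (2 * \<bar>\<xi>\<bar> powr q * E))" using 1 S(1) by (intro mult_left_mono) auto
    also have "\<dots> = ((1 + S) * exp L * 2 * E) * \<bar>\<xi>\<bar> powr q" by (simp only: mult_ac)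
    finally show ?thesis .
  qed
  then show ?thesis using S(1) E by (intro exI[of _ "(1 + S) * exp L * 2 * E"]) auto
qed

lemma \<Psi>_le_square: "\<exists>C\<ge>0. \<forall>\<xi>. 1 \<le> \<bar>\<xi>\<bar> \<longrightarrow> cmod (\<Psi> \<xi>) \<le> C * \<bar>\<xi>\<bar> powr 2"
proof -
  obtain C where C: "0 \<le> C" "\<And>\<xi>. cmod (\<Psi> \<xi>) \<le> C * (1 + \<xi>\<^sup>2)" using \<Psi>_growth by blast
  have "cmod (\<Psi> \<xi>) \<le> 2 * C * \<bar>\<xi>\<bar> powr 2" if "1 \<le> \<bar>\<xi>\<bar>" for \<xi>
  proof -
    have "1 \<le> \<xi>\<^sup>2" using that abs_le_square_iff[of 1 \<xi>] by simp
    then have "cmod (\<Psi> \<xi>) \<le> 2 * C * \<xi>\<^sup>2"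
      using mult_left_mono[of "1 + \<xi>\<^sup>2" "2 * \<xi>\<^sup>2" C] C(1) C(2)[of \<xi>] by simp
    also have "\<xi>\<^sup>2 = \<bar>\<xi>\<bar> powr 2" using that by (simp add: powr_numeral)
    finally show ?thesis .
  qed
  then show ?thesis using C(1) by (intro exI[of _ "2 * C"]) auto
qed

text \<open>Quadratic growth loses against any higher power. This supplies members of the set whose
  infimum is the upper index, so that \<open>cInf_lower\<close> and \<open>cInf_lessD\<close> give
  information.\<close>

lemma beta_upper_set:
  assumes "2 < q"
  shows "((\<lambda>\<xi>. cmod (\<Psi> \<xi>) / \<bar>\<xi>\<bar> powr q) \<longlongrightarrow> 0) at_infinity"
proof -
  obtain C where C: "0 \<le> C" "\<And>\<xi>. 1 \<le> \<bar>\<xi>\<bar> \<Longrightarrow> cmod (\<Psi> \<xi>) \<le> C * \<bar>\<xi>\<bar> powr 2"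
    using \<Psi>_le_square by blast
  have "((\<lambda>x::real. x powr (2 - q)) \<longlongrightarrow> 0) at_top"
    using tendsto_neg_powr[of "2 - q" "\<lambda>x. x" at_top] assms filterlim_ident by auto
  from filterlim_compose[OF this filterlim_norm_at_top[where ?'a=real]]
  have "((\<lambda>\<xi>::real. C * \<bar>\<xi>\<bar> powr (2 - q)) \<longlongrightarrow> 0) at_infinity"
    by (intro tendsto_mult_right_zero) simp
  moreover have "cmod (\<Psi> \<xi>) / \<bar>\<xi>\<bar> powr q \<le> C * \<bar>\<xi>\<bar> powr (2 - q)" if "1 \<le> \<bar>\<xi>\<bar>" for \<xi>
  proof -
    have "cmod (\<Psi> \<xi>) \<le> C * \<bar>\<xi>\<bar> powr 2" using C(2)[OF that] .
    also have "\<dots> = C * \<bar>\<xi>\<bar> powr (2 - q) * \<bar>\<xi>\<bar> powr q"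
      by (simp add: mult.assoc flip: powr_add)
    finally show ?thesis using that by (simp add: divide_le_eq)
  qed
  then have "eventually (\<lambda>\<xi>. norm (cmod (\<Psi> \<xi>) / \<bar>\<xi>\<bar> powr q) \<le> C * \<bar>\<xi>\<bar> powr (2 - q)) at_infinity"
    by (auto simp: eventually_at_infinity intro!: exI[of _ 1])
  ultimately show ?thesis by (rule Lim_null_comparison[rotated])
qed

text \<open>With p below the upper index this yields p < 2, the range in which
  \<open>moment_const p\<close> is finite.\<close>

lemma beta_upper_le_2: "beta_upper \<Psi> \<le> 2"
proof (rule field_le_epsilon)
  fix e :: real assume "0 < e"
  then show "beta_upper \<Psi> \<le> 2 + e"
    unfolding beta_upper_def using beta_upper_set[of "2 + e"]
    by (intro cInf_lower bdd_belowI[of _ 0]) auto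
qed

text \<open>An exponent above the infimum lies above some member of the set, which gives the bound.
  The alternative q = 2 is for an upper index equal to 2, where no exponent strictly above it stays
  within the reach of the cosine inequality.\<close>

lemma \<Psi>_le_powr_at_infinity:
  assumes "beta_upper \<Psi> < q \<or> q = 2"
  shows "\<exists>C\<ge>0. \<exists>R. \<forall>\<xi>. R \<le> \<bar>\<xi>\<bar> \<longrightarrow> cmod (\<Psi> \<xi>) \<le> C * \<bar>\<xi>\<bar> powr q"
proof (cases "q = 2")
  case True
  then show ?thesis using \<Psi>_le_square by blast
next
  case False
  then have "beta_upper \<Psi> < q" using assms by simp
  have "3 \<in> {q. 0 < q \<and> ((\<lambda>\<xi>. cmod (\<Psi> \<xi>) / \<bar>\<xi>\<bar> powr q) \<longlongrightarrow> 0) at_infinity}"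
    using beta_upper_set[of 3] by simp
  then have "{q. 0 < q \<and> ((\<lambda>\<xi>. cmod (\<Psi> \<xi>) / \<bar>\<xi>\<bar> powr q) \<longlongrightarrow> 0) at_infinity} \<noteq> {}"
    by (rule ex_in_conv[THEN iffD1, OF exI])
  from cInf_lessD[OF this \<open>beta_upper \<Psi> < q\<close>[unfolded beta_upper_def]]
  obtain q' where q': "0 < q'" "q' < q" "((\<lambda>\<xi>. cmod (\<Psi> \<xi>) / \<bar>\<xi>\<bar> powr q') \<longlongrightarrow> 0) at_infinity"
    by blast
  have "eventually (\<lambda>\<xi>. cmod (\<Psi> \<xi>) / \<bar>\<xi>\<bar> powr q' < 1) at_infinity"
    using order_tendstoD(2)[OF q'(3)] by simp
  then obtain R where R: "\<And>\<xi>. R \<le> \<bar>\<xi>\<bar> \<Longrightarrow> cmod (\<Psi> \<xi>) / \<bar>\<xi>\<bar> powr q' < 1"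
    by (auto simp: eventually_at_infinity)
  have "cmod (\<Psi> \<xi>) \<le> 1 * \<bar>\<xi>\<bar> powr q" if "max R 1 \<le> \<bar>\<xi>\<bar>" for \<xi>
  proof -
    have "cmod (\<Psi> \<xi>) \<le> \<bar>\<xi>\<bar> powr q'" using R[of \<xi>] that by (simp add: divide_less_eq split: if_splits)
    also have "\<dots> \<le> \<bar>\<xi>\<bar> powr q" using that q' by (intro powr_mono) auto
    finally show ?thesis by simp
  qed
  then show ?thesis by (intro exI[of _ 1] exI[of _ "max R 1"] conjI) auto
qed

lemma \<Psi>_le_powr:
  assumes "sector_condition \<Psi>" and q: "0 < q" "q \<le> 2" "beta_upper \<Psi> < q \<or> q = 2"
    and "abs_moment M q unit_cube_pairing < \<infinity>"
  shows "\<exists>C>0. \<forall>\<xi>. cmod (\<Psi> \<xi>) \<le> C * \<bar>\<xi>\<bar> powr q"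
proof -
  obtain C R where C: "0 \<le> C" "\<And>\<xi>. R \<le> \<bar>\<xi>\<bar> \<Longrightarrow> cmod (\<Psi> \<xi>) \<le> C * \<bar>\<xi>\<bar> powr q"
    using \<Psi>_le_powr_at_infinity[OF q(3)] by blast
  obtain D where D: "0 \<le> D" "\<And>\<xi>. \<bar>\<xi>\<bar> \<le> R \<Longrightarrow> cmod (\<Psi> \<xi>) \<le> D * \<bar>\<xi>\<bar> powr q"
    using \<Psi>_le_powr_near_0[OF assms(1) q(1,2) assms(5)] by blast
  have "cmod (\<Psi> \<xi>) \<le> (C + D + 1) * \<bar>\<xi>\<bar> powr q" for \<xi>
  proof -
    have "C * \<bar>\<xi>\<bar> powr q \<le> (C + D + 1) * \<bar>\<xi>\<bar> powr q" "D * \<bar>\<xi>\<bar> powr q \<le> (C + D + 1) * \<bar>\<xi>\<bar> powr q"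
      using C(1) D(1) by (auto intro!: mult_right_mono)
    then show ?thesis using C(2)[of \<xi>] D(2)[of \<xi>] by (cases "R \<le> \<bar>\<xi>\<bar>") auto
  qed
  then show ?thesis using C(1) D(1) by (intro exI[of _ "C + D + 1"]) auto
qed

text \<open>Below the infimum the lower limit of the quotient cannot be 0, and being nonnegative it
  is positive; this bounds the modulus from below. By the sector condition the modulus is at most 1
  + S times the negated real part.\<close>

lemma Re_\<Psi>_ge_powr:
  assumes sector: "sector_condition \<Psi>" and q: "0 < q" "q < beta_lower \<Psi>"
  shows "\<exists>c>0. \<exists>R>0. \<forall>\<xi>. R \<le> \<bar>\<xi>\<bar> \<longrightarrow> c * \<bar>\<xi>\<bar> powr q \<le> - Re (\<Psi> \<xi>)"
proof -
  let ?f = "\<lambda>\<xi>. ereal (cmod (\<Psi> \<xi>) / \<bar>\<xi>\<bar> powr q)"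
  have "Liminf at_infinity ?f \<noteq> 0"
  proof
    assume "Liminf at_infinity ?f = 0"
    then have "beta_lower \<Psi> \<le> q"
      unfolding beta_lower_def using q(1)
      by (intro cInf_lower[OF CollectI bdd_belowI[of _ 0]] conjI) (assumption | force)+
    then show False using q(2) by simp
  qed
  moreover have "0 \<le> Liminf at_infinity ?f"
    by (intro Liminf_bounded always_eventually) auto
  ultimately have "0 < Liminf at_infinity ?f" by simp
  from ereal_dense2[OF this] obtain c where c: "0 < c" "ereal c < Liminf at_infinity ?f"
    by auto
  have "eventually (\<lambda>\<xi>. ereal c < ?f \<xi>) at_infinity" by (rule less_LiminfD[OF c(2)])
  then obtain R where R: "\<And>\<xi>. R \<le> \<bar>\<xi>\<bar> \<Longrightarrow> c < cmod (\<Psi> \<xi>) / \<bar>\<xi>\<bar> powr q"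
    by (auto simp: eventually_at_infinity)
  obtain S where S: "0 < S" "\<And>\<xi>. \<bar>Im (\<Psi> \<xi>)\<bar> \<le> S * \<bar>Re (\<Psi> \<xi>)\<bar>"
    using sector unfolding sector_condition_def by blast
  have "c / (1 + S) * \<bar>\<xi>\<bar> powr q \<le> - Re (\<Psi> \<xi>)" if "max R 1 \<le> \<bar>\<xi>\<bar>" for \<xi>
  proof -
    have "c * \<bar>\<xi>\<bar> powr q \<le> cmod (\<Psi> \<xi>)"
      using R[of \<xi>] that by (auto simp: less_divide_eq split: if_splits)
    also have "\<dots> \<le> \<bar>Re (\<Psi> \<xi>)\<bar> + \<bar>Im (\<Psi> \<xi>)\<bar>" by (rule cmod_le)
    also have "\<dots> \<le> (1 + S) * (- Re (\<Psi> \<xi>))" using S(2)[of \<xi>] \<Psi>_Re[of \<xi>] by (simp add: algebra_simps)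
    finally show ?thesis using S(1) by (simp add: field_simps)
  qed
  then show ?thesis using c(1) S(1) by (intro exI[of _ "c / (1 + S)"] conjI exI[of _ "max R 1"]) auto
qed

end

section \<open>Moments of pairings with rescaled functions\<close>

lemma not_AE_zero_imp_level_set:
  fixes f :: "'a \<Rightarrow> real"
  assumes [measurable]: "f \<in> borel_measurable N" and "\<not> (AE x in N. f x = 0)"
  shows "\<exists>a>0. emeasure N {x \<in> space N. a \<le> \<bar>f x\<bar>} \<noteq> 0"
proof (rule ccontr)
  assume "\<not> ?thesis"
  then have "emeasure N {x \<in> space N. 1 / real (Suc n) \<le> \<bar>f x\<bar>} = 0" for n by simp
  then have "AE x in N. \<not> 1 / real (Suc n) \<le> \<bar>f x\<bar>" for n
    by (subst AE_iff_measurable[OF _ refl]) auto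
  then have "AE x in N. \<forall>n. \<not> 1 / real (Suc n) \<le> \<bar>f x\<bar>"
    by (simp add: AE_all_countable)
  then have "AE x in N. f x = 0"
  proof eventually_elim
    fix x assume x: "\<forall>n. \<not> 1 / real (Suc n) \<le> \<bar>f x\<bar>"
    show "f x = 0"
    proof (rule ccontr)
      assume "f x \<noteq> 0"
      then obtain n where "1 / real (Suc n) < \<bar>f x\<bar>"
        using nat_approx_posE[of "\<bar>f x\<bar>"] by auto
      then show False using x less_imp_le by blast
    qed
  qed
  then show False using assms(2) by simp
qed

context levy_noise
begin

context
  fixes \<psi> :: "real^'d \<Rightarrow> real" and b r :: real
  assumes \<psi>: "\<psi> \<in> borel_measurable lebesgue" "\<And>x. \<bar>\<psi> x\<bar> \<le> b" "0 < r" "\<And>x. r < norm x \<Longrightarrow> \<psi> x = 0"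
begin

lemma rescaled_pairing_measurable: "pairing M w (rescaled \<psi> j k) \<in> borel_measurable M"
  and char_rescaled_pairing: "(\<integral>\<omega>. iexp (\<xi> * pairing M w (rescaled \<psi> j k) \<omega>) \<partial>M) =
    exp (\<integral>x. \<Psi> (\<xi> * rescaled \<psi> j k x) \<partial>lebesgue)"
  and integrable_\<Psi>_rescaled: "integrable lebesgue (\<lambda>x. \<Psi> (\<xi> * rescaled \<psi> j k x))"
proof -
  obtain b' r' where *: "\<And>x. \<bar>rescaled \<psi> j k x\<bar> \<le> b'" "0 < r'" "\<And>x. r' < norm x \<Longrightarrow> rescaled \<psi> j k x = 0"
    using rescaled_bounded_support[of \<psi> b r, OF \<psi>(2-4)] by blast
  show "pairing M w (rescaled \<psi> j k) \<in> borel_measurable M"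
    by (rule pairing_measurable[OF measurable_rescaled[OF \<psi>(1)] *])
  show "(\<integral>\<omega>. iexp (\<xi> * pairing M w (rescaled \<psi> j k) \<omega>) \<partial>M) = exp (\<integral>x. \<Psi> (\<xi> * rescaled \<psi> j k x) \<partial>lebesgue)"
    by (rule char_pairing[OF measurable_rescaled[OF \<psi>(1)] *])
  show "integrable lebesgue (\<lambda>x. \<Psi> (\<xi> * rescaled \<psi> j k x))"
  proof (rule integrable_\<Psi>)
    show "(\<lambda>x. \<xi> * rescaled \<psi> j k x) \<in> borel_measurable lebesgue"
      using measurable_rescaled[OF \<psi>(1)] by measurable
    show "\<bar>\<xi> * rescaled \<psi> j k x\<bar> \<le> \<bar>\<xi>\<bar> * b'" for x
      by (simp add: abs_mult mult_left_mono *(1))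
    show "\<xi> * rescaled \<psi> j k x = 0" if "r' < norm x" for x using *(3)[OF that] by simp
  qed
qed

text \<open>The amplitude 2^(jd/2) enters with power q and the dilation shrinks volume by 2^(-jd),
  which gives the exponent jd (q/2 - 1). Translation invariance removes k.\<close>

lemma norm_integral_\<Psi>_rescaled_le:
  assumes q: "0 < q" and C: "0 < C" "\<And>\<xi>. cmod (\<Psi> \<xi>) \<le> C * \<bar>\<xi>\<bar> powr q"
  shows "\<exists>K>0. \<forall>j k. \<forall>\<xi>>0. cmod (\<integral>x. \<Psi> (\<xi> * rescaled \<psi> j k x) \<partial>lebesgue) \<le>
    K * 2 powr (real j * real CARD('d) * (q / 2 - 1)) * \<xi> powr q"
proof -
  let ?I = "\<integral>\<^sup>+x. ennreal (\<bar>\<psi> x\<bar> powr q) \<partial>lebesgue"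
  have "?I \<le> (\<integral>\<^sup>+x. ennreal (b powr q) * indicator (cball (0::real^'d) r) x \<partial>lebesgue)"
  proof (intro nn_integral_mono)
    fix x
    show "ennreal (\<bar>\<psi> x\<bar> powr q) \<le> ennreal (b powr q) * indicator (cball 0 r) x"
    proof (cases "norm x \<le> r")
      case True
      then show ?thesis using \<psi>(2)[of x] q by (auto intro!: ennreal_leI powr_mono2)
    qed (simp add: \<psi>(4))
  qed
  also have "\<dots> < \<top>"
    using emeasure_lborel_cball_finite[of "0::real^'d" r]
    by (simp add: nn_integral_cmult_indicator ennreal_mult_less_top)
  finally obtain I where I: "0 \<le> I" "?I = ennreal I" by (metis ennreal_cases less_irrefl)
  let ?D = "real CARD('d)"
  have "cmod (\<integral>x. \<Psi> (\<xi> * rescaled \<psi> j k x) \<partial>lebesgue) \<le>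
    C * (I + 1) * 2 powr (real j * ?D * (q / 2 - 1)) * \<xi> powr q" if \<xi>: "0 < \<xi>" for j k \<xi>
  proof -
    let ?k = "\<chi> i. real_of_int (k $ i)"
    define c where "c = C * (\<xi> powr q * 2 powr (real j * ?D / 2 * q))"
    have c: "0 \<le> c" using C(1) by (simp add: c_def)
    have "ennreal (cmod (\<integral>x. \<Psi> (\<xi> * rescaled \<psi> j k x) \<partial>lebesgue)) \<le>
        (\<integral>\<^sup>+x. ennreal (cmod (\<Psi> (\<xi> * rescaled \<psi> j k x))) \<partial>lebesgue)"
      by (rule norm_integral_le_nn_integral)
    also have "\<dots> \<le> (\<integral>\<^sup>+x. ennreal c * ennreal (\<bar>\<psi> (2 ^ j *\<^sub>R x - ?k)\<bar> powr q) \<partial>lebesgue)"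
    proof (intro nn_integral_mono)
      fix x
      have "cmod (\<Psi> (\<xi> * rescaled \<psi> j k x)) \<le> C * \<bar>\<xi> * rescaled \<psi> j k x\<bar> powr q" by (rule C(2))
      also have "\<dots> = c * \<bar>\<psi> (2 ^ j *\<^sub>R x - ?k)\<bar> powr q"
        using \<xi> by (simp add: rescaled_def abs_mult powr_mult powr_powr c_def mult.assoc)
      finally show "ennreal (cmod (\<Psi> (\<xi> * rescaled \<psi> j k x))) \<le> ennreal c * ennreal (\<bar>\<psi> (2 ^ j *\<^sub>R x - ?k)\<bar> powr q)"
        using c by (simp add: ennreal_leI flip: ennreal_mult)
    qed
    also have "\<dots> = ennreal c * (\<integral>\<^sup>+x. ennreal (\<bar>\<psi> (2 ^ j *\<^sub>R x - ?k)\<bar> powr q) \<partial>lebesgue)"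
    proof (rule nn_integral_cmult)
      have "(\<lambda>x. \<psi> (- ?k + 2 ^ j *\<^sub>R x)) \<in> borel_measurable lebesgue"
        by (rule measurable_compose[OF measurable_lebesgue_affine \<psi>(1)]) simp
      then have [measurable]: "(\<lambda>x. \<psi> (2 ^ j *\<^sub>R x - ?k)) \<in> borel_measurable lebesgue" by simp
      show "(\<lambda>x. ennreal (\<bar>\<psi> (2 ^ j *\<^sub>R x - ?k)\<bar> powr q)) \<in> borel_measurable lebesgue" by measurable
    qed
    also have "\<dots> = ennreal c * (ennreal (2 powr (- (real j * ?D))) * ennreal I)"
      using \<psi>(1) by (subst nn_integral_dyadic_rescale[of "\<lambda>y. ennreal (\<bar>\<psi> y\<bar> powr q)"]) (auto simp: I(2))
    also have "\<dots> = ennreal (c * (2 powr (- (real j * ?D)) * I))"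
      using c I(1) by (simp add: ennreal_mult)
    finally have "cmod (\<integral>x. \<Psi> (\<xi> * rescaled \<psi> j k x) \<partial>lebesgue) \<le> c * (2 powr (- (real j * ?D)) * I)"
      using c I(1) by (subst (asm) ennreal_le_iff) auto
    \<comment> \<open>The integral I could be 0; adding 1 keeps the constant K positive.\<close>
    also have "\<dots> \<le> c * (2 powr (- (real j * ?D)) * (I + 1))"
      using c by (intro mult_left_mono) auto
    also have "\<dots> = C * (I + 1) * (2 powr (real j * ?D / 2 * q) * 2 powr (- (real j * ?D))) * \<xi> powr q"
      by (simp add: c_def)
    also have "2 powr (real j * ?D / 2 * q) * 2 powr (- (real j * ?D)) = 2 powr (real j * ?D * (q / 2 - 1))"
      by (simp add: algebra_simps flip: powr_add)
    finally show ?thesis .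
  qed
  then show ?thesis using C(1) I(1) by (intro exI[of _ "C * (I + 1)"]) auto
qed

text \<open>On the rescaled copy of a level set {|\<psi>| at least a} of positive measure,
  frequencies above the threshold push the argument of \<Psi> to at least R 2^(jd/q). Its q-th power
  contains 2^(jd), which cancels the volume factor 2^(-jd), so the lower bound is the same at all
  scales.\<close>

lemma Re_integral_\<Psi>_rescaled_ge:
  assumes nz: "\<not> (AE x in lebesgue. \<psi> x = 0)" and q: "0 < q"
    and c: "0 < c" and R: "0 < R" "\<And>\<xi>. R \<le> \<bar>\<xi>\<bar> \<Longrightarrow> c * \<bar>\<xi>\<bar> powr q \<le> - Re (\<Psi> \<xi>)"
  shows "\<exists>L>0. \<exists>C>0. \<forall>j k \<xi>. L * 2 powr (- (real j * real CARD('d) * (1 / 2 - 1 / q))) \<le> \<xi> \<longrightarrow>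
    C \<le> - Re (\<integral>x. \<Psi> (\<xi> * rescaled \<psi> j k x) \<partial>lebesgue)"
proof -
  let ?D = "real CARD('d)"
  obtain a where a: "0 < a" "emeasure lebesgue {x. a \<le> \<bar>\<psi> x\<bar>} \<noteq> 0"
    using not_AE_zero_imp_level_set[OF \<psi>(1) nz] by auto
  define A where "A = {x. a \<le> \<bar>\<psi> x\<bar>}"
  have A [measurable]: "A \<in> sets lebesgue" 
  proof -
    have "{x \<in> space lebesgue. a \<le> \<bar>\<psi> x\<bar>} \<in> sets lebesgue" using \<psi>(1) by measurable
    then show ?thesis by (simp add: A_def)
  qed
  have "A \<subseteq> cball 0 r" 
  proof
    fix x assume "x \<in> A"
    then have "\<psi> x \<noteq> 0" using a(1) by (auto simp: A_def)
    then show "x \<in> cball 0 r" using \<psi>(4)[of x] by (cases "r < norm x") auto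
  qed
  then have "emeasure lebesgue A \<le> emeasure lebesgue (cball (0::real^'d) r)" by (intro emeasure_mono) auto
  also have "\<dots> < \<top>" using emeasure_lborel_cball_finite[of "0::real^'d" r] by simp
  finally obtain m where m: "0 \<le> m" "emeasure lebesgue A = ennreal m" by (metis ennreal_cases less_irrefl)
  have m0: "0 < m" using a(2) m by (auto simp: A_def[symmetric] less_le)
  have "c * R powr q * m \<le> - Re (\<integral>x. \<Psi> (\<xi> * rescaled \<psi> j k x) \<partial>lebesgue)"
    if \<xi>: "R / a * 2 powr (- (real j * ?D * (1 / 2 - 1 / q))) \<le> \<xi>" for j k \<xi>
  proof -
    let ?k = "\<chi> i. real_of_int (k $ i)"
    let ?s = "2 powr (real j * ?D / 2)"
    have "R * 2 powr (real j * ?D / q) = a * (R / a * 2 powr (- (real j * ?D * (1 / 2 - 1 / q)))) * ?s"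
      using a(1) by (simp add: algebra_simps flip: powr_add)
    also have "\<dots> \<le> a * \<xi> * ?s" using \<xi> a(1) by (intro mult_right_mono mult_left_mono) auto
    finally have 1: "R * 2 powr (real j * ?D / q) \<le> a * \<xi> * ?s" .
    have "0 < R / a * 2 powr (- (real j * ?D * (1 / 2 - 1 / q)))" using R(1) a(1) by simp
    then have \<xi>0: "0 < \<xi>" using \<xi> by linarith
    define h where "h = c * (R * 2 powr (real j * ?D / q)) powr q"
    have h: "h = c * R powr q * 2 powr (real j * ?D)" using R(1) q by (simp add: h_def powr_mult powr_powr)
    have "ennreal (c * R powr q * m) = ennreal (h * (2 powr (- (real j * ?D)) * m))"
      unfolding h by (simp add: powr_minus field_simps)
    also have "\<dots> = ennreal h * (ennreal (2 powr (- (real j * ?D))) * emeasure lebesgue A)"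
      using c R(1) m(1) by (simp add: h_def m(2) ennreal_mult)
    also have "\<dots> = ennreal h * (\<integral>\<^sup>+x. indicator A (2 ^ j *\<^sub>R x - ?k) \<partial>lebesgue)"
      by (subst nn_integral_dyadic_rescale) (auto simp: nn_integral_indicator A)
    also have "\<dots> = (\<integral>\<^sup>+x. ennreal h * indicator A (2 ^ j *\<^sub>R x - ?k) \<partial>lebesgue)"
    proof (rule nn_integral_cmult[symmetric])
      have "(\<lambda>x. - ?k + 2 ^ j *\<^sub>R x) \<in> lebesgue \<rightarrow>\<^sub>M lebesgue"
        by (rule measurable_lebesgue_affine) simp
      then have [measurable]: "(\<lambda>x. 2 ^ j *\<^sub>R x - ?k) \<in> lebesgue \<rightarrow>\<^sub>M lebesgue" by simp
      show "(\<lambda>x. indicator A (2 ^ j *\<^sub>R x - ?k) :: ennreal) \<in> borel_measurable lebesgue" by measurable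
    qed
    also have "\<dots> \<le> (\<integral>\<^sup>+x. ennreal (- Re (\<Psi> (\<xi> * rescaled \<psi> j k x))) \<partial>lebesgue)"
    proof (intro nn_integral_mono)
      fix x
      show "ennreal h * indicator A (2 ^ j *\<^sub>R x - ?k) \<le> ennreal (- Re (\<Psi> (\<xi> * rescaled \<psi> j k x)))"
      proof (cases "2 ^ j *\<^sub>R x - ?k \<in> A")
        case True
        have "a * \<xi> * ?s \<le> \<bar>\<xi> * rescaled \<psi> j k x\<bar>"
          using True \<xi>0 by (simp add: A_def rescaled_def abs_mult mult_ac)
        with 1 have 2: "R * 2 powr (real j * ?D / q) \<le> \<bar>\<xi> * rescaled \<psi> j k x\<bar>" by linarith
        \<comment> \<open>Here j being nonnegative matters: the argument of \<Psi> stays at least R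
          in modulus, where the lower bound for the real part is available.\<close>
        have "1 \<le> 2 powr (real j * ?D / q)" using q by (intro ge_one_powr_ge_zero) auto
        then have "R \<le> R * 2 powr (real j * ?D / q)" using R(1) by simp
        with 2 have "c * \<bar>\<xi> * rescaled \<psi> j k x\<bar> powr q \<le> - Re (\<Psi> (\<xi> * rescaled \<psi> j k x))"
          by (intro R(2)) linarith
        moreover have "h \<le> c * \<bar>\<xi> * rescaled \<psi> j k x\<bar> powr q"
          unfolding h_def using 2 c q R(1) by (intro mult_left_mono powr_mono2) auto
        ultimately show ?thesis using True by (simp add: ennreal_leI)
      qed simp
    qed
    also have "\<dots> = ennreal (\<integral>x. - Re (\<Psi> (\<xi> * rescaled \<psi> j k x)) \<partial>lebesgue)"
      using integrable_\<Psi>_rescaled \<Psi>_Re by (intro nn_integral_eq_integral AE_I2) auto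
    also have "(\<integral>x. - Re (\<Psi> (\<xi> * rescaled \<psi> j k x)) \<partial>lebesgue) = - Re (\<integral>x. \<Psi> (\<xi> * rescaled \<psi> j k x) \<partial>lebesgue)"
      using integrable_\<Psi>_rescaled by simp
    finally show ?thesis
      using Re_integral_nonpos[OF \<Psi>_Re] by (subst (asm) ennreal_le_iff) auto
  qed
  then show ?thesis using c R(1) a(1) m0
    by (intro exI[of _ "R / a"] conjI exI[of _ "c * R powr q * m"]) auto
qed

text \<open>The constant of the exponent bound at scale j is K 2^(jd(q/2 - 1));
  \<open>abs_moment_upper_bound\<close> raises it to the power p/q.\<close>

lemma rescaled_moment_upper:
  assumes p: "0 < p" "p < q" "p < 2" and C: "0 < C" "\<And>\<xi>. cmod (\<Psi> \<xi>) \<le> C * \<bar>\<xi>\<bar> powr q"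
  shows "\<exists>B>0. \<forall>j k. abs_moment M p (pairing M w (rescaled \<psi> j k)) \<le>
    ennreal (B * 2 powr (real j * real CARD('d) * p * (1 / 2 - 1 / q)))"
proof -
  have q: "0 < q" using p by simp
  obtain K where K: "0 < K" "\<And>j k \<xi>. 0 < \<xi> \<Longrightarrow> cmod (\<integral>x. \<Psi> (\<xi> * rescaled \<psi> j k x) \<partial>lebesgue) \<le>
      K * 2 powr (real j * real CARD('d) * (q / 2 - 1)) * \<xi> powr q"
    using norm_integral_\<Psi>_rescaled_le[OF q C] by blast
  define B where "B = (2 / (q - p) + 2 / p) / enn2real (moment_const p)"
  have B: "0 < B"
    using p moment_const_pos[of p] moment_const_less_top[of p]
    unfolding B_def by (intro divide_pos_pos add_pos_pos) (auto simp: enn2real_positive_iff)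
  have "abs_moment M p (pairing M w (rescaled \<psi> j k)) \<le>
    ennreal (B * K powr (p / q) * 2 powr (real j * real CARD('d) * p * (1 / 2 - 1 / q)))" for j k
  proof -
    have "abs_moment M p (pairing M w (rescaled \<psi> j k)) \<le>
      ennreal (B * (K * 2 powr (real j * real CARD('d) * (q / 2 - 1))) powr (p / q))"
      unfolding B_def
      by (rule abs_moment_upper_bound[OF rescaled_pairing_measurable p _ char_rescaled_pairing
            Re_integral_nonpos[OF \<Psi>_Re] K(2)]) (use K(1) in auto)
    also have "(K * 2 powr (real j * real CARD('d) * (q / 2 - 1))) powr (p / q) =
        K powr (p / q) * 2 powr (real j * real CARD('d) * p * (1 / 2 - 1 / q))"
      using K(1) q by (simp add: powr_mult powr_powr field_simps)
    finally show ?thesis by (simp add: mult.assoc)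
  qed
  then show ?thesis using B K(1) by (intro exI[of _ "B * K powr (p / q)"]) auto
qed

text \<open>Beyond the threshold the bound C on the exponent is free of j and k, so the scale enters
  only through the threshold, raised to the power -p.\<close>

lemma rescaled_moment_lower:
  assumes nz: "\<not> (AE x in lebesgue. \<psi> x = 0)" and p: "0 < p" "p < 2" and q: "0 < q"
    and c: "0 < c" and R: "0 < R" "\<And>\<xi>. R \<le> \<bar>\<xi>\<bar> \<Longrightarrow> c * \<bar>\<xi>\<bar> powr q \<le> - Re (\<Psi> \<xi>)"
  shows "\<exists>A>0. \<forall>j k. ennreal (A * 2 powr (real j * real CARD('d) * p * (1 / 2 - 1 / q))) \<le>
    abs_moment M p (pairing M w (rescaled \<psi> j k))"
proof -
  obtain L C where L: "0 < L" and C: "0 < C"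
    and LC: "\<And>j k \<xi>. L * 2 powr (- (real j * real CARD('d) * (1 / 2 - 1 / q))) \<le> \<xi> \<Longrightarrow>
      C \<le> - Re (\<integral>x. \<Psi> (\<xi> * rescaled \<psi> j k x) \<partial>lebesgue)"
    using Re_integral_\<Psi>_rescaled_ge[OF nz q c R] by blast
  define A where "A = (1 - exp (- C)) * 2 powr (- p - 1) / enn2real (moment_const p)"
  have A: "0 < A"
    using p C moment_const_pos[of p] moment_const_less_top[of p]
    unfolding A_def by (intro divide_pos_pos mult_pos_pos) (auto simp: enn2real_positive_iff)
  have "ennreal (A * L powr (- p) * 2 powr (real j * real CARD('d) * p * (1 / 2 - 1 / q))) \<le>
    abs_moment M p (pairing M w (rescaled \<psi> j k))" for j k
  proof -
    have "ennreal (A * (L * 2 powr (- (real j * real CARD('d) * (1 / 2 - 1 / q)))) powr (- p)) \<le>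
      abs_moment M p (pairing M w (rescaled \<psi> j k))"
      unfolding A_def
      by (rule abs_moment_lower_bound[OF rescaled_pairing_measurable p _ _ char_rescaled_pairing LC])
         (use L C in auto)
    also have "(L * 2 powr (- (real j * real CARD('d) * (1 / 2 - 1 / q)))) powr (- p) =
        L powr (- p) * 2 powr (real j * real CARD('d) * p * (1 / 2 - 1 / q))"
      using L by (simp add: powr_mult powr_powr mult_ac)
    finally show ?thesis by (simp add: mult.assoc)
  qed
  then show ?thesis using A L by (intro exI[of _ "A * L powr (- p)"]) auto
qed

end

end

section \<open>Choice of exponents near the indices, and conclusion\<close>

lemma exists_upper_exponent:
  fixes \<beta> q' \<delta> :: real
  assumes "0 < \<beta>" "\<beta> \<le> 2" "\<beta> < q'" "0 < \<delta>"
  shows "\<exists>q. \<beta> \<le> q \<and> q \<le> 2 \<and> q \<le> q' \<and> (\<beta> < q \<or> q = 2) \<and> 1 / \<beta> - 1 / q \<le> \<delta>"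
proof (cases "\<beta> = 2")
  case True
  then show ?thesis using assms by (intro exI[of _ 2]) auto
next
  case False
  \<comment> \<open>The cap 2 keeps the cosine inequality valid, the cap q' keeps the moment finite,
    and the last one limits the loss, because
    \<open>1 / \<beta> - 1 / q = (q - \<beta>) / (\<beta> * q)\<close> and q exceeds
    \<beta>.\<close>
  define q where "q = min (min 2 q') (\<beta> + \<delta> * \<beta>\<^sup>2)"
  have q: "\<beta> < q" "q \<le> 2" "q \<le> q'" "q \<le> \<beta> + \<delta> * \<beta>\<^sup>2" using False assms by (auto simp: q_def)
  have "1 / \<beta> - 1 / q = (q - \<beta>) / (\<beta> * q)" using assms q by (simp add: field_simps)
  also have "\<dots> \<le> (\<delta> * \<beta>\<^sup>2) / (\<beta> * \<beta>)" using assms q by (intro frac_le mult_left_mono) auto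
  also have "\<dots> = \<delta>" using assms by (simp add: power2_eq_square)
  finally show ?thesis using q by (intro exI[of _ q]) auto
qed

lemma exists_lower_exponent:
  fixes \<beta> \<delta> :: real
  assumes "0 < \<beta>" "0 < \<delta>"
  shows "\<exists>q. 0 < q \<and> q < \<beta> \<and> 1 / q - 1 / \<beta> \<le> \<delta>"
proof -
  \<comment> \<open>The floor \<beta>/2 keeps q positive and the denominator
    \<open>q * \<beta>\<close> at least \<open>\<beta>\<^sup>2 / 2\<close>, hence the halved
    distance to \<beta>.\<close>
  define q where "q = max (\<beta> / 2) (\<beta> - \<delta> * \<beta>\<^sup>2 / 2)"
  have q: "\<beta> / 2 \<le> q" "q < \<beta>" "\<beta> - \<delta> * \<beta>\<^sup>2 / 2 \<le> q" "0 < q" using assms by (auto simp: q_def)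
  have "1 / q - 1 / \<beta> = (\<beta> - q) / (q * \<beta>)" using assms q by (simp add: field_simps)
  also have "\<dots> \<le> (\<delta> * \<beta>\<^sup>2 / 2) / (\<beta> / 2 * \<beta>)" using assms q by (intro frac_le mult_right_mono) auto
  also have "\<dots> = \<delta>" using assms by (simp add: power2_eq_square)
  finally show ?thesis using q by (intro exI[of _ q]) auto
qed

theorem theorem5p2:
  fixes M :: "'w measure"
    and w :: "'w \<Rightarrow> (real^'d::finite \<Rightarrow> real) \<Rightarrow> real"
    and \<Psi> :: "real \<Rightarrow> complex"
    and \<psi> :: "real^'d \<Rightarrow> real"
    and p :: real
  assumes "prob_space M" and "complete_measure M"
    and "levy_white_noise M \<Psi> w"
    and "sector_condition \<Psi>"
    and "0 < beta_lower \<Psi>"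
    and "beta_lower \<Psi> \<le> beta_upper \<Psi>"
    and "ereal (beta_upper \<Psi>) < p_max M w"
    and "\<psi> \<in> borel_measurable lebesgue"
    and "bounded (range \<psi>)"
    and "compact (closure {x. \<psi> x \<noteq> 0})"
    and "\<not> (AE x in lebesgue. \<psi> x = 0)"
    and "0 < p" and "p < beta_upper \<Psi>"
  shows "\<exists>\<epsilon>\<^sub>0>0. \<forall>\<epsilon>. 0 < \<epsilon> \<and> \<epsilon> < \<epsilon>\<^sub>0 \<longrightarrow>
    (\<exists>A>0. \<exists>B>0. \<forall>(j::nat) (k::int^'d).
       ennreal (A * 2 powr (- (real j * \<epsilon>)) *
         2 powr (real j * real CARD('d) * p * (1/2 - 1 / beta_lower \<Psi>)))
         \<le> abs_moment M p (pairing M w (rescaled \<psi> j k)) \<and>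
       abs_moment M p (pairing M w (rescaled \<psi> j k))
         \<le> ennreal (B * 2 powr (real j * \<epsilon>) *
         2 powr (real j * real CARD('d) * p * (1/2 - 1 / beta_upper \<Psi>))))"
proof (rule exI[of _ 1], intro conjI allI impI)
  interpret levy_noise M w \<Psi> by (rule levy_noiseI[OF assms(1,3)])
  let ?D = "real CARD('d)" and ?\<beta> = "beta_upper \<Psi>" and ?\<gamma> = "beta_lower \<Psi>"
  obtain b where b: "\<And>x. \<bar>\<psi> x\<bar> \<le> b"
    using assms(9) by (auto simp: bounded_iff)
  have "bounded {x. \<psi> x \<noteq> 0}"
    using assms(10) compact_imp_bounded bounded_subset closure_subset by blast
  then obtain r where r: "0 < r" "\<And>x. \<psi> x \<noteq> 0 \<Longrightarrow> norm x \<le> r"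
    unfolding bounded_pos by auto
  have r': "\<psi> x = 0" if "r < norm x" for x using r(2)[of x] that by force
  note \<psi> = assms(8) b r(1) r'
  have \<beta>: "0 < ?\<beta>" "?\<beta> \<le> 2" using assms(5,6) beta_upper_le_2 by auto
  have p: "0 < p" "p < 2" using assms(12,13) \<beta> by auto
  \<comment> \<open>Lying strictly below the supremum \<open>p_max\<close> gives an actual exponent
    above the upper index with a finite moment.\<close>
  obtain q' where q': "?\<beta> < q'" "abs_moment M q' unit_cube_pairing < \<infinity>"
    using assms(7) unfolding p_max_def less_Sup_iff unit_cube_pairing_def by auto
  show "0 < (1::real)" by simp
  fix \<epsilon> :: real assume "0 < \<epsilon> \<and> \<epsilon> < 1"
  \<comment> \<open>Changing 1/q by at most \<delta> changes the exponent j d p (1/2 - 1/q) by at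
    most j \<epsilon>. The exponents q and s, and with them A and B, are chosen after \<epsilon>, so
    the witness 1 for its upper limit is arbitrary.\<close>
  define \<delta> where "\<delta> = \<epsilon> / (p * ?D)"
  have \<delta>: "0 < \<delta>" "\<delta> * (p * ?D) = \<epsilon>" using \<open>0 < \<epsilon> \<and> \<epsilon> < 1\<close> p by (auto simp: \<delta>_def)
  have exponent: "real j * ?D * p * x \<le> real j * \<epsilon> + real j * ?D * p * y" if "x - y \<le> \<delta>" for x y j
  proof -
    have "real j * ?D * p * (x - y) \<le> real j * ?D * p * \<delta>" using that p by (intro mult_left_mono) auto
    also have "\<dots> = real j * \<epsilon>" by (simp add: mult_ac flip: \<delta>(2))
    finally show ?thesis by (simp add: algebra_simps)
  qed

  obtain q where q: "?\<beta> \<le> q" "q \<le> 2" "q \<le> q'" "?\<beta> < q \<or> q = 2" "1 / ?\<beta> - 1 / q \<le> \<delta>"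
    using exists_upper_exponent[OF \<beta> q'(1) \<delta>(1)] by blast
  have q0: "0 < q" "p < q" using q(1) \<beta>(1) assms(13) by auto
  have "abs_moment M q unit_cube_pairing < \<infinity>"
    by (rule abs_moment_mono_finite[OF assms(1) unit_cube_pairing_measurable q0(1) q(3) q'(2)])
  from \<Psi>_le_powr[OF assms(4) q0(1) q(2,4) this]
  obtain C where C: "0 < C" "\<And>\<xi>. cmod (\<Psi> \<xi>) \<le> C * \<bar>\<xi>\<bar> powr q" by blast
  obtain B where B: "0 < B" "\<And>j k. abs_moment M p (pairing M w (rescaled \<psi> j k)) \<le>
      ennreal (B * 2 powr (real j * ?D * p * (1 / 2 - 1 / q)))"
    using rescaled_moment_upper[OF \<psi> p(1) q0(2) p(2) C] by blast
  have upper: "abs_moment M p (pairing M w (rescaled \<psi> j k))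
      \<le> ennreal (B * 2 powr (real j * \<epsilon>) * 2 powr (real j * ?D * p * (1/2 - 1 / ?\<beta>)))" for j k
  proof -
    have "2 powr (real j * ?D * p * (1 / 2 - 1 / q)) \<le> 2 powr (real j * \<epsilon> + real j * ?D * p * (1/2 - 1 / ?\<beta>))"
      by (intro powr_mono exponent) (use q(5) in auto)
    then show ?thesis
      using B(1) by (intro order_trans[OF B(2)] ennreal_leI) (simp add: powr_add mult.assoc)
  qed

  obtain s where s: "0 < s" "s < ?\<gamma>" "1 / s - 1 / ?\<gamma> \<le> \<delta>"
    using exists_lower_exponent[OF assms(5) \<delta>(1)] by blast
  from Re_\<Psi>_ge_powr[OF assms(4) s(1,2)]
  obtain c R where c: "0 < c" and R: "0 < R" "\<And>\<xi>. R \<le> \<bar>\<xi>\<bar> \<Longrightarrow> c * \<bar>\<xi>\<bar> powr s \<le> - Re (\<Psi> \<xi>)" by blast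
  obtain A where A: "0 < A" "\<And>j k. ennreal (A * 2 powr (real j * ?D * p * (1 / 2 - 1 / s))) \<le>
      abs_moment M p (pairing M w (rescaled \<psi> j k))"
    using rescaled_moment_lower[OF \<psi> assms(11) p s(1) c R] by blast
  have lower: "ennreal (A * 2 powr (- (real j * \<epsilon>)) * 2 powr (real j * ?D * p * (1/2 - 1 / ?\<gamma>)))
      \<le> abs_moment M p (pairing M w (rescaled \<psi> j k))" for j k
  proof -
    have "real j * ?D * p * (1/2 - 1 / ?\<gamma>) \<le> real j * \<epsilon> + real j * ?D * p * (1/2 - 1 / s)"
      by (rule exponent) (use s(3) in auto)
    then have "2 powr (- (real j * \<epsilon>)) * 2 powr (real j * ?D * p * (1/2 - 1 / ?\<gamma>)) \<le> 2 powr (real j * ?D * p * (1 / 2 - 1 / s))"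
      unfolding powr_add[symmetric] by (intro powr_mono) auto
    from mult_left_mono[OF this less_imp_le[OF A(1)]] show ?thesis
      by (intro order_trans[OF _ A(2)] ennreal_leI) (simp only: mult.assoc)
  qed
  show "\<exists>A>0. \<exists>B>0. \<forall>(j::nat) (k::int^'d).
       ennreal (A * 2 powr (- (real j * \<epsilon>)) *
         2 powr (real j * real CARD('d) * p * (1/2 - 1 / beta_lower \<Psi>)))
         \<le> abs_moment M p (pairing M w (rescaled \<psi> j k)) \<and>
       abs_moment M p (pairing M w (rescaled \<psi> j k))
         \<le> ennreal (B * 2 powr (real j * \<epsilon>) *
         2 powr (real j * real CARD('d) * p * (1/2 - 1 / beta_upper \<Psi>)))"
    using A(1) B(1) upper lower by blast
qed

end
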